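(* Let $(a_n)_{n\in\mathbb Z}$ (death rates) and $(b_n)_{n\in\mathbb Z}$ (birth rates) be positive real numbers, and let $\mathcal L$ be the generator of the birth-death process on $\mathbb Z$ which jumps from $n$ to $n+1$ at rate $b_n$ and from $n$ to $n-1$ at rate $a_n$. Assume that $\mathcal L$ is nonexplosive and positive recurrent, let $\mu$ be its stationary distribution, i.e. the probability measure on $\mathbb Z$ with $\mu(n)b_n=\mu(n+1)a_{n+1}$ for all $n\in\mathbb Z$ (so that moreover $\sum_{i\ge 0}\frac1{b_i\mu(i)}=\sum_{i\le 0}\frac{1}{b_i\mu(i)}=\infty$), and assume $\sum_{n\in\mathbb Z}\mu(n)b_n<\infty$. Then there exists a finite strong stationary time for the Markov process $X$ with generator $\mathcal L$, whatever its initial distribution, if and only if $$\sum_{i=1}^{\infty}\mu(i+1)\sum_{j=1}^{i}\frac{1}{\mu(j)b_j}<\infty\qquad\text{and}\qquad \sum_{i=1}^{\infty}\mu(-i-1)\sum_{j=1}^{i}\frac{1}{\mu(-j)a_{-j}}<\infty .$$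
   Context: Let $\mathcal F^X_t$ be the filtration generated by $X$ and $\mathcal F^X_\infty=\bigvee_t\mathcal F^X_t$. A random time $T\in[0,\infty]$ is a randomized stopping time relative to $X$ if there is a $\sigma$-algebra $\mathcal G$ independent of $\mathcal F^X_\infty$ such that $T$ is a stopping time with respect to $(\sigma(\mathcal F^X_t,\mathcal G))_{t\ge 0}$. A strong stationary time of $X$ is a randomized stopping time $T$ relative to $X$ such that, on $\{T<\infty\}$, the conditional law of $X_T$ given $T$ is $\mu$. It is finite if $T<\infty$ almost surely. The underlying probability space is assumed to be large enough (it may be enlarged by random variables independent of $X$). Nonexplosive means that the jump times of the process tend to infinity almost surely for every initial distribution. *)

theory Defs
  imports "HOL-Probability.Probability"
begin

section \<open>Continuous-time Markov chains on the integers\<close>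

text \<open>Generators are represented by their matrix of rates \<open>Q\<close>.\<close>

definition bd_generator :: "(int \<Rightarrow> real) \<Rightarrow> (int \<Rightarrow> real) \<Rightarrow> int \<Rightarrow> int \<Rightarrow> real" where
  "bd_generator a b i j =
     (if j = i + 1 then b i
      else if j = i - 1 then a i
      else if j = i then - (a i + b i)
      else 0)"

definition jump_prob :: "(int \<Rightarrow> int \<Rightarrow> real) \<Rightarrow> int \<Rightarrow> int \<Rightarrow> real" where
  "jump_prob Q i j = (if j = i then 0 else Q i j / (- Q i i))"

text \<open>
  \<open>jump_hold Q \<nu> M Y S\<close>: the sequence \<open>Y\<close> of successively visited states is a Markov chain with
  initial law \<open>\<nu>\<close> and transition probabilities \<open>jump_prob Q\<close> and, given \<open>Y\<close>, the holding times
  \<open>S k\<close> are independent and exponentially distributed with rates \<open>- Q (Y k) (Y k)\<close>.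
  The events below form a \<open>\<pi>\<close>-system, so this determines the joint law of \<open>(Y, S)\<close>.
\<close>
definition jump_hold ::
    "(int \<Rightarrow> int \<Rightarrow> real) \<Rightarrow> int pmf \<Rightarrow> 'a measure \<Rightarrow>
     (nat \<Rightarrow> 'a \<Rightarrow> int) \<Rightarrow> (nat \<Rightarrow> 'a \<Rightarrow> real) \<Rightarrow> bool" where
  "jump_hold Q \<nu> M Y S \<longleftrightarrow>
     prob_space M \<and>
     (\<forall>k. Y k \<in> measurable M (count_space UNIV)) \<and>
     (\<forall>k. S k \<in> borel_measurable M) \<and>
     (\<forall>n y s. (\<forall>k\<le>n. 0 \<le> s k) \<longrightarrow>
        measure M {\<omega> \<in> space M. \<forall>k\<le>n. Y k \<omega> = y k \<and> s k < S k \<omega>} =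
          pmf \<nu> (y 0) * (\<Prod>k<n. jump_prob Q (y k) (y (Suc k))) * (\<Prod>k\<le>n. exp (Q (y k) (y k) * s k)))"

definition jump_time :: "(nat \<Rightarrow> 'a \<Rightarrow> real) \<Rightarrow> nat \<Rightarrow> 'a \<Rightarrow> real" where
  "jump_time S n \<omega> = (\<Sum>k<n. S k \<omega>)"

text \<open>
  The next two notions depend on the law of \<open>(Y, S)\<close> only. They are therefore stated for
  realisations on the space of sequences of pairs (state, holding time), to which every
  realisation can be transported.
\<close>
definition nonexplosive :: "(int \<Rightarrow> int \<Rightarrow> real) \<Rightarrow> bool" where
  "nonexplosive Q \<longleftrightarrow>
     (\<forall>\<nu> (M :: (nat \<Rightarrow> int \<times> real) measure) Y S. jump_hold Q \<nu> M Y S \<longrightarrow>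
        (AE \<omega> in M. filterlim (\<lambda>n. jump_time S n \<omega>) at_top sequentially))"

text \<open>
  First return time to \<open>i\<close>: as the holding times are almost surely positive, the infimum is
  attained at the first \<open>n > 0\<close> with \<open>Y n \<omega> = i\<close>; it is \<open>\<infinity>\<close> if there is no such \<open>n\<close>.
\<close>
definition return_time :: "(nat \<Rightarrow> 'a \<Rightarrow> int) \<Rightarrow> (nat \<Rightarrow> 'a \<Rightarrow> real) \<Rightarrow> int \<Rightarrow> 'a \<Rightarrow> ennreal" where
  "return_time Y S i \<omega> = (INF n\<in>{n. 0 < n \<and> Y n \<omega> = i}. ennreal (jump_time S n \<omega>))"

definition positive_recurrent :: "(int \<Rightarrow> int \<Rightarrow> real) \<Rightarrow> bool" where
  "positive_recurrent Q \<longleftrightarrow>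
     (\<forall>i (M :: (nat \<Rightarrow> int \<times> real) measure) Y S. jump_hold Q (return_pmf i) M Y S \<longrightarrow>
        (\<integral>\<^sup>+ \<omega>. return_time Y S i \<omega> \<partial>M) < \<infinity>)"

text \<open>
  Only meaningful for nonexplosive \<open>Q\<close>, since \<open>X\<close> is not prescribed after an explosion.
  Right-continuity refers to the discrete topology of \<^typ>\<open>int\<close>.
\<close>
definition markov_process ::
    "(int \<Rightarrow> int \<Rightarrow> real) \<Rightarrow> int pmf \<Rightarrow> 'a measure \<Rightarrow> (real \<Rightarrow> 'a \<Rightarrow> int) \<Rightarrow> bool" where
  "markov_process Q \<nu> M X \<longleftrightarrow>
     prob_space M \<and>
     (\<forall>t\<ge>0. X t \<in> measurable M (count_space UNIV)) \<and>
     (\<forall>\<omega>\<in>space M. \<forall>t\<ge>0. continuous (at_right t) (\<lambda>s. X s \<omega>)) \<and>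
     (\<exists>Y S. jump_hold Q \<nu> M Y S \<and>
        (AE \<omega> in M. \<forall>n t. jump_time S n \<omega> \<le> t \<and> t < jump_time S (Suc n) \<omega> \<longrightarrow> X t \<omega> = Y n \<omega>))"


section \<open>Strong stationary times\<close>

text \<open>
  Filtrations are indexed by \<open>[0, \<infinity>]\<close>; the member at \<open>\<infinity>\<close> is generated by the whole process.
\<close>
definition natural_filtration :: "'a measure \<Rightarrow> (real \<Rightarrow> 'a \<Rightarrow> int) \<Rightarrow> ennreal \<Rightarrow> 'a measure" where
  "natural_filtration M X t =
     sigma (space M) {X s -` A \<inter> space M | s A. 0 \<le> s \<and> ennreal s \<le> t}"

definition randomized_stopping_time ::
    "'a measure \<Rightarrow> (real \<Rightarrow> 'a \<Rightarrow> int) \<Rightarrow> ('a \<Rightarrow> ennreal) \<Rightarrow> bool" where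
  "randomized_stopping_time M X T \<longleftrightarrow>
     (\<exists>G. subalgebra M G \<and>
        prob_space.indep_set M (sets G) (sets (natural_filtration M X \<infinity>)) \<and>
        stopping_time (\<lambda>t. sigma (space M) (sets (natural_filtration M X t) \<union> sets G)) T)"

text \<open>On the event \<open>T = \<infinity>\<close> the value of \<open>X\<close> at \<^term>\<open>enn2real (T \<omega>)\<close> is irrelevant below.\<close>
definition strong_stationary_time ::
    "int pmf \<Rightarrow> 'a measure \<Rightarrow> (real \<Rightarrow> 'a \<Rightarrow> int) \<Rightarrow> ('a \<Rightarrow> ennreal) \<Rightarrow> bool" where
  "strong_stationary_time \<mu> M X T \<longleftrightarrow>
     randomized_stopping_time M X T \<and>
     (\<forall>A. AE \<omega> in M. T \<omega> < \<infinity> \<longrightarrow>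
        real_cond_exp M (vimage_algebra (space M) T borel)
          (indicator {\<omega> \<in> space M. X (enn2real (T \<omega>)) \<omega> \<in> A}) \<omega> = measure_pmf.prob \<mu> A)"

definition finite_strong_stationary_time ::
    "int pmf \<Rightarrow> 'a measure \<Rightarrow> (real \<Rightarrow> 'a \<Rightarrow> int) \<Rightarrow> ('a \<Rightarrow> ennreal) \<Rightarrow> bool" where
  "finite_strong_stationary_time \<mu> M X T \<longleftrightarrow>
     strong_stationary_time \<mu> M X T \<and> (AE \<omega> in M. T \<omega> < \<infinity>)"

text \<open>
  The probability space carries external randomness: a random variable uniformly distributed on
  \<open>[0, 1]\<close> and independent of the process (from which a sequence of independent uniform variables
  can be extracted). A product with the unit interval always achieves this.
\<close>
definition large_enough :: "'a measure \<Rightarrow> (real \<Rightarrow> 'a \<Rightarrow> int) \<Rightarrow> bool" where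
  "large_enough M X \<longleftrightarrow>
     (\<exists>U \<in> borel_measurable M.
        distr M borel U = uniform_measure lborel {0..1::real} \<and>
        prob_space.indep_set M (sets (vimage_algebra (space M) U borel))
          (sets (natural_filtration M X \<infinity>)))"

end

theory Submission
  imports Defs
begin

text \<open>
  Both conditions are read off the resolvent \<open>R\<close> of the process, i.e. the Laplace transform in time
  of its transition function \<open>P\<close>, which inherits reversibility from the rates by induction over the number
  of jumps.

  If a finite strong stationary time \<open>T\<close> exists from \<open>0\<close>, the strong Markov property gives
  \<open>R(0, y) \<ge> E[exp (- T)] \<mu>(y)\<close>, hence \<open>R(y, 0)\<close> is bounded below uniformly in \<open>y\<close> by reversibility. Then
  \<open>- R(\<cdot>, 0)\<close>, suitably scaled, is a bounded function on which the generator is at most \<open>- 1\<close> outside \<open>0\<close>;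
  summing this inequality twice bounds both series.

  Conversely, both series being finite yields a bounded Lyapunov function, hence again a uniform lower
  bound on \<open>R(y, 0)\<close>. This passes to a fixed time: \<open>P\<^sub>\<tau>(x, y) \<ge> \<epsilon> \<mu>(y)\<close> for all \<open>x\<close> and \<open>y\<close>.
  Stopping at the multiples of \<open>\<tau>\<close> with conditional probability \<open>\<epsilon> \<mu>(y) / P\<^sub>\<tau>(x, y)\<close>, given the last two
  states \<open>x, y\<close> of the skeleton, produces a strong stationary time that is \<open>\<tau>\<close> times a geometric variable.
\<close>

section \<open>The law of jump chain and holding times\<close>

text \<open>The Laplace transform in time turns the convolution over successive holding times into
  an algebraic recursion in the number of jumps. Reversibility then is an identity between
  recursively defined weights, and the time axis is handled without any regularity of the transition
  function.

  In the direction from the series to the stationary time, the obstacle is that the rates are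
  unbounded in general, so waiting in an arbitrary state has no uniform cost. Passing from the
  resolvent to a fixed time therefore always waits in 0: a passage from x to 0 is followed by one
  from 0 to y, the latter being a time reversal of the former.

  In the other direction, \<mu>(n) b(n) acts as the conductance of the edge from n to n + 1. Its
  summability bounds it by a constant. If the weighted gradient of a bounded supersolution fell
  below the tail of \<mu>, it would stay negative further out, and bounded conductances would then
  force the supersolution to decrease linearly. This comparison of gradient and tail produces the
  series.\<close>

lemma emeasure_split_countable:
  fixes X :: "'a \<Rightarrow> 'b::countable"
  assumes "A \<in> sets M" "X \<in> measurable M (count_space UNIV)"
  shows "emeasure M A = (\<integral>\<^sup>+ i. emeasure M (A \<inter> {\<omega> \<in> space M. X \<omega> = i}) \<partial>count_space UNIV)"
proof -
  have "A = (\<Union>i\<in>UNIV. A \<inter> {\<omega> \<in> space M. X \<omega> = i})"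
    using sets.sets_into_space[OF assms(1)] by auto
  moreover have "emeasure M (\<Union>i\<in>UNIV. A \<inter> {\<omega> \<in> space M. X \<omega> = i}) =
      (\<integral>\<^sup>+ i. emeasure M (A \<inter> {\<omega> \<in> space M. X \<omega> = i}) \<partial>count_space UNIV)"
    using assms by (intro emeasure_UN_countable) (auto simp: disjoint_family_on_def)
  ultimately show ?thesis by simp
qed

text \<open>A Dynkin argument: both sides are finite measures in \<open>A\<close>. The space belongs
  to the generator so that complements can be subtracted, and \<open>c\<close> is finite so that
  multiplication distributes over that subtraction. It extends Markov identities from generating
  events to \<sigma>-algebras.\<close>

lemma (in finite_measure) emeasure_Int_eq_cmult_sigma_sets:
  assumes G: "Int_stable G" "G \<subseteq> sets M" "space M \<in> G"
    and P: "P1 \<in> sets M" "P2 \<in> sets M" and c: "c < \<infinity>"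
    and eq: "\<And>A. A \<in> G \<Longrightarrow> emeasure M (A \<inter> P1) = c * emeasure M (A \<inter> P2)"
    and A: "A \<in> sigma_sets (space M) G"
  shows "emeasure M (A \<inter> P1) = c * emeasure M (A \<inter> P2)"
proof -
  have sub: "sigma_sets (space M) G \<subseteq> sets M"
    using G(2) by (rule sets.sigma_sets_subset)
  have GP: "G \<subseteq> Pow (space M)" using G(2) sets.space_closed by blast
  show ?thesis
    using G(1) GP A
  proof (induction rule: sigma_sets_induct_disjoint)
    case (basic A) then show ?case using eq by auto
  next
    case empty then show ?case by simp
  next
    case (compl A)
    have Am: "A \<in> sets M" using compl sub by auto
    have sp: "emeasure M (space M \<inter> P1) = c * emeasure M (space M \<inter> P2)" using eq G(3) by auto
    have d: "emeasure M ((space M - A) \<inter> P) = emeasure M (space M \<inter> P) - emeasure M (A \<inter> P)"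
      if "P \<in> sets M" for P
    proof -
      have "(space M - A) \<inter> P = (space M \<inter> P) - (A \<inter> P)" by auto
      then show ?thesis using that Am sets.sets_into_space[OF Am]
        by (simp add: emeasure_Diff Int_mono)
    qed
    have "emeasure M ((space M - A) \<inter> P1) = c * emeasure M (space M \<inter> P2) - c * emeasure M (A \<inter> P2)"
      using d[OF P(1)] sp compl by simp
    also have "\<dots> = c * emeasure M ((space M - A) \<inter> P2)"
      unfolding d[OF P(2)] using c by (intro ennreal_right_diff_distrib[symmetric]) simp
    finally show ?case .
  next
    case (union D)
    have Dm: "\<And>i. D i \<in> sets M" using union sub by auto
    have s: "emeasure M (\<Union>(range D) \<inter> P) = (\<Sum>i. emeasure M (D i \<inter> P))" if "P \<in> sets M" for P
    proof -
      have "\<Union>(range D) \<inter> P = (\<Union>i. D i \<inter> P)" by auto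
      also have "emeasure M \<dots> = (\<Sum>i. emeasure M (D i \<inter> P))"
        using Dm that union(1) by (intro suminf_emeasure[symmetric]) (auto simp: disjoint_family_on_def)
      finally show ?thesis .
    qed
    show ?case using s[OF P(1)] s[OF P(2)] union by simp
  qed
qed

section \<open>Rates, jump probabilities and realisations of the chain\<close>

locale bd_rates =
  fixes a b :: "int \<Rightarrow> real"
  assumes a_pos: "\<And>n. 0 < a n" and b_pos: "\<And>n. 0 < b n"
begin

definition rate :: "int \<Rightarrow> real" where "rate x = a x + b x"

lemma rate_pos: "0 < rate x"
  using a_pos b_pos by (simp add: rate_def add_pos_pos)

abbreviation J :: "int \<Rightarrow> int \<Rightarrow> real" where "J \<equiv> jump_prob (bd_generator a b)"

lemma generator_diag [simp]: "bd_generator a b x x = - rate x"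
  by (simp add: bd_generator_def rate_def)

lemma J_up: "J x (x + 1) = b x / rate x"
  by (simp add: jump_prob_def bd_generator_def rate_def)

lemma J_down: "J x (x - 1) = a x / rate x"
  by (simp add: jump_prob_def bd_generator_def rate_def)

lemma J_other: "z \<noteq> x + 1 \<Longrightarrow> z \<noteq> x - 1 \<Longrightarrow> J x z = 0"
  by (simp add: jump_prob_def bd_generator_def)

lemma J_nonneg: "0 \<le> J x z"
  using a_pos[of x] b_pos[of x] by (auto simp: jump_prob_def bd_generator_def)

lemma J_sum: "J x (x + 1) + J x (x - 1) = 1"
  using rate_pos[of x] by (simp add: J_up J_down add_divide_distrib[symmetric]) (simp add: rate_def)

end

locale bd_realisation = bd_rates a b + prob_space M
  for a b and M :: "'a measure" +
  fixes \<nu> :: "int pmf" and Y :: "nat \<Rightarrow> 'a \<Rightarrow> int" and S :: "nat \<Rightarrow> 'a \<Rightarrow> real"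
  assumes jump_hold: "jump_hold (bd_generator a b) \<nu> M Y S"
begin

lemma Y_measurable [measurable]: "Y k \<in> measurable M (count_space UNIV)"
  and S_measurable [measurable]: "S k \<in> borel_measurable M"
  using jump_hold by (auto simp: jump_hold_def)

lemma emeasure_cylinder:
  assumes "\<And>k. k \<le> n \<Longrightarrow> 0 \<le> s k"
  shows "emeasure M {\<omega> \<in> space M. \<forall>k\<le>n. Y k \<omega> = y k \<and> s k < S k \<omega>} =
    ennreal (pmf \<nu> (y 0) * (\<Prod>k<n. J (y k) (y (Suc k))) * (\<Prod>k\<le>n. exp (- rate (y k) * s k)))"
  using jump_hold assms by (simp add: jump_hold_def emeasure_eq_measure)

text \<open>\<open>jump_hold\<close> prescribes the probabilities of cylinders with strict bounds on
  the holding times, so positivity is a matter of total mass: the cylinders with all bounds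
  \<open>0\<close> already carry probability 1. The induction compares the event of a path with its
  continuations by a positive holding time.\<close>

lemma AE_S_pos: "AE \<omega> in M. \<forall>k. 0 < S k \<omega>"
proof -
  have "AE \<omega> in M. \<forall>k\<le>n. 0 < S k \<omega>" for n
  proof (induction n)
    case 0
    have "emeasure M {\<omega> \<in> space M. 0 < S 0 \<omega>} =
        (\<integral>\<^sup>+ i. emeasure M ({\<omega> \<in> space M. 0 < S 0 \<omega>} \<inter> {\<omega> \<in> space M. Y 0 \<omega> = i}) \<partial>count_space UNIV)"
      by (intro emeasure_split_countable) auto
    also have "\<dots> = (\<integral>\<^sup>+ i. pmf \<nu> i \<partial>count_space UNIV)"
    proof (intro nn_integral_cong)
      fix i
      have "{\<omega> \<in> space M. 0 < S 0 \<omega>} \<inter> {\<omega> \<in> space M. Y 0 \<omega> = i} =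
        {\<omega> \<in> space M. \<forall>k\<le>0. Y k \<omega> = (\<lambda>_. i) k \<and> (\<lambda>_. 0) k < S k \<omega>}" by auto
      then show "emeasure M ({\<omega> \<in> space M. 0 < S 0 \<omega>} \<inter> {\<omega> \<in> space M. Y 0 \<omega> = i}) = ennreal (pmf \<nu> i)"
        using emeasure_cylinder[of 0 "\<lambda>_. 0" "\<lambda>_. i"] by simp
    qed
    also have "\<dots> = 1" using measure_pmf.emeasure_space_1[of \<nu>] by (simp add: nn_integral_pmf)
    finally have "prob {\<omega> \<in> space M. 0 < S 0 \<omega>} = 1" by (simp add: measure_def)
    then show ?case by (subst (asm) prob_Collect_eq_1) auto
  next
    case (Suc n)
    have "AE \<omega> in M. map (\<lambda>k. Y k \<omega>) [0..<Suc n] = l \<longrightarrow> 0 < S (Suc n) \<omega>" for l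
    proof -
      define y where "y = (!) l"
      define B where "B = {\<omega> \<in> space M. \<forall>k\<le>n. Y k \<omega> = y k}"
      define C where "C z = {\<omega> \<in> space M. \<forall>k\<le>Suc n. Y k \<omega> = (y(Suc n := z)) k \<and> 0 < S k \<omega>}" for z
      define w where "w = pmf \<nu> (y 0) * (\<Prod>k<n. J (y k) (y (Suc k)))"
      have w0: "0 \<le> w" unfolding w_def by (auto intro!: mult_nonneg_nonneg prod_nonneg J_nonneg)
      have [measurable]: "B \<in> sets M" "C z \<in> sets M" for z by (auto simp: B_def C_def)
      have "emeasure M B = emeasure M {\<omega> \<in> space M. \<forall>k\<le>n. Y k \<omega> = y k \<and> 0 < S k \<omega>}"
        unfolding B_def
      proof (rule emeasure_eq_AE)
        show "AE \<omega> in M. (\<omega> \<in> {\<omega> \<in> space M. \<forall>k\<le>n. Y k \<omega> = y k}) =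
            (\<omega> \<in> {\<omega> \<in> space M. \<forall>k\<le>n. Y k \<omega> = y k \<and> 0 < S k \<omega>})"
          using Suc by eventually_elim blast
      qed auto
      also have "\<dots> = ennreal w"
        using emeasure_cylinder[of n "\<lambda>_. 0" y] by (simp add: w_def)
      finally have B: "emeasure M B = ennreal w" .
      have C: "emeasure M (C z) = ennreal (w * J (y n) z)" for z
      proof -
        have "(\<Prod>k<n. J ((y(Suc n := z)) k) ((y(Suc n := z)) (Suc k))) = (\<Prod>k<n. J (y k) (y (Suc k)))"
          by (intro prod.cong) auto
        then show ?thesis
          using emeasure_cylinder[of "Suc n" "\<lambda>_. 0" "y(Suc n := z)"] by (simp add: w_def C_def mult_ac)
      qed
      \<comment> \<open>The jump probabilities to the two neighbours add up to 1, so
        \<open>D\<close> exhausts \<open>B\<close> up to a null set.\<close>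
      define D where "D = C (y n + 1) \<union> C (y n - 1)"
      have [measurable]: "D \<in> sets M" by (simp add: D_def)
      have "emeasure M D = emeasure M (C (y n + 1)) + emeasure M (C (y n - 1))"
        unfolding D_def by (intro plus_emeasure[symmetric]) (auto simp: C_def)
      also have "\<dots> = ennreal (w * J (y n) (y n + 1) + w * J (y n) (y n - 1))"
        unfolding C by (intro ennreal_plus[symmetric] mult_nonneg_nonneg w0 J_nonneg)
      also have "\<dots> = ennreal w"
        unfolding distrib_left[symmetric] J_sum by simp
      finally have D: "emeasure M D = ennreal w" .
      have "D \<subseteq> B" by (auto simp: D_def B_def C_def)
      then have "emeasure M (B - D) = 0"
        using B D by (subst emeasure_Diff) auto
      then have "AE \<omega> in M. \<omega> \<notin> B - D"
        by (intro AE_not_in) (auto simp: null_sets_def)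
      with AE_space show ?thesis
      proof eventually_elim
        case (elim \<omega>)
        show ?case
        proof (intro impI)
          assume l: "map (\<lambda>k. Y k \<omega>) [0..<Suc n] = l"
          have "Y k \<omega> = y k" if "k \<le> n" for k
            using that unfolding y_def l[symmetric] by (simp del: upt_Suc)
          then have "\<omega> \<in> B" using elim(1) by (simp add: B_def)
          then have "\<omega> \<in> D" using elim(2) by blast
          then show "0 < S (Suc n) \<omega>" by (auto simp: D_def C_def)
        qed
      qed
    qed
    then have "AE \<omega> in M. \<forall>l. map (\<lambda>k. Y k \<omega>) [0..<Suc n] = l \<longrightarrow> 0 < S (Suc n) \<omega>"
      by (simp only: AE_all_countable) simp
    with Suc show ?case
    proof eventually_elim
      case (elim \<omega>)
      then show ?case by (metis le_Suc_eq)
    qed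
  qed
  then have "AE \<omega> in M. \<forall>n. \<forall>k\<le>n. 0 < S k \<omega>" by (simp only: AE_all_countable) simp
  then show ?thesis by (rule AE_mp) (rule AE_I2, blast)
qed

text \<open>Both sides are cylinder probabilities, and they differ by the factors of the last step.
  A bound \<open>- \<infinity>\<close> imposes no condition on a holding time, although the cylinder
  formula needs nonnegative bounds.\<close>

lemma emeasure_path_step:
  fixes s :: "nat \<Rightarrow> ereal"
  assumes r: "0 \<le> r"
  shows "emeasure M {\<omega> \<in> space M. (\<forall>k\<le>n. Y k \<omega> = y k) \<and> (\<forall>k<n. s k < ereal (S k \<omega>)) \<and> r < S n \<omega> \<and> Y (Suc n) \<omega> = z} =
    ennreal (exp (- rate (y n) * r) * J (y n) z) *
    emeasure M {\<omega> \<in> space M. (\<forall>k\<le>n. Y k \<omega> = y k) \<and> (\<forall>k<n. s k < ereal (S k \<omega>))}"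
proof (cases "\<exists>k<n. s k = \<infinity>")
  case True
  then have "\<not> (\<forall>k<n. s k < ereal (S k \<omega>))" for \<omega> by auto
  then show ?thesis by (simp add: not_all[symmetric] del: not_all)
next
  case False
  \<comment> \<open>Bounds below \<open>0\<close>, including \<open>- \<infinity>\<close>, become
    \<open>0\<close>; this changes the events by a null set because the holding times are
    positive.\<close>
  define s' where "s' k = max 0 (real_of_ereal (s k))" for k
  have s': "s k < ereal u \<longleftrightarrow> s' k < u" if "k < n" "0 < u" for k u
    using False that by (cases "s k") (auto simp: s'_def)
  define w where "w = pmf \<nu> (y 0) * (\<Prod>k<n. J (y k) (y (Suc k))) * (\<Prod>k<n. exp (- rate (y k) * s' k))"
  have w0: "0 \<le> w" unfolding w_def by (auto intro!: mult_nonneg_nonneg prod_nonneg J_nonneg)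
  have "emeasure M {\<omega> \<in> space M. (\<forall>k\<le>n. Y k \<omega> = y k) \<and> (\<forall>k<n. s k < ereal (S k \<omega>))} =
    emeasure M {\<omega> \<in> space M. \<forall>k\<le>n. Y k \<omega> = y k \<and> (s'(n := 0)) k < S k \<omega>}"
    by (rule emeasure_eq_AE) (use AE_S_pos in eventually_elim, auto simp: s' le_less)
  also have "\<dots> = ennreal w"
    by (subst emeasure_cylinder)
       (auto simp: s'_def[symmetric] w_def lessThan_Suc_atMost[symmetric] intro!: arg_cong[where f=ennreal] arg_cong2[where f="(*)"] prod.cong, simp add: s'_def)
  finally have 1: "emeasure M {\<omega> \<in> space M. (\<forall>k\<le>n. Y k \<omega> = y k) \<and> (\<forall>k<n. s k < ereal (S k \<omega>))} = ennreal w" .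
  \<comment> \<open>The new coordinate \<open>Suc n\<close> gets the bound \<open>0\<close>, almost
    surely no condition, so that \<open>r < S n\<close> is the only bound added.\<close>
  let ?y = "y(Suc n := z)" and ?s = "s'(n := r, Suc n := 0)"
  have "emeasure M {\<omega> \<in> space M. (\<forall>k\<le>n. Y k \<omega> = y k) \<and> (\<forall>k<n. s k < ereal (S k \<omega>)) \<and> r < S n \<omega> \<and> Y (Suc n) \<omega> = z} =
    emeasure M {\<omega> \<in> space M. \<forall>k\<le>Suc n. Y k \<omega> = ?y k \<and> ?s k < S k \<omega>}"
    by (rule emeasure_eq_AE) (use AE_S_pos in eventually_elim, auto simp: s' le_less less_Suc_eq)
  also have "\<dots> = ennreal (pmf \<nu> (?y 0) * (\<Prod>k<Suc n. J (?y k) (?y (Suc k))) * (\<Prod>k\<le>Suc n. exp (- rate (?y k) * ?s k)))"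
    by (rule emeasure_cylinder) (use r in \<open>auto simp: s'_def\<close>)
  also have "(\<Prod>k<Suc n. J (?y k) (?y (Suc k))) = (\<Prod>k<n. J (y k) (y (Suc k))) * J (y n) z"
    by (auto intro!: prod.cong)
  also have "(\<Prod>k\<le>Suc n. exp (- rate (?y k) * ?s k)) = (\<Prod>k<n. exp (- rate (y k) * s' k)) * exp (- rate (y n) * r)"
    by (auto intro!: prod.cong simp: lessThan_Suc_atMost[symmetric])
  finally show ?thesis
    using w0 J_nonneg by (simp add: 1 ennreal_mult[symmetric]) (simp add: w_def mult_ac)
qed


text \<open>
  \<open>past n\<close> is generated by \<open>Y 0, \<dots>, Y n\<close> and \<open>S 0, \<dots>, S (n - 1)\<close>; the bounds \<open>s k\<close> are
  extended reals, so that \<open>- \<infinity>\<close> stands for no condition on \<open>S k\<close>.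
\<close>

definition past_gen :: "nat \<Rightarrow> 'a set set" where
  "past_gen n = {{\<omega> \<in> space M. map (\<lambda>k. Y k \<omega>) [0..<Suc n] \<in> B \<and> (\<forall>k<n. s k < ereal (S k \<omega>))} | B s. True}"

definition past :: "nat \<Rightarrow> 'a measure" where
  "past n = sigma (space M) (past_gen n)"

lemma measurable_map_upt:
  fixes Z :: "nat \<Rightarrow> 'b \<Rightarrow> 'c::countable"
  assumes "\<And>k. k < n \<Longrightarrow> Z k \<in> measurable N (count_space UNIV)"
  shows "(\<lambda>\<omega>. map (\<lambda>k. Z k \<omega>) [0..<n]) \<in> measurable N (count_space UNIV)"
  using assms
proof (induction n)
  case (Suc n)
  have [measurable]: "Z n \<in> measurable N (count_space UNIV)" using Suc.prems by simp
  have "(\<lambda>\<omega>. map (\<lambda>k. Z k \<omega>) [0..<n] @ [Z n \<omega>]) \<in> measurable N (count_space UNIV)"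
    by (rule measurable_compose_countable[OF _ Suc.IH]) (measurable, use Suc.prems in simp)
  then show ?case by simp
qed simp

lemma map_Y_measurable [measurable]:
  "(\<lambda>\<omega>. map (\<lambda>k. Y k \<omega>) [0..<n]) \<in> measurable M (count_space UNIV)"
  by (intro measurable_map_upt) simp

lemma past_gen_subset: "past_gen n \<subseteq> sets M"
  by (auto simp: past_gen_def simp del: upt_Suc)

lemma Int_stable_past_gen: "Int_stable (past_gen n)"
proof (rule Int_stableI)
  fix E F assume "E \<in> past_gen n" "F \<in> past_gen n"
  then obtain B s B' s' where
    "E = {\<omega> \<in> space M. map (\<lambda>k. Y k \<omega>) [0..<Suc n] \<in> B \<and> (\<forall>k<n. s k < ereal (S k \<omega>))}"
    "F = {\<omega> \<in> space M. map (\<lambda>k. Y k \<omega>) [0..<Suc n] \<in> B' \<and> (\<forall>k<n. s' k < ereal (S k \<omega>))}"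
    unfolding past_gen_def by blast
  then have "E \<inter> F = {\<omega> \<in> space M. map (\<lambda>k. Y k \<omega>) [0..<Suc n] \<in> B \<inter> B' \<and>
      (\<forall>k<n. max (s k) (s' k) < ereal (S k \<omega>))}"
    by auto
  then show "E \<inter> F \<in> past_gen n" unfolding past_gen_def
    by (intro CollectI exI[of _ "B \<inter> B'"] exI[of _ "\<lambda>k. max (s k) (s' k)"]) simp
qed

lemma space_in_past_gen: "space M \<in> past_gen n"
  unfolding past_gen_def by (intro CollectI exI[of _ UNIV] exI[of _ "\<lambda>_. -\<infinity>"]) simp

lemma sets_past: "sets (past n) = sigma_sets (space M) (past_gen n)"
  using past_gen_subset sets.space_closed unfolding past_def by (intro sets_measure_of) blast

lemma space_past [simp]: "space (past n) = space M"
  using past_gen_subset sets.space_closed unfolding past_def by (intro space_measure_of) blast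

lemma past_subset: "sets (past n) \<subseteq> sets M"
  unfolding sets_past using past_gen_subset by (rule sets.sigma_sets_subset)

lemma measurable_past: "f \<in> measurable (past n) N \<Longrightarrow> f \<in> measurable M N"
  using past_subset unfolding measurable_def by auto

lemma Y_measurable_past:
  assumes "k \<le> n" shows "Y k \<in> measurable (past n) (count_space UNIV)"
proof (rule measurableI)
  fix A
  have "Y k -` A \<inter> space (past n) = {\<omega> \<in> space M. map (\<lambda>k. Y k \<omega>) [0..<Suc n] \<in> {l. l ! k \<in> A} \<and>
      (\<forall>k<n. - \<infinity> < ereal (S k \<omega>))}"
    using assms by (auto simp del: upt_Suc)
  also have "\<dots> \<in> past_gen n"
    unfolding past_gen_def by (intro CollectI exI[of _ "{l. l ! k \<in> A}"] exI[of _ "\<lambda>_. -\<infinity>"]) simp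
  finally show "Y k -` A \<inter> space (past n) \<in> sets (past n)" by (auto simp: sets_past)
qed simp

lemma S_measurable_past:
  assumes "k < n" shows "S k \<in> borel_measurable (past n)"
proof (subst borel_measurable_iff_greater, intro allI)
  fix u
  have "{\<omega> \<in> space (past n). u < S k \<omega>} = {\<omega> \<in> space M. map (\<lambda>k. Y k \<omega>) [0..<Suc n] \<in> UNIV \<and>
      (\<forall>j<n. ((\<lambda>_. -\<infinity>)(k := ereal u)) j < ereal (S j \<omega>))}"
    using assms by (auto simp del: upt_Suc)
  also have "\<dots> \<in> past_gen n"
    unfolding past_gen_def by blast
  finally show "{\<omega> \<in> space (past n). u < S k \<omega>} \<in> sets (past n)" by (auto simp: sets_past)
qed

text \<open>Splitting a generating event by the list of visited states reduces the claim to
  \<open>emeasure_path_step\<close>, whose factor depends on the path through its last state alone.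
  This is the Markov property of the chain at its \<open>n\<close>-th jump.\<close>

lemma emeasure_past_step:
  assumes E: "E \<in> sets (past n)" and r: "0 \<le> r"
  shows "emeasure M (E \<inter> {\<omega> \<in> space M. Y n \<omega> = x \<and> r < S n \<omega> \<and> Y (Suc n) \<omega> = z}) =
    ennreal (exp (- rate x * r) * J x z) * emeasure M (E \<inter> {\<omega> \<in> space M. Y n \<omega> = x})"
proof (rule emeasure_Int_eq_cmult_sigma_sets[OF Int_stable_past_gen past_gen_subset space_in_past_gen])
  show "E \<in> sigma_sets (space M) (past_gen n)" using E by (simp add: sets_past)
  fix E assume "E \<in> past_gen n"
  then obtain B s where E: "E = {\<omega> \<in> space M. map (\<lambda>k. Y k \<omega>) [0..<Suc n] \<in> B \<and> (\<forall>k<n. s k < ereal (S k \<omega>))}"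
    unfolding past_gen_def by blast
  define L where "L \<omega> = map (\<lambda>k. Y k \<omega>) [0..<Suc n]" for \<omega>
  have [measurable]: "L \<in> measurable M (count_space UNIV)" unfolding L_def by measurable
  have [measurable]: "E \<in> sets M" unfolding E by (simp del: upt_Suc)
  let ?A = "{\<omega> \<in> space M. Y n \<omega> = x \<and> r < S n \<omega> \<and> Y (Suc n) \<omega> = z}" and ?A' = "{\<omega> \<in> space M. Y n \<omega> = x}"
  let ?c = "ennreal (exp (- rate x * r) * J x z)"
  have "emeasure M (E \<inter> ?A) = (\<integral>\<^sup>+ l. emeasure M (E \<inter> ?A \<inter> {\<omega> \<in> space M. L \<omega> = l}) \<partial>count_space UNIV)"
    by (intro emeasure_split_countable) auto
  also have "\<dots> = (\<integral>\<^sup>+ l. ?c * emeasure M (E \<inter> ?A' \<inter> {\<omega> \<in> space M. L \<omega> = l}) \<partial>count_space UNIV)"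
  proof (intro nn_integral_cong)
    fix l
    show "emeasure M (E \<inter> ?A \<inter> {\<omega> \<in> space M. L \<omega> = l}) = ?c * emeasure M (E \<inter> ?A' \<inter> {\<omega> \<in> space M. L \<omega> = l})"
    proof (cases "l \<in> B \<and> length l = Suc n \<and> l ! n = x")
      case True
      have L: "L \<omega> = l \<longleftrightarrow> (\<forall>k\<le>n. Y k \<omega> = l ! k)" for \<omega>
        using True unfolding L_def list_eq_iff_nth_eq by (auto simp: less_Suc_eq_le simp del: upt_Suc)
      have LB: "map (\<lambda>k. Y k \<omega>) [0..<Suc n] \<in> B" if "\<forall>k\<le>n. Y k \<omega> = l ! k" for \<omega>
        using that L[of \<omega>] True by (simp add: L_def)
      have 1: "E \<inter> ?A \<inter> {\<omega> \<in> space M. L \<omega> = l} = {\<omega> \<in> space M. (\<forall>k\<le>n. Y k \<omega> = l ! k) \<and>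
          (\<forall>k<n. s k < ereal (S k \<omega>)) \<and> r < S n \<omega> \<and> Y (Suc n) \<omega> = z}"
        using True LB unfolding E by (auto simp: L simp del: upt_Suc)
      have 2: "E \<inter> ?A' \<inter> {\<omega> \<in> space M. L \<omega> = l} = {\<omega> \<in> space M. (\<forall>k\<le>n. Y k \<omega> = l ! k) \<and>
          (\<forall>k<n. s k < ereal (S k \<omega>))}"
        using True LB unfolding E by (auto simp: L simp del: upt_Suc)
      show ?thesis unfolding 1 2 using emeasure_path_step[OF r, of n "(!) l" s z] True by simp
    next
      case False
      then have "E \<inter> ?A' \<inter> {\<omega> \<in> space M. L \<omega> = l} = {}"
        unfolding E by (auto simp: L_def simp del: upt_Suc)
      moreover then have "E \<inter> ?A \<inter> {\<omega> \<in> space M. L \<omega> = l} = {}" by auto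
      ultimately show ?thesis by (simp only: emeasure_empty mult_zero_right)
    qed
  qed
  also have "\<dots> = ?c * (\<integral>\<^sup>+ l. emeasure M (E \<inter> ?A' \<inter> {\<omega> \<in> space M. L \<omega> = l}) \<partial>count_space UNIV)"
    by (intro nn_integral_cmult) auto
  also have "(\<integral>\<^sup>+ l. emeasure M (E \<inter> ?A' \<inter> {\<omega> \<in> space M. L \<omega> = l}) \<partial>count_space UNIV) = emeasure M (E \<inter> ?A')"
    by (intro emeasure_split_countable[symmetric]) auto
  finally show "emeasure M (E \<inter> ?A) = ?c * emeasure M (E \<inter> ?A')" .
qed auto

text \<open>Given the past and the next state \<open>z\<close>, the tails of \<open>S n\<close> are
  those of an exponential law, and tails determine the law. Hence the event \<open>r < S n\<close>
  of \<open>emeasure_past_step\<close> may be replaced by any Borel condition.\<close>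

lemma emeasure_past_hold:
  assumes E: "E \<in> sets (past n)" "E \<subseteq> {\<omega> \<in> space M. Y n \<omega> = x}" and B: "B \<in> sets borel"
  shows "emeasure M (E \<inter> {\<omega> \<in> space M. S n \<omega> \<in> B \<and> Y (Suc n) \<omega> = z}) =
    emeasure M E * (ennreal (J x z) * emeasure (density lborel (exponential_density (rate x))) B)"
proof -
  define E' where "E' = E \<inter> {\<omega> \<in> space M. Y (Suc n) \<omega> = z}"
  have [measurable]: "E \<in> sets M" using E past_subset by blast
  have [measurable]: "E' \<in> sets M" by (simp add: E'_def)
  have step: "emeasure M (E \<inter> {\<omega> \<in> space M. r < S n \<omega> \<and> Y (Suc n) \<omega> = z}) =
    ennreal (exp (- rate x * r)) * ennreal (J x z) * emeasure M E" if "0 \<le> r" for r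
  proof -
    have *: "E \<inter> {\<omega> \<in> space M. r < S n \<omega> \<and> Y (Suc n) \<omega> = z} =
      E \<inter> {\<omega> \<in> space M. Y n \<omega> = x \<and> r < S n \<omega> \<and> Y (Suc n) \<omega> = z}" "E \<inter> {\<omega> \<in> space M. Y n \<omega> = x} = E"
      using E(2) by auto
    show ?thesis
      using emeasure_past_step[OF E(1) that, of x z] J_nonneg unfolding *(1) unfolding *(2)
      by (simp add: ennreal_mult)
  qed
  have E': "emeasure M E' = ennreal (J x z) * emeasure M E"
  proof -
    have "emeasure M E' = emeasure M (E \<inter> {\<omega> \<in> space M. 0 < S n \<omega> \<and> Y (Suc n) \<omega> = z})"
      unfolding E'_def by (rule emeasure_eq_AE) (use AE_S_pos in auto)
    then show ?thesis using step[of 0] by simp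
  qed
  have B': "E \<inter> {\<omega> \<in> space M. S n \<omega> \<in> B \<and> Y (Suc n) \<omega> = z} = E' \<inter> S n -` B"
    using sets.sets_into_space[OF \<open>E \<in> sets M\<close>] by (auto simp: E'_def)
  show ?thesis
  \<comment> \<open>Conditioning on \<open>E'\<close> requires positive mass, so the null case is
    separate.\<close>
  proof (cases "emeasure M E' = 0")
    case True
    then have "emeasure M (E' \<inter> S n -` B) = 0"
      by (metis B' Int_lower1 emeasure_eq_0 \<open>E' \<in> sets M\<close>)
    then show ?thesis using True B' E' by (auto simp: mult_ac)
  next
    case False
    let ?U = "uniform_measure M E'"
    interpret U: prob_space ?U
      using False by (intro prob_space_uniform_measure) auto
    have "distributed ?U lborel (S n) (exponential_density (rate x))"
      unfolding U.exponential_distributed_iff[OF rate_pos]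
    proof (intro conjI allI impI)
      fix r :: real assume r: "0 \<le> r"
      have "emeasure ?U {\<omega> \<in> space ?U. r < S n \<omega>} = emeasure M (E' \<inter> {\<omega> \<in> space M. r < S n \<omega>}) / emeasure M E'"
        by simp
      also have "E' \<inter> {\<omega> \<in> space M. r < S n \<omega>} = E \<inter> {\<omega> \<in> space M. r < S n \<omega> \<and> Y (Suc n) \<omega> = z}"
        by (auto simp: E'_def)
      also have "emeasure M \<dots> / emeasure M E' = ennreal (exp (- rate x * r))"
        using False unfolding step[OF r] E' mult.assoc
        by (subst ennreal_mult_divide_eq) (auto simp: E'[symmetric])
      finally have "U.prob {\<omega> \<in> space ?U. r < S n \<omega>} = exp (- rate x * r)"
        by (simp add: measure_def)
      moreover have "{\<omega> \<in> space ?U. r < S n \<omega>} \<in> sets ?U" by simp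
      moreover have "{\<omega> \<in> space ?U. S n \<omega> \<le> r} = space ?U - {\<omega> \<in> space ?U. r < S n \<omega>}" by auto
      ultimately show "U.prob {\<omega> \<in> space ?U. S n \<omega> \<le> r} = 1 - exp (- r * rate x)"
        by (simp add: U.prob_compl mult.commute del: space_uniform_measure)
    qed simp
    then have d: "distr ?U lborel (S n) = density lborel (exponential_density (rate x))"
      by (simp add: distributed_distr_eq_density)
    have "emeasure (density lborel (exponential_density (rate x))) B = emeasure ?U (S n -` B \<inter> space ?U)"
      unfolding d[symmetric] using B by (subst emeasure_distr) auto
    also have "\<dots> = emeasure M (E' \<inter> (S n -` B \<inter> space M)) / emeasure M E'"
      using B by (simp add: measurable_sets[OF S_measurable])
    also have "E' \<inter> (S n -` B \<inter> space M) = E' \<inter> S n -` B"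
      using sets.sets_into_space[OF \<open>E' \<in> sets M\<close>] by auto
    finally have "emeasure M (E' \<inter> S n -` B) = emeasure M E' * emeasure (density lborel (exponential_density (rate x))) B"
      using False by (simp add: ennreal_times_divide) (subst mult.commute, simp add: mult_divide_eq_ennreal)
    then show ?thesis unfolding B' E' by (simp add: mult_ac)
  qed
qed

text \<open>On \<open>E\<close> and with next state \<open>z\<close>, the holding time is
  independent of the past, so the joint law of \<open>V\<close> and \<open>S n\<close> is a product
  measure. Tonelli's theorem then integrates out the holding time with \<open>V\<close>
  frozen.\<close>

lemma nn_integral_past_hold:
  assumes E: "E \<in> sets (past n)" "E \<subseteq> {\<omega> \<in> space M. Y n \<omega> = x}"
    and V: "V \<in> measurable (past n) N" and f: "f \<in> borel_measurable (N \<Otimes>\<^sub>M borel)"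
  shows "(\<integral>\<^sup>+ \<omega>. indicator E \<omega> * (indicator {z} (Y (Suc n) \<omega>) * f (V \<omega>, S n \<omega>)) \<partial>M) =
    (\<integral>\<^sup>+ \<omega>. indicator E \<omega> * (\<integral>\<^sup>+ r. ennreal (J x z * exponential_density (rate x) r) * f (V \<omega>, r) \<partial>lborel) \<partial>M)"
proof -
  have [measurable]: "E \<in> sets M" "V \<in> measurable M N" "f \<in> borel_measurable (N \<Otimes>\<^sub>M borel)"
    using E past_subset V f by (blast intro: measurable_past)+
  define E' where "E' = E \<inter> {\<omega> \<in> space M. Y (Suc n) \<omega> = z}"
  have [measurable]: "E' \<in> sets M" by (auto simp: E'_def)
  define N1 where "N1 = distr (density M (indicator E)) N V"
  define N2 where "N2 = density lborel (\<lambda>r. ennreal (J x z * exponential_density (rate x) r))"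
  have dens: "N2 = density lborel (\<lambda>r. ennreal (J x z) * ennreal (exponential_density (rate x) r))"
    unfolding N2_def using J_nonneg exponential_density_nonneg[OF rate_pos] by (simp add: ennreal_mult)
  have N2: "emeasure N2 B = ennreal (J x z) * emeasure (density lborel (exponential_density (rate x))) B"
    if "B \<in> sets borel" for B
    using that unfolding dens
    by (simp add: emeasure_density nn_integral_cmult mult.assoc)
  interpret N1: finite_measure N1
    unfolding N1_def
    by (intro finite_measure.finite_measure_distr finite_measureI) (auto simp: emeasure_restricted)
  interpret Ex: prob_space "density lborel (exponential_density (rate x))"
    using prob_space_exponential_density[OF rate_pos] .
  have "emeasure (density lborel (exponential_density (rate x))) UNIV = 1"
    using Ex.emeasure_space_1 by simp
  then have "emeasure N2 (space N2) \<noteq> \<infinity>"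
    using N2[of UNIV] by (simp add: N2_def)
  then interpret N2: finite_measure N2 by (rule finite_measureI)
  have eq: "N1 \<Otimes>\<^sub>M N2 = distr (density M (indicator E')) (N \<Otimes>\<^sub>M borel) (\<lambda>\<omega>. (V \<omega>, S n \<omega>))"
  proof (rule pair_measure_eqI)
    show "sets (N1 \<Otimes>\<^sub>M N2) = sets (distr (density M (indicator E')) (N \<Otimes>\<^sub>M borel) (\<lambda>\<omega>. (V \<omega>, S n \<omega>)))"
      by (simp add: N1_def N2_def cong: sets_pair_measure_cong)
    fix A B assume "A \<in> sets N1" "B \<in> sets N2"
    then have [measurable]: "A \<in> sets N" "B \<in> sets borel" by (auto simp: N1_def N2_def)
    have EA: "E \<inter> (V -` A \<inter> space M) \<in> sets (past n)"
      using E(1) measurable_sets[OF V, of A] by auto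
    have "emeasure N1 A * emeasure N2 B = emeasure M (E \<inter> (V -` A \<inter> space M)) * emeasure N2 B"
      by (simp add: N1_def emeasure_distr emeasure_restricted)
    also have "\<dots> = emeasure M ((E \<inter> (V -` A \<inter> space M)) \<inter> {\<omega> \<in> space M. S n \<omega> \<in> B \<and> Y (Suc n) \<omega> = z})"
      using E(2) by (subst emeasure_past_hold[OF EA, of x]) (auto simp: N2)
    also have "(E \<inter> (V -` A \<inter> space M)) \<inter> {\<omega> \<in> space M. S n \<omega> \<in> B \<and> Y (Suc n) \<omega> = z} =
      E' \<inter> ((\<lambda>\<omega>. (V \<omega>, S n \<omega>)) -` (A \<times> B) \<inter> space M)"
      by (auto simp: E'_def)
    finally show "emeasure N1 A * emeasure N2 B =
      emeasure (distr (density M (indicator E')) (N \<Otimes>\<^sub>M borel) (\<lambda>\<omega>. (V \<omega>, S n \<omega>))) (A \<times> B)"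
      by (simp add: emeasure_distr emeasure_restricted)
  qed (rule N1.sigma_finite_measure_axioms N2.sigma_finite_measure_axioms)+
  have "(\<integral>\<^sup>+ \<omega>. indicator E \<omega> * (indicator {z} (Y (Suc n) \<omega>) * f (V \<omega>, S n \<omega>)) \<partial>M) =
    (\<integral>\<^sup>+ \<omega>. indicator E' \<omega> * f (V \<omega>, S n \<omega>) \<partial>M)"
    by (intro nn_integral_cong) (auto simp: E'_def split: split_indicator)
  also have "\<dots> = (\<integral>\<^sup>+ p. f p \<partial>(N1 \<Otimes>\<^sub>M N2))"
    unfolding eq by (simp add: nn_integral_distr nn_integral_density)
  also have "\<dots> = (\<integral>\<^sup>+ v. \<integral>\<^sup>+ r. f (v, r) \<partial>N2 \<partial>N1)"
    by (rule N2.nn_integral_fst[symmetric]) (simp add: N1_def N2_def cong: measurable_cong_sets sets_pair_measure_cong)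
  also have "\<dots> = (\<integral>\<^sup>+ v. \<integral>\<^sup>+ r. ennreal (J x z * exponential_density (rate x) r) * f (v, r) \<partial>lborel \<partial>N1)"
    unfolding N2_def
    by (rule nn_integral_cong, rule nn_integral_density) (auto simp: N1_def)
  also have "\<dots> = (\<integral>\<^sup>+ \<omega>. (\<integral>\<^sup>+ r. ennreal (J x z * exponential_density (rate x) r) * f (V \<omega>, r) \<partial>lborel) \<partial>density M (indicator E))"
    unfolding N1_def by (rule nn_integral_distr) measurable
  also have "\<dots> = (\<integral>\<^sup>+ \<omega>. indicator E \<omega> * (\<integral>\<^sup>+ r. ennreal (J x z * exponential_density (rate x) r) * f (V \<omega>, r) \<partial>lborel) \<partial>M)"
    by (rule nn_integral_density) measurable
  finally show ?thesis .
qed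


section \<open>One-step analysis over the two neighbours\<close>

lemma past_mono: "sets (past n) \<subseteq> sets (past (Suc n))"
proof -
  have "past_gen n \<subseteq> sets (past (Suc n))"
  proof
    fix E assume "E \<in> past_gen n"
    then obtain B s where E: "E = {\<omega> \<in> space M. map (\<lambda>k. Y k \<omega>) [0..<Suc n] \<in> B \<and> (\<forall>k<n. s k < ereal (S k \<omega>))}"
      unfolding past_gen_def by blast
    have [measurable]: "(\<lambda>\<omega>. map (\<lambda>k. Y k \<omega>) [0..<Suc n]) \<in> measurable (past (Suc n)) (count_space UNIV)"
      by (intro measurable_map_upt Y_measurable_past) simp
    have "E = {\<omega> \<in> space (past (Suc n)). map (\<lambda>k. Y k \<omega>) [0..<Suc n] \<in> B} \<inter>
        {\<omega> \<in> space (past (Suc n)). \<forall>k\<in>{..<n}. s k < ereal (S k \<omega>)}"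
      unfolding E by auto
    also have "\<dots> \<in> sets (past (Suc n))"
    proof (rule sets.Int)
      show "{\<omega> \<in> space (past (Suc n)). map (\<lambda>k. Y k \<omega>) [0..<Suc n] \<in> B} \<in> sets (past (Suc n))"
        by measurable
      have "S k \<in> borel_measurable (past (Suc n))" if "k \<in> {..<n}" for k
        using that by (intro S_measurable_past) simp
      then show "{\<omega> \<in> space (past (Suc n)). \<forall>k\<in>{..<n}. s k < ereal (S k \<omega>)} \<in> sets (past (Suc n))"
        by (intro sets.sets_Collect_finite_All borel_measurable_less borel_measurable_ereal) auto
    qed
    finally show "E \<in> sets (past (Suc n))" .
  qed
  then have "sigma_sets (space (past (Suc n))) (past_gen n) \<subseteq> sets (past (Suc n))"
    by (rule sets.sigma_sets_subset)
  then show ?thesis by (simp add: sets_past)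
qed

lemma measurable_past_Suc: "f \<in> measurable (past n) N \<Longrightarrow> f \<in> measurable (past (Suc n)) N"
  using past_mono unfolding measurable_def by auto

lemma AE_nearest_neighbour: "AE \<omega> in M. Y (Suc n) \<omega> = Y n \<omega> + 1 \<or> Y (Suc n) \<omega> = Y n \<omega> - 1"
proof -
  have "AE \<omega> in M. Y n \<omega> = x \<longrightarrow> Y (Suc n) \<omega> = z \<longrightarrow> z = x + 1 \<or> z = x - 1" for x z
  proof (cases "z = x + 1 \<or> z = x - 1")
    case False
    have "{\<omega> \<in> space M. Y n \<omega> = x} \<in> sets (past n)"
      using measurable_sets[OF Y_measurable_past[of n n], of "{x}"] by (simp add: vimage_def Int_def conj_commute)
    then have "emeasure M ({\<omega> \<in> space M. Y n \<omega> = x} \<inter> {\<omega> \<in> space M. S n \<omega> \<in> UNIV \<and> Y (Suc n) \<omega> = z}) = 0"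
      using False by (subst emeasure_past_hold[where x=x]) (auto simp: J_other)
    then have "AE \<omega> in M. \<omega> \<notin> {\<omega> \<in> space M. Y n \<omega> = x} \<inter> {\<omega> \<in> space M. S n \<omega> \<in> UNIV \<and> Y (Suc n) \<omega> = z}"
      by (intro AE_not_in) (auto simp: null_sets_def)
    with AE_space show ?thesis by eventually_elim auto
  qed simp
  then have "AE \<omega> in M. \<forall>x z. Y n \<omega> = x \<longrightarrow> Y (Suc n) \<omega> = z \<longrightarrow> z = x + 1 \<or> z = x - 1"
    by (simp only: AE_all_countable) simp
  then show ?thesis by eventually_elim simp
qed

text \<open>Sum of \<open>nn_integral_past_hold\<close> over the two neighbours. The total rate
  cancels in \<open>J x (x + 1) * rate x = b x\<close> and in its counterpart for \<open>a\<close>,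
  which produces the integrand in the recursion of \<open>jump_kernel\<close>.\<close>

lemma nn_integral_past_step:
  assumes E: "E \<in> sets (past n)" "E \<subseteq> {\<omega> \<in> space M. Y n \<omega> = x}"
    and V: "V \<in> measurable (past n) N" and g: "\<And>z. g z \<in> borel_measurable (N \<Otimes>\<^sub>M borel)"
  shows "(\<integral>\<^sup>+ \<omega>. indicator E \<omega> * g (Y (Suc n) \<omega>) (V \<omega>, S n \<omega>) \<partial>M) =
    (\<integral>\<^sup>+ \<omega>. indicator E \<omega> * (\<integral>\<^sup>+ r. (if 0 \<le> r then ennreal (exp (- rate x * r)) *
      (ennreal (b x) * g (x + 1) (V \<omega>, r) + ennreal (a x) * g (x - 1) (V \<omega>, r)) else 0) \<partial>lborel) \<partial>M)"
proof -
  have [measurable]: "E \<in> sets M" "V \<in> measurable M N" "\<And>z. g z \<in> borel_measurable (N \<Otimes>\<^sub>M borel)"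
    using E past_subset V g by (blast intro: measurable_past)+
  have [measurable]: "(\<lambda>\<omega>. g z (V \<omega>, S n \<omega>)) \<in> borel_measurable M" for z
    by (rule measurable_compose[OF _ g]) measurable
  have [measurable]: "(\<lambda>\<omega>. indicator {z} (Y (Suc n) \<omega>) :: ennreal) \<in> borel_measurable M" for z
    by (rule measurable_compose[OF Y_measurable]) simp
  have [measurable]: "(\<lambda>(\<omega>, r). g z (V \<omega>, r)) \<in> borel_measurable (M \<Otimes>\<^sub>M borel)" for z
    unfolding case_prod_beta by (rule measurable_compose[OF _ g]) measurable
  let ?I = "\<lambda>z \<omega>. indicator E \<omega> * (indicator {z} (Y (Suc n) \<omega>) * g z (V \<omega>, S n \<omega>))"
  let ?K = "\<lambda>z \<omega>. \<integral>\<^sup>+ r. ennreal (J x z * exponential_density (rate x) r) * g z (V \<omega>, r) \<partial>lborel"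
  have "(\<integral>\<^sup>+ \<omega>. indicator E \<omega> * g (Y (Suc n) \<omega>) (V \<omega>, S n \<omega>) \<partial>M) = (\<integral>\<^sup>+ \<omega>. ?I (x + 1) \<omega> + ?I (x - 1) \<omega> \<partial>M)"
  proof (rule nn_integral_cong_AE, use AE_nearest_neighbour[of n] in eventually_elim)
    case (elim \<omega>)
    then show ?case using E(2) by (cases "\<omega> \<in> E") auto
  qed
  also have "\<dots> = (\<integral>\<^sup>+ \<omega>. ?I (x + 1) \<omega> \<partial>M) + (\<integral>\<^sup>+ \<omega>. ?I (x - 1) \<omega> \<partial>M)"
    by (rule nn_integral_add) measurable
  also have "\<dots> = (\<integral>\<^sup>+ \<omega>. indicator E \<omega> * ?K (x + 1) \<omega> \<partial>M) + (\<integral>\<^sup>+ \<omega>. indicator E \<omega> * ?K (x - 1) \<omega> \<partial>M)"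
    by (intro arg_cong2[where f="(+)"] nn_integral_past_hold[where N=N] E V g)
  also have "\<dots> = (\<integral>\<^sup>+ \<omega>. indicator E \<omega> * ?K (x + 1) \<omega> + indicator E \<omega> * ?K (x - 1) \<omega> \<partial>M)"
    by (rule nn_integral_add[symmetric]) measurable
  also have "\<dots> = (\<integral>\<^sup>+ \<omega>. indicator E \<omega> * (\<integral>\<^sup>+ r. (if 0 \<le> r then ennreal (exp (- rate x * r)) *
      (ennreal (b x) * g (x + 1) (V \<omega>, r) + ennreal (a x) * g (x - 1) (V \<omega>, r)) else 0) \<partial>lborel) \<partial>M)"
  proof (intro nn_integral_cong)
    fix \<omega> assume [simp]: "\<omega> \<in> space M"
    have "V \<omega> \<in> space N"
      using measurable_space[OF \<open>V \<in> measurable M N\<close> \<open>\<omega> \<in> space M\<close>] .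
    then have [measurable]: "(\<lambda>r. g z (V \<omega>, r)) \<in> borel_measurable borel" for z by measurable
    have "?K (x + 1) \<omega> + ?K (x - 1) \<omega> =
        (\<integral>\<^sup>+ r. ennreal (J x (x + 1) * exponential_density (rate x) r) * g (x + 1) (V \<omega>, r) +
          ennreal (J x (x - 1) * exponential_density (rate x) r) * g (x - 1) (V \<omega>, r) \<partial>lborel)"
      by (rule nn_integral_add[symmetric]) measurable
    also have "\<dots> = (\<integral>\<^sup>+ r. (if 0 \<le> r then ennreal (exp (- rate x * r)) *
      (ennreal (b x) * g (x + 1) (V \<omega>, r) + ennreal (a x) * g (x - 1) (V \<omega>, r)) else 0) \<partial>lborel)"
      using rate_pos[of x] a_pos[of x] b_pos[of x]
      by (intro nn_integral_cong)
         (auto simp: J_up J_down exponential_density_def ennreal_mult distrib_left mult_ac)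
    finally show "indicator E \<omega> * ?K (x + 1) \<omega> + indicator E \<omega> * ?K (x - 1) \<omega> = indicator E \<omega> *
      (\<integral>\<^sup>+ r. (if 0 \<le> r then ennreal (exp (- rate x * r)) *
      (ennreal (b x) * g (x + 1) (V \<omega>, r) + ennreal (a x) * g (x - 1) (V \<omega>, r)) else 0) \<partial>lborel)"
      by (simp add: distrib_left[symmetric])
  qed
  finally show ?thesis .
qed

end

section \<open>Counting jumps from a jump time\<close>

lemma nn_integral_exp_tail:
  fixes c v :: real
  assumes c: "0 < c"
  shows "(\<integral>\<^sup>+ r. (if v < r then ennreal (c * exp (- c * r)) else 0) \<partial>lborel) = ennreal (exp (- c * v))"
proof -
  have "(\<integral>\<^sup>+ r. (if v < r then ennreal (c * exp (- c * r)) else 0) \<partial>lborel) =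
      (\<integral>\<^sup>+ r. ennreal (c * exp (- c * r)) * indicator {v..} r \<partial>lborel)"
  proof (rule nn_integral_cong_AE)
    show "AE r in lborel. (if v < r then ennreal (c * exp (- c * r)) else 0) =
        ennreal (c * exp (- c * r)) * indicator {v..} r"
      using AE_lborel_singleton[of v] by eventually_elim (auto split: split_indicator)
  qed
  also have "\<dots> = ennreal (0 - (- exp (- c * v)))"
  proof (rule nn_integral_FTC_atLeast)
    show "((\<lambda>r. - exp (- c * r)) has_real_derivative c * exp (- c * r)) (at r)" for r
      by (auto intro!: derivative_eq_intros)
    have "filterlim (\<lambda>r. - c * r) at_bot at_top"
      using c by (intro filterlim_tendsto_neg_mult_at_bot[OF tendsto_const]) (auto simp: filterlim_ident)
    then have "((\<lambda>r. exp (- c * r)) \<longlongrightarrow> 0) at_top"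
      by (rule filterlim_compose[OF exp_at_bot])
    then show "((\<lambda>r. - exp (- c * r)) \<longlongrightarrow> 0) at_top"
      using tendsto_minus by fastforce
  qed (use c in auto)
  finally show ?thesis by simp
qed

lemma ennreal_exp_add: "ennreal (exp u) * (ennreal (exp v) * c) = ennreal (exp (u + v)) * c"
  by (simp add: exp_add ennreal_mult mult.assoc)

context bd_rates
begin

text \<open>
  \<open>jump_kernel m f x t\<close> is the expectation of \<open>f\<close> of the state at time \<open>t\<close>, for the chain started
  in \<open>x\<close> and on the event of exactly \<open>m\<close> jumps by time \<open>t\<close>.
\<close>

primrec jump_kernel :: "nat \<Rightarrow> (int \<Rightarrow> ennreal) \<Rightarrow> int \<Rightarrow> real \<Rightarrow> ennreal" where
  "jump_kernel 0 f x t = ennreal (exp (- rate x * t)) * f x"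
| "jump_kernel (Suc m) f x t = (\<integral>\<^sup>+ r. (if 0 \<le> r \<and> r \<le> t then ennreal (exp (- rate x * r)) *
     (ennreal (b x) * jump_kernel m f (x + 1) (t - r) + ennreal (a x) * jump_kernel m f (x - 1) (t - r)) else 0) \<partial>lborel)"

lemma jump_kernel_measurable [measurable]: "jump_kernel m f x \<in> borel_measurable borel"
proof (induction m arbitrary: x)
  case 0
  then show ?case by simp
next
  case (Suc m)
  note Suc [measurable]
  have "(\<lambda>t. \<integral>\<^sup>+ r. (if 0 \<le> r \<and> r \<le> t then ennreal (exp (- rate x * r)) *
     (ennreal (b x) * jump_kernel m f (x + 1) (t - r) + ennreal (a x) * jump_kernel m f (x - 1) (t - r)) else 0) \<partial>lborel)
     \<in> borel_measurable borel"
    by measurable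
  then show ?case by (simp cong: measurable_cong)
qed

text \<open>The minimal transition function applied to \<open>f\<close>: paths with infinitely many
  jumps by time \<open>t\<close> do not contribute. That no mass is lost is
  \<open>transition_one\<close>.\<close>

definition transition :: "(int \<Rightarrow> ennreal) \<Rightarrow> int \<Rightarrow> real \<Rightarrow> ennreal" where
  "transition f x t = (\<Sum>m. jump_kernel m f x t)"

lemma transition_measurable [measurable]: "transition f x \<in> borel_measurable borel"
  unfolding transition_def[abs_def] by measurable

end

context bd_realisation
begin

text \<open>The exponential tail at a level fixed by the past. The integrand of
  \<open>nn_integral_past_step\<close> does not depend on the next state here, so \<open>a x\<close>
  and \<open>b x\<close> add up to the rate of an exponential density.\<close>

lemma nn_integral_past_tail:
  assumes E: "E \<in> sets (past n)" "E \<subseteq> {\<omega> \<in> space M. Y n \<omega> = x}"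
    and W: "W \<in> borel_measurable (past n)" "\<And>\<omega>. \<omega> \<in> E \<Longrightarrow> 0 \<le> W \<omega>"
  shows "(\<integral>\<^sup>+ \<omega>. indicator E \<omega> * (if W \<omega> < S n \<omega> then c else 0) \<partial>M) =
    (\<integral>\<^sup>+ \<omega>. indicator E \<omega> * (ennreal (exp (- rate x * W \<omega>)) * c) \<partial>M)"
proof -
  define g :: "int \<Rightarrow> real \<times> real \<Rightarrow> ennreal" where "g z p = (if fst p < snd p then c else 0)" for z p
  have [measurable]: "g z \<in> borel_measurable (borel \<Otimes>\<^sub>M borel)" for z unfolding g_def by measurable
  have "(\<integral>\<^sup>+ \<omega>. indicator E \<omega> * (if W \<omega> < S n \<omega> then c else 0) \<partial>M) =
     (\<integral>\<^sup>+ \<omega>. indicator E \<omega> * g (Y (Suc n) \<omega>) (W \<omega>, S n \<omega>) \<partial>M)"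
    by (simp add: g_def)
  also have "\<dots> = (\<integral>\<^sup>+ \<omega>. indicator E \<omega> * (\<integral>\<^sup>+ r. (if 0 \<le> r then ennreal (exp (- rate x * r)) *
      (ennreal (b x) * g (x + 1) (W \<omega>, r) + ennreal (a x) * g (x - 1) (W \<omega>, r)) else 0) \<partial>lborel) \<partial>M)"
    by (rule nn_integral_past_step[OF E W(1)]) measurable
  also have "\<dots> = (\<integral>\<^sup>+ \<omega>. indicator E \<omega> * (ennreal (exp (- rate x * W \<omega>)) * c) \<partial>M)"
  proof (intro nn_integral_cong)
    fix \<omega>
    have "(\<integral>\<^sup>+ r. (if 0 \<le> r then ennreal (exp (- rate x * r)) *
      (ennreal (b x) * g (x + 1) (W \<omega>, r) + ennreal (a x) * g (x - 1) (W \<omega>, r)) else 0) \<partial>lborel) =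
      ennreal (exp (- rate x * W \<omega>)) * c" if "\<omega> \<in> E"
    proof -
      have "(\<integral>\<^sup>+ r. (if 0 \<le> r then ennreal (exp (- rate x * r)) *
      (ennreal (b x) * g (x + 1) (W \<omega>, r) + ennreal (a x) * g (x - 1) (W \<omega>, r)) else 0) \<partial>lborel) =
        (\<integral>\<^sup>+ r. (if W \<omega> < r then ennreal (rate x * exp (- rate x * r)) else 0) * c \<partial>lborel)"
        using W(2)[OF that] a_pos[of x] b_pos[of x]
        by (intro nn_integral_cong)
           (auto simp: g_def rate_def ennreal_mult distrib_right[symmetric] ennreal_plus[symmetric]
              mult_ac add_ac simp del: ennreal_plus)
      also have "\<dots> = ennreal (exp (- rate x * W \<omega>)) * c"
        unfolding nn_integral_exp_tail[OF rate_pos, symmetric] by (rule nn_integral_multc) measurable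
      finally show ?thesis .
    qed
    then show "indicator E \<omega> * (\<integral>\<^sup>+ r. (if 0 \<le> r then ennreal (exp (- rate x * r)) *
      (ennreal (b x) * g (x + 1) (W \<omega>, r) + ennreal (a x) * g (x - 1) (W \<omega>, r)) else 0) \<partial>lborel) =
      indicator E \<omega> * (ennreal (exp (- rate x * W \<omega>)) * c)"
      by (auto split: split_indicator)
  qed
  finally show ?thesis .
qed

text \<open>\<open>W\<close> and \<open>V\<close> are two times measured from the
  \<open>n\<close>-th jump. The condition \<open>W < S n\<close> says that the chain is still in
  \<open>x\<close> at the earlier one; lack of memory then gives the kernel at \<open>V - W\<close>,
  after the price \<open>exp (- rate x * W)\<close> of waiting. Induction over \<open>m\<close>
  conditions on \<open>S n\<close> and the next state and restarts at jump
  \<open>Suc n\<close>.\<close>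

lemma nn_integral_past_jumps:
  assumes "E \<in> sets (past n)" "E \<subseteq> {\<omega> \<in> space M. Y n \<omega> = x}"
    and "V \<in> borel_measurable (past n)" "W \<in> borel_measurable (past n)"
    and "\<And>\<omega>. \<omega> \<in> E \<Longrightarrow> 0 \<le> W \<omega>" "\<And>\<omega>. \<omega> \<in> E \<Longrightarrow> W \<omega> \<le> V \<omega>"
  shows "(\<integral>\<^sup>+ \<omega>. indicator E \<omega> * (if W \<omega> < S n \<omega> \<and> (\<Sum>k=n..<n+m. S k \<omega>) \<le> V \<omega> \<and>
      V \<omega> < (\<Sum>k=n..<Suc (n+m). S k \<omega>) then f (Y (n + m) \<omega>) else 0) \<partial>M) =
    (\<integral>\<^sup>+ \<omega>. indicator E \<omega> * (ennreal (exp (- rate x * W \<omega>)) * jump_kernel m f x (V \<omega> - W \<omega>)) \<partial>M)"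
  using assms
proof (induction m arbitrary: n E x V W)
  case 0
  note E = "0.prems"(1,2) and WV = "0.prems"(5,6)
  have "(\<integral>\<^sup>+ \<omega>. indicator E \<omega> * (if W \<omega> < S n \<omega> \<and> (\<Sum>k=n..<n+0. S k \<omega>) \<le> V \<omega> \<and>
      V \<omega> < (\<Sum>k=n..<Suc (n+0). S k \<omega>) then f (Y (n + 0) \<omega>) else 0) \<partial>M) =
    (\<integral>\<^sup>+ \<omega>. indicator E \<omega> * (if V \<omega> < S n \<omega> then f x else 0) \<partial>M)"
  proof (intro nn_integral_cong)
    fix \<omega>
    show "indicator E \<omega> * (if W \<omega> < S n \<omega> \<and> (\<Sum>k=n..<n+0. S k \<omega>) \<le> V \<omega> \<and>
      V \<omega> < (\<Sum>k=n..<Suc (n+0). S k \<omega>) then f (Y (n + 0) \<omega>) else 0) =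
      indicator E \<omega> * (if V \<omega> < S n \<omega> then f x else 0)"
      using WV[of \<omega>] E(2) by (cases "\<omega> \<in> E") auto
  qed
  also have "\<dots> = (\<integral>\<^sup>+ \<omega>. indicator E \<omega> * (ennreal (exp (- rate x * V \<omega>)) * f x) \<partial>M)"
    using WV by (intro nn_integral_past_tail E "0.prems") force
  also have "\<dots> = (\<integral>\<^sup>+ \<omega>. indicator E \<omega> * (ennreal (exp (- rate x * W \<omega>)) * jump_kernel 0 f x (V \<omega> - W \<omega>)) \<partial>M)"
    by (simp add: ennreal_exp_add right_diff_distrib)
  finally show ?case .
next
  case (Suc m)
  note E = "Suc.prems"(1,2) and V = "Suc.prems"(3) and W = "Suc.prems"(4) and WV = "Suc.prems"(5,6)
  have EM [measurable]: "E \<in> sets M" "V \<in> borel_measurable M" "W \<in> borel_measurable M"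
    using E V W past_subset by (blast intro: measurable_past)+
  \<comment> \<open>The part of \<open>E\<close> on which the holding time ends between the two
    times and the chain moves to \<open>z\<close>. It belongs to the past of \<open>Suc n\<close>,
    so the induction hypothesis applies to it.\<close>
  define Ez where "Ez z = E \<inter> {\<omega> \<in> space M. W \<omega> < S n \<omega> \<and> S n \<omega> \<le> V \<omega> \<and> Y (Suc n) \<omega> = z}" for z
  define F where "F \<omega> = (if (\<Sum>k=n..<n+Suc m. S k \<omega>) \<le> V \<omega> \<and>
      V \<omega> < (\<Sum>k=n..<Suc (n+Suc m). S k \<omega>) then f (Y (n + Suc m) \<omega>) else 0)" for \<omega>
  have [measurable]: "F \<in> borel_measurable M" unfolding F_def by measurable
  define g :: "int \<Rightarrow> (real \<times> real) \<times> real \<Rightarrow> ennreal"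
    where "g z p = (if snd (fst p) < snd p \<and> snd p \<le> fst (fst p) then jump_kernel m f z (fst (fst p) - snd p) else 0)" for z p
  have gm: "g z \<in> borel_measurable ((borel \<Otimes>\<^sub>M borel) \<Otimes>\<^sub>M borel)" for z unfolding g_def by measurable
  have Ez_past: "Ez z \<in> sets (past (Suc n))" for z
  proof -
    have [measurable]: "E \<in> sets (past (Suc n))" "V \<in> borel_measurable (past (Suc n))" "W \<in> borel_measurable (past (Suc n))"
      "S n \<in> borel_measurable (past (Suc n))" "Y (Suc n) \<in> measurable (past (Suc n)) (count_space UNIV)"
      using E V W past_mono by (auto intro: measurable_past_Suc S_measurable_past Y_measurable_past)
    have "{\<omega> \<in> space (past (Suc n)). W \<omega> < S n \<omega> \<and> S n \<omega> \<le> V \<omega> \<and> Y (Suc n) \<omega> = z} \<in> sets (past (Suc n))"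
      by measurable
    then show ?thesis unfolding Ez_def by auto
  qed
  have Ez_M [measurable]: "Ez z \<in> sets M" for z using Ez_past past_subset by blast
  have IH: "(\<integral>\<^sup>+ \<omega>. indicator (Ez z) \<omega> * F \<omega> \<partial>M) =
      (\<integral>\<^sup>+ \<omega>. indicator (Ez z) \<omega> * jump_kernel m f z (V \<omega> - S n \<omega>) \<partial>M)" for z
  proof -
    have "(\<integral>\<^sup>+ \<omega>. indicator (Ez z) \<omega> * F \<omega> \<partial>M) = (\<integral>\<^sup>+ \<omega>. indicator (Ez z) \<omega> *
        (if 0 < S (Suc n) \<omega> \<and> (\<Sum>k=Suc n..<Suc n+m. S k \<omega>) \<le> V \<omega> - S n \<omega> \<and>
        V \<omega> - S n \<omega> < (\<Sum>k=Suc n..<Suc (Suc n+m). S k \<omega>) then f (Y (Suc n + m) \<omega>) else 0) \<partial>M)"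
    proof (rule nn_integral_cong_AE, use AE_S_pos in eventually_elim)
      case (elim \<omega>)
      have "(\<Sum>k=n..<n+Suc m. S k \<omega>) = S n \<omega> + (\<Sum>k=Suc n..<Suc n+m. S k \<omega>)"
        "(\<Sum>k=n..<Suc (n+Suc m). S k \<omega>) = S n \<omega> + (\<Sum>k=Suc n..<Suc (Suc n+m). S k \<omega>)"
        by (subst sum.atLeast_Suc_lessThan; simp)+
      then show ?case using elim unfolding F_def by (auto simp: algebra_simps)
    qed
    \<comment> \<open>At the fresh jump no waiting time has elapsed: the induction hypothesis is
      used with earlier time \<open>0\<close> and later time \<open>V - S n\<close>.\<close>
    also have "\<dots> = (\<integral>\<^sup>+ \<omega>. indicator (Ez z) \<omega> * (ennreal (exp (- rate z * 0)) * jump_kernel m f z ((V \<omega> - S n \<omega>) - 0)) \<partial>M)"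
    proof (rule Suc.IH[OF Ez_past])
      show "(\<lambda>\<omega>. V \<omega> - S n \<omega>) \<in> borel_measurable (past (Suc n))"
        by (intro borel_measurable_diff measurable_past_Suc V S_measurable_past) simp
    qed (auto simp: Ez_def)
    finally show ?thesis by simp
  qed
  have split: "indicator E \<omega> * h (Y (Suc n) \<omega>) = indicator (Ez (x + 1)) \<omega> * h (x + 1) + indicator (Ez (x - 1)) \<omega> * h (x - 1)"
    if "Y (Suc n) \<omega> = Y n \<omega> + 1 \<or> Y (Suc n) \<omega> = Y n \<omega> - 1" "\<omega> \<in> E \<Longrightarrow> \<not> (W \<omega> < S n \<omega> \<and> S n \<omega> \<le> V \<omega>) \<Longrightarrow> h (Y (Suc n) \<omega>) = 0"
    for \<omega> and h :: "int \<Rightarrow> ennreal"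
    using that E(2) by (cases "\<omega> \<in> E") (auto simp: Ez_def split: split_indicator)
  have "(\<integral>\<^sup>+ \<omega>. indicator E \<omega> * (if W \<omega> < S n \<omega> \<and> (\<Sum>k=n..<n+Suc m. S k \<omega>) \<le> V \<omega> \<and>
      V \<omega> < (\<Sum>k=n..<Suc (n+Suc m). S k \<omega>) then f (Y (n + Suc m) \<omega>) else 0) \<partial>M) =
    (\<integral>\<^sup>+ \<omega>. indicator (Ez (x + 1)) \<omega> * F \<omega> + indicator (Ez (x - 1)) \<omega> * F \<omega> \<partial>M)"
  proof (rule nn_integral_cong_AE, use AE_S_pos AE_nearest_neighbour[of n] in eventually_elim)
    case (elim \<omega>)
    have "(\<Sum>k=n..<n+Suc m. S k \<omega>) = S n \<omega> + (\<Sum>k=Suc n..<Suc n+m. S k \<omega>)"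
      by (subst sum.atLeast_Suc_lessThan; simp)
    moreover have "0 \<le> (\<Sum>k=Suc n..<Suc n+m. S k \<omega>)"
      using elim(1) by (intro sum_nonneg) (simp add: less_imp_le)
    ultimately have "S n \<omega> \<le> V \<omega>" if "(\<Sum>k=n..<n+Suc m. S k \<omega>) \<le> V \<omega>"
      using that by simp
    then have "(if W \<omega> < S n \<omega> \<and> (\<Sum>k=n..<n+Suc m. S k \<omega>) \<le> V \<omega> \<and>
      V \<omega> < (\<Sum>k=n..<Suc (n+Suc m). S k \<omega>) then f (Y (n + Suc m) \<omega>) else 0) =
      (if W \<omega> < S n \<omega> \<and> S n \<omega> \<le> V \<omega> then F \<omega> else 0)"
      by (auto simp: F_def)
    then show ?case
      using split[OF elim(2), of "\<lambda>_. if W \<omega> < S n \<omega> \<and> S n \<omega> \<le> V \<omega> then F \<omega> else 0"]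
      by (auto simp: Ez_def split: split_indicator)
  qed
  also have "\<dots> = (\<integral>\<^sup>+ \<omega>. indicator (Ez (x + 1)) \<omega> * F \<omega> \<partial>M) + (\<integral>\<^sup>+ \<omega>. indicator (Ez (x - 1)) \<omega> * F \<omega> \<partial>M)"
    by (rule nn_integral_add) measurable
  also have "\<dots> = (\<integral>\<^sup>+ \<omega>. indicator (Ez (x + 1)) \<omega> * jump_kernel m f (x + 1) (V \<omega> - S n \<omega>) \<partial>M) +
      (\<integral>\<^sup>+ \<omega>. indicator (Ez (x - 1)) \<omega> * jump_kernel m f (x - 1) (V \<omega> - S n \<omega>) \<partial>M)"
    unfolding IH ..
  also have "\<dots> = (\<integral>\<^sup>+ \<omega>. indicator (Ez (x + 1)) \<omega> * jump_kernel m f (x + 1) (V \<omega> - S n \<omega>) +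
      indicator (Ez (x - 1)) \<omega> * jump_kernel m f (x - 1) (V \<omega> - S n \<omega>) \<partial>M)"
    by (rule nn_integral_add[symmetric]) measurable
  also have "\<dots> = (\<integral>\<^sup>+ \<omega>. indicator E \<omega> * g (Y (Suc n) \<omega>) ((V \<omega>, W \<omega>), S n \<omega>) \<partial>M)"
  proof (rule nn_integral_cong_AE, use AE_nearest_neighbour[of n] in eventually_elim)
    case (elim \<omega>)
    show ?case
      using split[OF elim, of "\<lambda>z. g z ((V \<omega>, W \<omega>), S n \<omega>)"]
      by (auto simp: Ez_def g_def split: split_indicator)
  qed
  also have "\<dots> = (\<integral>\<^sup>+ \<omega>. indicator E \<omega> * (\<integral>\<^sup>+ r. (if 0 \<le> r then ennreal (exp (- rate x * r)) *
      (ennreal (b x) * g (x + 1) ((V \<omega>, W \<omega>), r) + ennreal (a x) * g (x - 1) ((V \<omega>, W \<omega>), r)) else 0) \<partial>lborel) \<partial>M)"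
    by (rule nn_integral_past_step[OF E _ gm]) (intro measurable_Pair V W)
  also have "\<dots> = (\<integral>\<^sup>+ \<omega>. indicator E \<omega> * (ennreal (exp (- rate x * W \<omega>)) * jump_kernel (Suc m) f x (V \<omega> - W \<omega>)) \<partial>M)"
  proof (intro nn_integral_cong)
    fix \<omega>
    have "(\<integral>\<^sup>+ r. (if 0 \<le> r then ennreal (exp (- rate x * r)) *
      (ennreal (b x) * g (x + 1) ((V \<omega>, W \<omega>), r) + ennreal (a x) * g (x - 1) ((V \<omega>, W \<omega>), r)) else 0) \<partial>lborel) =
      ennreal (exp (- rate x * W \<omega>)) * jump_kernel (Suc m) f x (V \<omega> - W \<omega>)" if "\<omega> \<in> E"
    proof -
      define k where "k r = ennreal (exp (- rate x * r)) * (ennreal (b x) * jump_kernel m f (x + 1) (V \<omega> - r) +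
         ennreal (a x) * jump_kernel m f (x - 1) (V \<omega> - r))" for r
      have [measurable]: "k \<in> borel_measurable borel" unfolding k_def by measurable
      have "(\<integral>\<^sup>+ r. (if 0 \<le> r then ennreal (exp (- rate x * r)) *
        (ennreal (b x) * g (x + 1) ((V \<omega>, W \<omega>), r) + ennreal (a x) * g (x - 1) ((V \<omega>, W \<omega>), r)) else 0) \<partial>lborel) =
        (\<integral>\<^sup>+ r. (if W \<omega> \<le> r \<and> r \<le> V \<omega> then k r else 0) \<partial>lborel)"
      proof (rule nn_integral_cong_AE, use AE_lborel_singleton[of "W \<omega>"] in eventually_elim)
        case (elim r)
        then show ?case using WV(1)[OF that] by (auto simp: g_def k_def)
      qed
      \<comment> \<open>The shift of \<open>r\<close> by \<open>W\<close> splits the price of the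
        elapsed time off the convolution integral.\<close>
      also have "\<dots> = (\<integral>\<^sup>+ r. (if W \<omega> \<le> W \<omega> + 1 * r \<and> W \<omega> + 1 * r \<le> V \<omega> then k (W \<omega> + 1 * r) else 0) \<partial>lborel)"
        by (subst nn_integral_real_affine[where c=1 and t="W \<omega>"]) auto
      also have "\<dots> = (\<integral>\<^sup>+ r. ennreal (exp (- rate x * W \<omega>)) * (if 0 \<le> r \<and> r \<le> V \<omega> - W \<omega> then ennreal (exp (- rate x * r)) *
         (ennreal (b x) * jump_kernel m f (x + 1) ((V \<omega> - W \<omega>) - r) + ennreal (a x) * jump_kernel m f (x - 1) ((V \<omega> - W \<omega>) - r)) else 0) \<partial>lborel)"
        by (intro nn_integral_cong) (auto simp: k_def ennreal_exp_add distrib_left diff_diff_eq)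
      also have "\<dots> = ennreal (exp (- rate x * W \<omega>)) * jump_kernel (Suc m) f x (V \<omega> - W \<omega>)"
        by (subst nn_integral_cmult) auto
      finally show ?thesis .
    qed
    then show "indicator E \<omega> * (\<integral>\<^sup>+ r. (if 0 \<le> r then ennreal (exp (- rate x * r)) *
      (ennreal (b x) * g (x + 1) ((V \<omega>, W \<omega>), r) + ennreal (a x) * g (x - 1) ((V \<omega>, W \<omega>), r)) else 0) \<partial>lborel) =
      indicator E \<omega> * (ennreal (exp (- rate x * W \<omega>)) * jump_kernel (Suc m) f x (V \<omega> - W \<omega>))"
      by (auto split: split_indicator)
  qed
  finally show ?case .
qed

end

section \<open>The Markov property\<close>

locale bd_path = bd_realisation a b M \<nu> Y S
  for a b and M :: "'a measure" and \<nu> Y S +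
  fixes X :: "real \<Rightarrow> 'a \<Rightarrow> int"
  assumes X_measurable: "\<And>t. 0 \<le> t \<Longrightarrow> X t \<in> measurable M (count_space UNIV)"
    and nonexplosive: "nonexplosive (bd_generator a b)"
    and AE_X: "AE \<omega> in M. \<forall>n t. jump_time S n \<omega> \<le> t \<and> t < jump_time S (Suc n) \<omega> \<longrightarrow> X t \<omega> = Y n \<omega>"
begin

text \<open>\<open>nonexplosive\<close> speaks of realisations on the sequence space. The pair of
  \<open>Y\<close> and \<open>S\<close> is therefore transported there; cylinder probabilities, and
  with them \<open>jump_hold\<close>, are preserved.\<close>

lemma AE_jump_time_at_top: "AE \<omega> in M. filterlim (\<lambda>n. jump_time S n \<omega>) at_top sequentially"
proof -
  define N :: "(nat \<Rightarrow> int \<times> real) measure" where "N = PiM UNIV (\<lambda>_. count_space UNIV \<Otimes>\<^sub>M borel)"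
  define \<phi> where "\<phi> \<omega> = (\<lambda>k. (Y k \<omega>, S k \<omega>))" for \<omega>
  have \<phi> [measurable]: "\<phi> \<in> measurable M N"
    unfolding \<phi>_def N_def by (rule measurable_PiM_single') (auto simp: space_pair_measure)
  have c [measurable]: "(\<lambda>p. p k) \<in> measurable N (count_space UNIV \<Otimes>\<^sub>M borel)" for k
    unfolding N_def by (rule measurable_component_singleton) simp
  have f [measurable]: "(\<lambda>p. fst (p k)) \<in> measurable N (count_space UNIV)"
    and s [measurable]: "(\<lambda>p. snd (p k)) \<in> borel_measurable N" for k
    by (rule measurable_compose[OF c], simp)+
  have sp: "space N = UNIV" by (simp add: N_def space_PiM space_pair_measure)
  have "jump_hold (bd_generator a b) \<nu> (distr M N \<phi>) (\<lambda>k p. fst (p k)) (\<lambda>k p. snd (p k))"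
    unfolding jump_hold_def
  proof (intro conjI allI impI)
    show "prob_space (distr M N \<phi>)" by (rule prob_space_distr) fact
    fix n and y :: "nat \<Rightarrow> int" and u :: "nat \<Rightarrow> real"
    assume u: "\<forall>k\<le>n. 0 \<le> u k"
    have *: "{p \<in> space (distr M N \<phi>). \<forall>k\<le>n. fst (p k) = y k \<and> u k < snd (p k)} \<in> sets N"
    proof -
      have "{p \<in> space N. \<forall>k\<le>n. fst (p k) = y k \<and> u k < snd (p k)} \<in> sets N" by measurable
      then show ?thesis by simp
    qed
    have "measure (distr M N \<phi>) {p \<in> space (distr M N \<phi>). \<forall>k\<le>n. fst (p k) = y k \<and> u k < snd (p k)} =
      measure M {\<omega> \<in> space M. \<forall>k\<le>n. Y k \<omega> = y k \<and> u k < S k \<omega>}"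
      by (subst measure_distr[OF \<phi> *]) (auto simp: \<phi>_def sp intro!: arg_cong[where f=prob])
    then show "measure (distr M N \<phi>) {p \<in> space (distr M N \<phi>). \<forall>k\<le>n. fst (p k) = y k \<and> u k < snd (p k)} =
      pmf \<nu> (y 0) * (\<Prod>k<n. J (y k) (y (Suc k))) * (\<Prod>k\<le>n. exp (bd_generator a b (y k) (y k) * u k))"
      using jump_hold u by (simp add: jump_hold_def)
  qed simp_all
  then have "AE p in distr M N \<phi>. filterlim (\<lambda>n. jump_time (\<lambda>k p. snd (p k)) n p) at_top sequentially"
    using nonexplosive unfolding nonexplosive_def by blast
  from AE_distrD[OF \<phi> this] show ?thesis
    by (simp add: jump_time_def \<phi>_def)
qed

lemma jump_time_measurable [measurable]: "jump_time S n \<in> borel_measurable M"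
  unfolding jump_time_def[abs_def] by measurable

lemma jump_time_measurable_past: "jump_time S n \<in> borel_measurable (past n)"
  unfolding jump_time_def[abs_def] by (intro borel_measurable_sum S_measurable_past) simp

section \<open>Position of a fixed time among the jump times\<close>

definition at_jump :: "nat \<Rightarrow> real \<Rightarrow> 'a \<Rightarrow> bool" where
  "at_jump n t \<omega> \<longleftrightarrow> jump_time S n \<omega> \<le> t \<and> t < jump_time S (Suc n) \<omega>"

lemma at_jump_measurable [measurable]: "Measurable.pred M (at_jump n t)"
  unfolding at_jump_def[abs_def] by measurable

text \<open>The cap at \<open>n\<close> keeps the search within the data of \<open>past n\<close>,
  which contains the jump times up to index \<open>n\<close> but not the end of the holding time
  there.\<close>

lemma ex_last_jump:
  fixes u :: "nat \<Rightarrow> real"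
  assumes "u 0 \<le> r"
  shows "\<exists>k\<le>n. u k \<le> r \<and> (k < n \<longrightarrow> r < u (Suc k))"
proof (induction n)
  case 0 then show ?case using assms by auto
next
  case (Suc n)
  then obtain k where k: "k \<le> n" "u k \<le> r" "k < n \<longrightarrow> r < u (Suc k)" by blast
  show ?case
  proof (cases "k < n \<or> r < u (Suc n)")
    case True
    then have "r < u (Suc k)" using k by (cases "k = n") auto
    then show ?thesis using k by (intro exI[of _ k]) auto
  next
    case False
    then show ?thesis by (intro exI[of _ "Suc n"]) auto
  qed
qed

lemma AE_ex1_at_jump:
  "AE \<omega> in M. \<forall>t\<ge>0. \<exists>n. \<forall>m. at_jump m t \<omega> \<longleftrightarrow> m = n"
  using AE_jump_time_at_top AE_S_pos
proof eventually_elim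
  case (elim \<omega>)
  let ?u = "\<lambda>n. jump_time S n \<omega>"
  have mono: "?u m \<le> ?u n" if "m \<le> n" for m n
    unfolding jump_time_def using elim(2) that by (intro sum_mono2) (auto simp: less_imp_le)
  show ?case
  proof (intro allI impI)
    fix t :: real assume t: "0 \<le> t"
    obtain N where N: "t < ?u N"
      using elim(1) by (metis filterlim_at_top_dense eventually_sequentially order_refl)
    have "?u 0 \<le> t" using t by (simp add: jump_time_def)
    then obtain k where k: "k \<le> N" "?u k \<le> t" "k < N \<longrightarrow> t < ?u (Suc k)"
      using ex_last_jump[of ?u t N] by blast
    then have "at_jump k t \<omega>" using N by (cases "k = N") (auto simp: at_jump_def)
    moreover have "m = k" if "at_jump m t \<omega>" for m
    proof (rule ccontr)
      assume "m \<noteq> k"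
      then consider "Suc m \<le> k" | "Suc k \<le> m" by linarith
      then show False
        using mono[of "Suc m" k] mono[of "Suc k" m] that \<open>at_jump k t \<omega>\<close>
        by cases (auto simp: at_jump_def)
    qed
    ultimately show "\<exists>n. \<forall>m. at_jump m t \<omega> \<longleftrightarrow> m = n" by blast
  qed
qed

text \<open>On \<open>at_jump n s\<close> the state at a time \<open>r\<close> up to
  \<open>s\<close> is \<open>Y k\<close>, where \<open>k\<close> is the last jump not after
  \<open>r\<close>, and this can be read off \<open>past n\<close>. The property passes to
  complements and countable unions, up to null sets.\<close>

lemma natural_filtration_past:
  assumes s: "0 \<le> s" and A: "A \<in> sets (natural_filtration M X (ennreal s))"
  shows "\<exists>A'\<in>sets (past n). AE \<omega> in M. at_jump n s \<omega> \<longrightarrow> (\<omega> \<in> A \<longleftrightarrow> \<omega> \<in> A')"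
proof -
  have "A \<in> sigma_sets (space M) {X r -` B \<inter> space M | r B. 0 \<le> r \<and> ennreal r \<le> ennreal s}"
    using A unfolding natural_filtration_def by (subst (asm) sets_measure_of) auto
  then show ?thesis
  proof induction
    case (Basic A)
    then obtain r B where A: "A = X r -` B \<inter> space M" and r: "0 \<le> r" "r \<le> s" using s by auto
    \<comment> \<open>For \<open>k = n\<close> no upper bound is imposed: on
      \<open>at_jump n s\<close> the next jump comes after \<open>s\<close> anyway, and its time is
      not among the data of \<open>past n\<close>.\<close>
    define A' where "A' = {\<omega> \<in> space (past n). \<exists>k\<in>{..n}. jump_time S k \<omega> \<le> r \<and>
      (k < n \<longrightarrow> r < jump_time S (Suc k) \<omega>) \<and> Y k \<omega> \<in> B}"
    have "A' \<in> sets (past n)"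
      unfolding A'_def
    proof (rule sets.sets_Collect_finite_Ex)
      fix k assume "k \<in> {..n}"
      then have [measurable]: "Y k \<in> measurable (past n) (count_space UNIV)"
        "jump_time S k \<in> borel_measurable (past n)"
        unfolding jump_time_def[abs_def]
        by (auto intro!: borel_measurable_sum S_measurable_past Y_measurable_past)
      show "{\<omega> \<in> space (past n). jump_time S k \<omega> \<le> r \<and> (k < n \<longrightarrow> r < jump_time S (Suc k) \<omega>) \<and> Y k \<omega> \<in> B} \<in> sets (past n)"
      proof (cases "k < n")
        case True
        then have [measurable]: "jump_time S (Suc k) \<in> borel_measurable (past n)"
          unfolding jump_time_def[abs_def] by (intro borel_measurable_sum S_measurable_past) simp
        show ?thesis by measurable
      next
        case False
        then have "{\<omega> \<in> space (past n). jump_time S k \<omega> \<le> r \<and> (k < n \<longrightarrow> r < jump_time S (Suc k) \<omega>) \<and> Y k \<omega> \<in> B} =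
          {\<omega> \<in> space (past n). jump_time S k \<omega> \<le> r \<and> Y k \<omega> \<in> B}" by auto
        also have "\<dots> \<in> sets (past n)" by measurable
        finally show ?thesis .
      qed
    qed simp
    moreover have "AE \<omega> in M. at_jump n s \<omega> \<longrightarrow> (\<omega> \<in> A \<longleftrightarrow> \<omega> \<in> A')"
      using AE_X AE_space
    proof (eventually_elim, intro impI)
      fix \<omega> assume X: "\<forall>n t. jump_time S n \<omega> \<le> t \<and> t < jump_time S (Suc n) \<omega> \<longrightarrow> X t \<omega> = Y n \<omega>"
        and \<omega>: "\<omega> \<in> space M" and n: "at_jump n s \<omega>"
      have eq: "X r \<omega> = Y k \<omega>" if "k \<le> n" "jump_time S k \<omega> \<le> r" "k < n \<longrightarrow> r < jump_time S (Suc k) \<omega>" for k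
        using that X n r(2) by (cases "k = n") (auto simp: at_jump_def)
      have "jump_time S 0 \<omega> \<le> r" using r by (simp add: jump_time_def)
      then obtain k where k: "k \<le> n" "jump_time S k \<omega> \<le> r" "k < n \<longrightarrow> r < jump_time S (Suc k) \<omega>"
        using ex_last_jump[of "\<lambda>k. jump_time S k \<omega>" r n] by blast
      show "\<omega> \<in> A \<longleftrightarrow> \<omega> \<in> A'"
      proof
        assume "\<omega> \<in> A"
        then have "Y k \<omega> \<in> B" using eq[OF k] by (simp add: A)
        then show "\<omega> \<in> A'" using k \<omega> unfolding A'_def by auto
      next
        assume "\<omega> \<in> A'"
        then obtain k' where "k' \<le> n" "jump_time S k' \<omega> \<le> r" "k' < n \<longrightarrow> r < jump_time S (Suc k') \<omega>" "Y k' \<omega> \<in> B"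
          unfolding A'_def by auto
        then show "\<omega> \<in> A" using eq[of k'] \<omega> by (simp add: A)
      qed
    qed
    ultimately show ?case by blast
  next
    case Empty
    show ?case by (rule bexI[of _ "{}"]) auto
  next
    case (Compl A)
    then obtain A' where "A' \<in> sets (past n)" and A': "AE \<omega> in M. at_jump n s \<omega> \<longrightarrow> (\<omega> \<in> A \<longleftrightarrow> \<omega> \<in> A')" by blast
    then have "space M - A' \<in> sets (past n)" using sets.compl_sets[of A' "past n"] by simp
    moreover have "AE \<omega> in M. at_jump n s \<omega> \<longrightarrow> (\<omega> \<in> space M - A \<longleftrightarrow> \<omega> \<in> space M - A')"
      using A' by eventually_elim auto
    ultimately show ?case by blast
  next
    case (Union A)
    then obtain A' where A': "\<And>i::nat. A' i \<in> sets (past n)"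
      "\<And>i. AE \<omega> in M. at_jump n s \<omega> \<longrightarrow> (\<omega> \<in> A i \<longleftrightarrow> \<omega> \<in> A' i)" by metis
    then have "AE \<omega> in M. \<forall>i. at_jump n s \<omega> \<longrightarrow> (\<omega> \<in> A i \<longleftrightarrow> \<omega> \<in> A' i)"
      by (simp only: AE_all_countable) simp
    then have "AE \<omega> in M. at_jump n s \<omega> \<longrightarrow> (\<omega> \<in> (\<Union>i. A i) \<longleftrightarrow> \<omega> \<in> (\<Union>i. A' i))"
      by eventually_elim auto
    moreover have "(\<Union>i. A' i) \<in> sets (past n)" using A' by auto
    ultimately show ?case by blast
  qed
qed

lemma sets_natural_filtration:
  "sets (natural_filtration M X t) = sigma_sets (space M) {X s -` A \<inter> space M | s A. 0 \<le> s \<and> ennreal s \<le> t}"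
  unfolding natural_filtration_def by (subst sets_measure_of) auto

lemma natural_filtration_subset: "sets (natural_filtration M X t) \<subseteq> sets M"
  unfolding sets_natural_filtration
  by (rule sets.sigma_sets_subset) (auto intro: measurable_sets[OF X_measurable])

lemma suminf_at_jump:
  fixes c :: ennreal
  assumes "\<forall>m. at_jump m t \<omega> \<longleftrightarrow> m = n"
  shows "(\<Sum>m. if at_jump m t \<omega> then h m else 0) = (h n :: ennreal)"
  using sums_single[of n h] assms by (simp add: sums_iff)

text \<open>Split by the number \<open>n\<close> of jumps by time \<open>s\<close> and the number
  \<open>m\<close> of further jumps by time \<open>t\<close>. Measured from the \<open>n\<close>-th
  jump, the two times differ by the constant \<open>t - s\<close>, so each term is a factor
  depending on \<open>n\<close> times the kernel of \<open>m\<close> jumps, and the double series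
  factorises.\<close>

lemma markov_natural_filtration:
  assumes s: "0 \<le> s" "s \<le> t" and A: "A \<in> sets (natural_filtration M X (ennreal s))"
  shows "(\<integral>\<^sup>+ \<omega>. indicator (A \<inter> {\<omega> \<in> space M. X s \<omega> = x}) \<omega> * f (X t \<omega>) \<partial>M) =
    emeasure M (A \<inter> {\<omega> \<in> space M. X s \<omega> = x}) * transition f x (t - s)"
proof -
  have [measurable]: "A \<in> sets M" "X s \<in> measurable M (count_space UNIV)" "X t \<in> measurable M (count_space UNIV)"
    using A natural_filtration_subset X_measurable s by auto
  define B where "B = A \<inter> {\<omega> \<in> space M. X s \<omega> = x}"
  have [measurable]: "B \<in> sets M" by (simp add: B_def)
  have fX [measurable]: "(\<lambda>\<omega>. f (X t \<omega>)) \<in> borel_measurable M" "(\<lambda>\<omega>. f (Y n \<omega>)) \<in> borel_measurable M" for n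
    by (rule measurable_compose[of _ _ "count_space UNIV"]; simp)+
  define c where "c n = (\<integral>\<^sup>+ \<omega>. (if at_jump n s \<omega> then indicator B \<omega> else 0) \<partial>M)" for n
  have T: "(\<integral>\<^sup>+ \<omega>. (if at_jump n s \<omega> then if at_jump (n + m) t \<omega> then indicator B \<omega> * f (X t \<omega>) else 0 else 0) \<partial>M) =
      c n * jump_kernel m f x (t - s)" for n m
  proof -
    obtain A' where A': "A' \<in> sets (past n)" "AE \<omega> in M. at_jump n s \<omega> \<longrightarrow> (\<omega> \<in> A \<longleftrightarrow> \<omega> \<in> A')"
      using natural_filtration_past[OF s(1) A] by blast
    define E where "E = A' \<inter> {\<omega> \<in> space (past n). Y n \<omega> = x \<and> jump_time S n \<omega> \<le> s}"
    have [measurable]: "Y n \<in> measurable (past n) (count_space UNIV)" "jump_time S n \<in> borel_measurable (past n)"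
      by (simp_all add: Y_measurable_past jump_time_measurable_past)
    have "{\<omega> \<in> space (past n). Y n \<omega> = x \<and> jump_time S n \<omega> \<le> s} \<in> sets (past n)" by measurable
    with A' have E: "E \<in> sets (past n)" "E \<subseteq> {\<omega> \<in> space M. Y n \<omega> = x}" unfolding E_def by auto
    define V where "V u \<omega> = u - jump_time S n \<omega>" for u \<omega>
    have V: "V u \<in> borel_measurable (past n)" for u unfolding V_def[abs_def] by measurable
    have V0: "0 \<le> V s \<omega>" "V s \<omega> \<le> V t \<omega>" if "\<omega> \<in> E" for \<omega> using that s by (auto simp: V_def E_def)
    have [measurable]: "E \<in> sets M" using E past_subset by auto
    have [measurable]: "V u \<in> borel_measurable M" for u by (rule measurable_past[OF V])
    \<comment> \<open>The same waiting price appears here without a second time, which allows it to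
      be separated from the kernel.\<close>
    have cn: "c n = (\<integral>\<^sup>+ \<omega>. indicator E \<omega> * (ennreal (exp (- rate x * V s \<omega>)) * 1) \<partial>M)"
    proof -
      have "c n = (\<integral>\<^sup>+ \<omega>. indicator E \<omega> * (if V s \<omega> < S n \<omega> then 1 else 0) \<partial>M)"
        unfolding c_def
      proof (rule nn_integral_cong_AE, use A'(2) AE_X AE_space in eventually_elim)
        case (elim \<omega>)
        have "X s \<omega> = Y n \<omega>" if "at_jump n s \<omega>" using elim that unfolding at_jump_def by blast
        moreover have "at_jump n s \<omega> \<longleftrightarrow> jump_time S n \<omega> \<le> s \<and> V s \<omega> < S n \<omega>"
          by (auto simp: at_jump_def V_def jump_time_def)
        ultimately show ?case using elim by (auto simp: B_def E_def split: split_indicator)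
      qed
      also have "\<dots> = (\<integral>\<^sup>+ \<omega>. indicator E \<omega> * (ennreal (exp (- rate x * V s \<omega>)) * 1) \<partial>M)"
        by (rule nn_integral_past_tail[OF E V V0(1)])
      finally show ?thesis .
    qed
    have "(\<integral>\<^sup>+ \<omega>. (if at_jump n s \<omega> then if at_jump (n + m) t \<omega> then indicator B \<omega> * f (X t \<omega>) else 0 else 0) \<partial>M) =
      (\<integral>\<^sup>+ \<omega>. indicator E \<omega> * (if V s \<omega> < S n \<omega> \<and> (\<Sum>k=n..<n+m. S k \<omega>) \<le> V t \<omega> \<and>
      V t \<omega> < (\<Sum>k=n..<Suc (n+m). S k \<omega>) then f (Y (n + m) \<omega>) else 0) \<partial>M)"
    proof (rule nn_integral_cong_AE, use A'(2) AE_X AE_space in eventually_elim)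
      case (elim \<omega>)
      have 1: "jump_time S (Suc n) \<omega> = jump_time S n \<omega> + S n \<omega>" by (simp add: jump_time_def)
      have 2: "jump_time S (n + m) \<omega> = jump_time S n \<omega> + (\<Sum>k=n..<n+m. S k \<omega>)" for m
        unfolding jump_time_def by (simp add: lessThan_atLeast0 sum.atLeastLessThan_concat)
      have X1: "X s \<omega> = Y n \<omega>" if "at_jump n s \<omega>" using elim that by (auto simp: at_jump_def)
      have X2: "X t \<omega> = Y (n + m) \<omega>" if "at_jump (n + m) t \<omega>" using elim that unfolding at_jump_def by blast
      have J1: "at_jump n s \<omega> \<longleftrightarrow> jump_time S n \<omega> \<le> s \<and> V s \<omega> < S n \<omega>"
        using 1 by (auto simp: at_jump_def V_def)
      have J2: "at_jump (n + m) t \<omega> \<longleftrightarrow> (\<Sum>k=n..<n+m. S k \<omega>) \<le> V t \<omega> \<and> V t \<omega> < (\<Sum>k=n..<Suc (n+m). S k \<omega>)"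
        using 2[of m] 2[of "Suc m"] by (auto simp: at_jump_def V_def algebra_simps)
      have "(if at_jump n s \<omega> then if at_jump (n + m) t \<omega> then indicator B \<omega> * f (X t \<omega>) else 0 else 0) =
        indicator E \<omega> * (if V s \<omega> < S n \<omega> \<and> at_jump (n + m) t \<omega> then f (Y (n + m) \<omega>) else 0)"
        using elim X1 X2 J1 by (auto simp: B_def E_def split: split_indicator)
      then show ?case unfolding J2 .
    qed
    also have "\<dots> = (\<integral>\<^sup>+ \<omega>. indicator E \<omega> * (ennreal (exp (- rate x * V s \<omega>)) * jump_kernel m f x (V t \<omega> - V s \<omega>)) \<partial>M)"
      by (rule nn_integral_past_jumps[OF E V V V0])
    also have "\<dots> = (\<integral>\<^sup>+ \<omega>. indicator E \<omega> * (ennreal (exp (- rate x * V s \<omega>)) * 1) * jump_kernel m f x (t - s) \<partial>M)"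
      by (simp add: V_def mult.assoc)
    also have "\<dots> = c n * jump_kernel m f x (t - s)"
      unfolding cn by (intro nn_integral_multc) measurable
    finally show ?thesis .
  qed
  \<comment> \<open>By nonexplosion, almost surely exactly one pair \<open>n\<close>,
    \<open>m\<close> contributes.\<close>
  have "(\<integral>\<^sup>+ \<omega>. indicator B \<omega> * f (X t \<omega>) \<partial>M) =
    (\<integral>\<^sup>+ \<omega>. (\<Sum>n. \<Sum>m. (if at_jump n s \<omega> then if at_jump (n + m) t \<omega> then indicator B \<omega> * f (X t \<omega>) else 0 else 0)) \<partial>M)"
  proof (rule nn_integral_cong_AE, use AE_ex1_at_jump AE_S_pos in eventually_elim)
    case (elim \<omega>)
    obtain n where n: "\<forall>m. at_jump m s \<omega> \<longleftrightarrow> m = n" using elim s by blast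
    obtain n' where n': "\<forall>m. at_jump m t \<omega> \<longleftrightarrow> m = n'" using elim s by (meson order_trans)
    have "n \<le> n'"
    proof (rule ccontr)
      assume "\<not> n \<le> n'"
      then have "jump_time S (Suc n') \<omega> \<le> jump_time S n \<omega>"
        unfolding jump_time_def using elim(2) by (intro sum_mono2) (auto simp: less_imp_le)
      then show False using n n' s unfolding at_jump_def by fastforce
    qed
    then obtain k where k: "n' = n + k" using le_Suc_ex by blast
    define C where "C = indicator B \<omega> * f (X t \<omega>)"
    have "(\<Sum>i. \<Sum>m. (if at_jump i s \<omega> then if at_jump (i + m) t \<omega> then C else 0 else 0)) =
      (\<Sum>i. if at_jump i s \<omega> then \<Sum>m. (if at_jump (i + m) t \<omega> then C else 0) else 0)"
      by (intro suminf_cong) auto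
    also have "\<dots> = (\<Sum>m. (if at_jump (n + m) t \<omega> then C else 0))"
      by (rule suminf_at_jump[OF n])
    also have "\<dots> = (\<Sum>m. (if m = k then C else 0))"
      by (intro suminf_cong) (auto simp: n' k)
    also have "\<dots> = C" using sums_single[of k "\<lambda>_. C"] by (simp add: sums_iff)
    finally show ?case unfolding C_def by (rule sym)
  qed
  also have "\<dots> = (\<Sum>n. \<Sum>m. \<integral>\<^sup>+ \<omega>. (if at_jump n s \<omega> then if at_jump (n + m) t \<omega> then indicator B \<omega> * f (X t \<omega>) else 0 else 0) \<partial>M)"
    by (subst nn_integral_suminf; (intro suminf_cong nn_integral_suminf)?) measurable
  also have "\<dots> = (\<Sum>n. c n) * transition f x (t - s)"
    unfolding T by (simp add: transition_def)
  also have "(\<Sum>n. c n) = (\<integral>\<^sup>+ \<omega>. (\<Sum>n. if at_jump n s \<omega> then indicator B \<omega> else 0) \<partial>M)"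
    unfolding c_def by (intro nn_integral_suminf[symmetric]) measurable
  also have "\<dots> = (\<integral>\<^sup>+ \<omega>. indicator B \<omega> \<partial>M)"
  proof (rule nn_integral_cong_AE, use AE_ex1_at_jump in eventually_elim)
    case (elim \<omega>)
    then obtain n where n: "\<forall>m. at_jump m s \<omega> \<longleftrightarrow> m = n" using s by blast
    show ?case by (rule suminf_at_jump[OF n])
  qed
  also have "\<dots> = emeasure M B" by simp
  finally show ?thesis by (simp add: B_def)
qed

lemma emeasure_X_0: "emeasure M {\<omega> \<in> space M. X 0 \<omega> = x} = ennreal (pmf \<nu> x)"
proof -
  have [measurable]: "X 0 \<in> measurable M (count_space UNIV)" by (rule X_measurable) simp
  have "emeasure M {\<omega> \<in> space M. X 0 \<omega> = x} = emeasure M {\<omega> \<in> space M. \<forall>k\<le>0. Y k \<omega> = x \<and> 0 < S k \<omega>}"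
  proof (rule emeasure_eq_AE, use AE_X AE_S_pos in eventually_elim)
    case (elim \<omega>)
    have "X 0 \<omega> = Y 0 \<omega>" using elim(1)[rule_format, of 0 0] elim(2) by (simp add: jump_time_def)
    then show ?case using elim by auto
  qed auto
  also have "\<dots> = ennreal (pmf \<nu> x)" using emeasure_cylinder[of 0 "\<lambda>_. 0" "\<lambda>_. x"] by simp
  finally show ?thesis .
qed

end

section \<open>The resolvent\<close>

lemma nn_integral_exp_half_line:
  fixes c :: real
  assumes "0 < c"
  shows "(\<integral>\<^sup>+ t. (if 0 \<le> t then ennreal (exp (- c * t)) else 0) \<partial>lborel) = ennreal (1 / c)"
proof -
  have "ennreal c * (\<integral>\<^sup>+ t. (if 0 \<le> t then ennreal (exp (- c * t)) else 0) \<partial>lborel) =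
      (\<integral>\<^sup>+ t. ennreal c * (if 0 \<le> t then ennreal (exp (- c * t)) else 0) \<partial>lborel)"
    by (rule nn_integral_cmult[symmetric]) measurable
  also have "\<dots> = (\<integral>\<^sup>+ r. (if 0 < r then ennreal (c * exp (- c * r)) else 0) \<partial>lborel)"
  proof (rule nn_integral_cong_AE, use AE_lborel_singleton[of 0] in eventually_elim)
    case (elim t) then show ?case using assms by (auto simp: ennreal_mult)
  qed
  also have "\<dots> = 1" using nn_integral_exp_tail[OF assms, of 0] by simp
  finally have *: "ennreal c * (\<integral>\<^sup>+ t. (if 0 \<le> t then ennreal (exp (- c * t)) else 0) \<partial>lborel) = 1" .
  have "ennreal (1 / c) * (ennreal c * I) = I" for I
    using assms by (simp add: mult.assoc[symmetric] ennreal_mult[symmetric])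
  from this[of "\<integral>\<^sup>+ t. (if 0 \<le> t then ennreal (exp (- c * t)) else 0) \<partial>lborel"] show ?thesis
    unfolding * by simp
qed

context bd_rates
begin

text \<open>The Laplace transform at \<open>l\<close> of \<open>jump_kernel m f x\<close>, as
  \<open>laplace_jump_kernel\<close> shows; integrating out the first holding time leaves the factor
  \<open>1 / (l + rate x)\<close>.\<close>

primrec green :: "real \<Rightarrow> nat \<Rightarrow> (int \<Rightarrow> ennreal) \<Rightarrow> int \<Rightarrow> ennreal" where
  "green l 0 f x = ennreal (1 / (l + rate x)) * f x"
| "green l (Suc m) f x = ennreal (1 / (l + rate x)) *
     (ennreal (b x) * green l m f (x + 1) + ennreal (a x) * green l m f (x - 1))"

definition resolvent :: "real \<Rightarrow> (int \<Rightarrow> ennreal) \<Rightarrow> int \<Rightarrow> ennreal" where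
  "resolvent l f x = (\<Sum>m. green l m f x)"

text \<open>After exchanging the integrals and measuring \<open>t\<close> from the first jump time
  \<open>r\<close>, the exponential factorises: the double integral is the transform of the holding
  time times that of the remaining kernels.\<close>

lemma laplace_jump_kernel:
  assumes l: "0 < l"
  shows "(\<integral>\<^sup>+ t. (if 0 \<le> t then ennreal (exp (- l * t)) * jump_kernel m f x t else 0) \<partial>lborel) = green l m f x"
proof (induction m arbitrary: x)
  case 0
  have c: "0 < l + rate x" using l rate_pos[of x] by simp
  have "(\<integral>\<^sup>+ t. (if 0 \<le> t then ennreal (exp (- l * t)) * jump_kernel 0 f x t else 0) \<partial>lborel) =
    (\<integral>\<^sup>+ t. (if 0 \<le> t then ennreal (exp (- (l + rate x) * t)) else 0) * f x \<partial>lborel)"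
    by (intro nn_integral_cong) (auto simp: ennreal_exp_add distrib_right left_diff_distrib)
  also have "\<dots> = green l 0 f x"
    unfolding green.simps nn_integral_exp_half_line[OF c, symmetric] by (rule nn_integral_multc) measurable
  finally show ?case .
next
  case (Suc m)
  have c: "0 < l + rate x" using l rate_pos[of x] by simp
  define h where "h t = ennreal (b x) * jump_kernel m f (x + 1) t + ennreal (a x) * jump_kernel m f (x - 1) t" for t
  have [measurable]: "h \<in> borel_measurable borel" unfolding h_def[abs_def] by measurable
  have h: "(\<integral>\<^sup>+ t. (if 0 \<le> t then ennreal (exp (- l * t)) * h t else 0) \<partial>lborel) =
      ennreal (b x) * green l m f (x + 1) + ennreal (a x) * green l m f (x - 1)" (is "?H = _")
  proof -
    have "?H = (\<integral>\<^sup>+ t. ennreal (b x) * (if 0 \<le> t then ennreal (exp (- l * t)) * jump_kernel m f (x + 1) t else 0) +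
        ennreal (a x) * (if 0 \<le> t then ennreal (exp (- l * t)) * jump_kernel m f (x - 1) t else 0) \<partial>lborel)"
      by (intro nn_integral_cong) (auto simp: h_def distrib_left mult_ac)
    also have "\<dots> = ennreal (b x) * green l m f (x + 1) + ennreal (a x) * green l m f (x - 1)"
      by (subst nn_integral_add, measurable) (simp add: nn_integral_cmult Suc.IH)
    finally show ?thesis .
  qed
  have "(\<integral>\<^sup>+ t. (if 0 \<le> t then ennreal (exp (- l * t)) * jump_kernel (Suc m) f x t else 0) \<partial>lborel) =
    (\<integral>\<^sup>+ t. (\<integral>\<^sup>+ r. (if 0 \<le> r \<and> r \<le> t then ennreal (exp (- l * t)) * (ennreal (exp (- rate x * r)) * h (t - r)) else 0) \<partial>lborel) \<partial>lborel)"
  proof (intro nn_integral_cong)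
    fix t :: real
    have "ennreal (exp (- l * t)) * jump_kernel (Suc m) f x t =
      (\<integral>\<^sup>+ r. ennreal (exp (- l * t)) * (if 0 \<le> r \<and> r \<le> t then ennreal (exp (- rate x * r)) * h (t - r) else 0) \<partial>lborel)"
      unfolding jump_kernel.simps h_def by (rule nn_integral_cmult[symmetric]) measurable
    also have "\<dots> = (\<integral>\<^sup>+ r. (if 0 \<le> r \<and> r \<le> t then ennreal (exp (- l * t)) * (ennreal (exp (- rate x * r)) * h (t - r)) else 0) \<partial>lborel)"
      by (intro nn_integral_cong) auto
    finally have 1: "ennreal (exp (- l * t)) * jump_kernel (Suc m) f x t = \<dots>" .
    have 2: "(\<integral>\<^sup>+ r. (if 0 \<le> r \<and> r \<le> t then ennreal (exp (- l * t)) * (ennreal (exp (- rate x * r)) * h (t - r)) else 0) \<partial>lborel) = 0"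
      if "\<not> 0 \<le> t"
    proof -
      have "(\<lambda>r. (if 0 \<le> r \<and> r \<le> t then ennreal (exp (- l * t)) * (ennreal (exp (- rate x * r)) * h (t - r)) else 0)) = (\<lambda>r. 0)"
        using that by (auto simp: fun_eq_iff)
      then show ?thesis by simp
    qed
    show "(if 0 \<le> t then ennreal (exp (- l * t)) * jump_kernel (Suc m) f x t else 0) =
      (\<integral>\<^sup>+ r. (if 0 \<le> r \<and> r \<le> t then ennreal (exp (- l * t)) * (ennreal (exp (- rate x * r)) * h (t - r)) else 0) \<partial>lborel)"
      using 1 2 by auto
  qed
  also have "\<dots> = (\<integral>\<^sup>+ r. (\<integral>\<^sup>+ t. (if 0 \<le> r \<and> r \<le> t then ennreal (exp (- l * t)) * (ennreal (exp (- rate x * r)) * h (t - r)) else 0) \<partial>lborel) \<partial>lborel)"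
    by (rule lborel_pair.Fubini') measurable
  also have "\<dots> = (\<integral>\<^sup>+ r. (if 0 \<le> r then ennreal (exp (- (l + rate x) * r)) else 0) * ?H \<partial>lborel)"
  proof (intro nn_integral_cong)
    fix r :: real
    have "(\<integral>\<^sup>+ t. (if 0 \<le> r \<and> r \<le> t then ennreal (exp (- l * t)) * (ennreal (exp (- rate x * r)) * h (t - r)) else 0) \<partial>lborel) =
      (\<integral>\<^sup>+ t. (if 0 \<le> r \<and> r \<le> r + 1 * t then ennreal (exp (- l * (r + 1 * t))) * (ennreal (exp (- rate x * r)) * h (r + 1 * t - r)) else 0) \<partial>lborel)"
      by (subst nn_integral_real_affine[where c=1 and t=r]) auto
    also have "\<dots> = (\<integral>\<^sup>+ t. (if 0 \<le> r then ennreal (exp (- (l + rate x) * r)) else 0) * (if 0 \<le> t then ennreal (exp (- l * t)) * h t else 0) \<partial>lborel)"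
    proof (intro nn_integral_cong)
      fix t :: real
      have "- l * (r + 1 * t) + - rate x * r = - (l + rate x) * r + - l * t" by (simp add: algebra_simps)
      then show "(if 0 \<le> r \<and> r \<le> r + 1 * t then ennreal (exp (- l * (r + 1 * t))) * (ennreal (exp (- rate x * r)) * h (r + 1 * t - r)) else 0) =
        (if 0 \<le> r then ennreal (exp (- (l + rate x) * r)) else 0) * (if 0 \<le> t then ennreal (exp (- l * t)) * h t else 0)"
        unfolding ennreal_exp_add by (auto simp: ennreal_exp_add simp del: mult_minus_left mult_minus_right minus_add_distrib)
    qed
    also have "\<dots> = (if 0 \<le> r then ennreal (exp (- (l + rate x) * r)) else 0) * ?H"
      by (rule nn_integral_cmult) measurable
    finally show "(\<integral>\<^sup>+ t. (if 0 \<le> r \<and> r \<le> t then ennreal (exp (- l * t)) * (ennreal (exp (- rate x * r)) * h (t - r)) else 0) \<partial>lborel) =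
      (if 0 \<le> r then ennreal (exp (- (l + rate x) * r)) else 0) * ?H" .
  qed
  also have "\<dots> = ennreal (1 / (l + rate x)) * ?H"
    unfolding nn_integral_exp_half_line[OF c, symmetric] by (rule nn_integral_multc) measurable
  finally show ?case unfolding h by simp
qed

lemma laplace_transition:
  assumes l: "0 < l"
  shows "(\<integral>\<^sup>+ t. (if 0 \<le> t then ennreal (exp (- l * t)) * transition f x t else 0) \<partial>lborel) = resolvent l f x"
proof -
  have "(\<integral>\<^sup>+ t. (if 0 \<le> t then ennreal (exp (- l * t)) * transition f x t else 0) \<partial>lborel) =
      (\<integral>\<^sup>+ t. (\<Sum>m. if 0 \<le> t then ennreal (exp (- l * t)) * jump_kernel m f x t else 0) \<partial>lborel)"
    by (intro nn_integral_cong) (auto simp: transition_def)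
  also have "\<dots> = (\<Sum>m. \<integral>\<^sup>+ t. (if 0 \<le> t then ennreal (exp (- l * t)) * jump_kernel m f x t else 0) \<partial>lborel)"
    by (rule nn_integral_suminf) measurable
  finally show ?thesis by (simp add: laplace_jump_kernel[OF l] resolvent_def)
qed

text \<open>The resolvent equation (l - L) R f = f for the generator L, solved for the diagonal term
  so that no subtraction in \<open>ennreal\<close> occurs.\<close>

lemma resolvent_eq:
  "resolvent l f x = ennreal (1 / (l + rate x)) *
     (f x + ennreal (b x) * resolvent l f (x + 1) + ennreal (a x) * resolvent l f (x - 1))"
proof -
  have "(\<lambda>m. green l (Suc m) f x) sums (ennreal (1 / (l + rate x)) *
     (ennreal (b x) * resolvent l f (x + 1) + ennreal (a x) * resolvent l f (x - 1)))"
    unfolding green.simps resolvent_def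
    by (simp add: sums_iff ennreal_suminf_cmult suminf_add[OF summableI summableI, symmetric])
  from sums_Suc[OF this] show ?thesis
    by (simp add: resolvent_def sums_iff distrib_left add_ac)
qed

text \<open>The definition of \<open>green\<close> splits off the first jump, this identity the last
  one. Reversing a path needs both recursions, since its last jump becomes the first jump of the
  reversal.\<close>

lemma green_forward:
  "green l (Suc m) (indicator {y}) x = ennreal (1 / (l + rate y)) *
     (ennreal (b (y - 1)) * green l m (indicator {y - 1}) x + ennreal (a (y + 1)) * green l m (indicator {y + 1}) x)"
proof (induction m arbitrary: x)
  case 0
  have "x + 1 = y \<longleftrightarrow> x = y - 1" "x - 1 = y \<longleftrightarrow> x = y + 1" by auto
  then show ?case by (cases "x = y - 1"; cases "x = y + 1") (auto simp: mult_ac)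
next
  case (Suc m)
  have "green l (Suc (Suc m)) (indicator {y}) x = ennreal (1 / (l + rate x)) *
     (ennreal (b x) * green l (Suc m) (indicator {y}) (x + 1) + ennreal (a x) * green l (Suc m) (indicator {y}) (x - 1))"
    by simp
  also have "\<dots> = ennreal (1 / (l + rate y)) *
     (ennreal (b (y - 1)) * green l (Suc m) (indicator {y - 1}) x + ennreal (a (y + 1)) * green l (Suc m) (indicator {y + 1}) x)"
    unfolding Suc.IH by (simp add: distrib_left mult_ac add_ac)
  finally show ?case .
qed

text \<open>The last jump into \<open>y\<close> is split off by \<open>green_forward\<close>;
  detailed balance turns its rate into that of the reversed jump out of \<open>y\<close>, and this
  is the first jump in the defining recursion.\<close>

lemma green_symmetric:
  fixes \<mu> :: "int \<Rightarrow> real"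
  assumes \<mu>: "\<And>n. \<mu> n * b n = \<mu> (n + 1) * a (n + 1)" "\<And>n. 0 \<le> \<mu> n"
  shows "ennreal (\<mu> x) * green l m (indicator {y}) x = ennreal (\<mu> y) * green l m (indicator {x}) y"
proof (induction m arbitrary: x y)
  case 0
  then show ?case by (auto split: split_indicator)
next
  case (Suc m)
  have up: "ennreal (\<mu> z) * ennreal (b z) = ennreal (\<mu> (z + 1)) * ennreal (a (z + 1))" for z
    using \<mu>(1)[of z] \<mu>(2) a_pos b_pos by (simp add: ennreal_mult[symmetric] less_imp_le)
  note up' = up[of "y - 1", simplified]
  have "ennreal (\<mu> x) * green l (Suc m) (indicator {y}) x = ennreal (1 / (l + rate y)) *
     (ennreal (b (y - 1)) * (ennreal (\<mu> x) * green l m (indicator {y - 1}) x) +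
      ennreal (a (y + 1)) * (ennreal (\<mu> x) * green l m (indicator {y + 1}) x))"
    unfolding green_forward by (simp add: distrib_left mult_ac)
  also have "\<dots> = ennreal (1 / (l + rate y)) *
     ((ennreal (\<mu> (y - 1)) * ennreal (b (y - 1))) * green l m (indicator {x}) (y - 1) +
      (ennreal (\<mu> (y + 1)) * ennreal (a (y + 1))) * green l m (indicator {x}) (y + 1))"
    unfolding Suc.IH[of x "y - 1"] Suc.IH[of x "y + 1"] by (simp add: mult_ac)
  also have "\<dots> = ennreal (\<mu> y) * green l (Suc m) (indicator {x}) y"
    unfolding up' up[symmetric] by (simp add: distrib_left mult_ac add_ac)
  finally show ?case .
qed

lemma resolvent_symmetric:
  fixes \<mu> :: "int \<Rightarrow> real"
  assumes "\<And>n. \<mu> n * b n = \<mu> (n + 1) * a (n + 1)" "\<And>n. 0 \<le> \<mu> n"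
  shows "ennreal (\<mu> x) * resolvent l (indicator {y}) x = ennreal (\<mu> y) * resolvent l (indicator {x}) y"
  unfolding resolvent_def ennreal_suminf_cmult[symmetric] green_symmetric[of \<mu> x l _ y, OF assms] ..

text \<open>A comparison principle without optional stopping: the inequality is proved by induction
  for the truncations to fewer than \<open>n\<close> jumps, where the drift condition on
  \<open>h\<close> is what the induction step asks for.\<close>

lemma resolvent_Lyapunov:
  fixes h :: "int \<Rightarrow> real"
  assumes l: "0 < l" and h: "\<And>x. 0 \<le> h x" and c: "0 \<le> c"
    and drift: "\<And>x. b x * h (x + 1) + a x * h (x - 1) + 1 \<le> rate x * h x + c * indicator {0} x"
  shows "resolvent l (\<lambda>_. 1) x \<le> ennreal (h x) + ennreal c * resolvent l (indicator {0}) x"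
proof -
  define G where "G n f x = (\<Sum>m<n. green l m f x)" for n f x
  have G: "G (Suc n) f x = ennreal (1 / (l + rate x)) * (f x + (ennreal (b x) * G n f (x + 1) + ennreal (a x) * G n f (x - 1)))" for n f x
    unfolding G_def by (subst sum.lessThan_Suc_shift) (simp add: sum_distrib_left sum.distrib distrib_left)
  have "G n (\<lambda>_. 1) x \<le> ennreal (h x) + ennreal c * G n (indicator {0}) x" for n
  proof (induction n arbitrary: x)
    case 0
    then show ?case by (simp add: G_def)
  next
    case (Suc n)
    let ?k = "ennreal (1 / (l + rate x))" and ?I = "\<lambda>x. G n (indicator {0}) x"
    have lr: "0 < l + rate x" using l rate_pos[of x] by simp
    have h': "0 \<le> a x * h y" "0 \<le> b x * h y" "0 \<le> rate x * h y" for y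
      using h[of y] a_pos[of x] b_pos[of x] rate_pos[of x] by simp_all
    have "G (Suc n) (\<lambda>_. 1) x \<le> ?k * (1 + (ennreal (b x) * (ennreal (h (x + 1)) + ennreal c * ?I (x + 1)) +
        ennreal (a x) * (ennreal (h (x - 1)) + ennreal c * ?I (x - 1))))"
      unfolding G by (intro mult_left_mono add_left_mono add_mono Suc.IH) auto
    also have "\<dots> = ?k * ennreal (b x * h (x + 1) + a x * h (x - 1) + 1) +
        ?k * (ennreal c * (ennreal (b x) * ?I (x + 1) + ennreal (a x) * ?I (x - 1)))"
      using h' h a_pos[of x] b_pos[of x]
      by (simp add: ennreal_mult distrib_left mult_ac add_ac)
    also have "?k * ennreal (b x * h (x + 1) + a x * h (x - 1) + 1) \<le> ?k * ennreal (rate x * h x + c * indicator {0} x)"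
      using drift[of x] by (intro mult_left_mono ennreal_leI) auto
    also have "\<dots> = ennreal ((rate x / (l + rate x)) * h x) + ?k * (ennreal c * indicator {0} x)"
      using lr h[of x] h' c by (auto simp: ennreal_mult[symmetric] ennreal_plus[symmetric] add_divide_distrib
          split: split_indicator simp del: ennreal_plus)
    \<comment> \<open>Killing at rate \<open>l\<close> can only decrease the contribution of the
      nonnegative \<open>h\<close>.\<close>
    also have "ennreal ((rate x / (l + rate x)) * h x) \<le> ennreal (h x)"
      using lr l rate_pos[of x] h[of x] by (intro ennreal_leI mult_left_le_one_le) auto
    finally have "G (Suc n) (\<lambda>_. 1) x \<le> ennreal (h x) + ?k * (ennreal c * indicator {0} x) +
        ?k * (ennreal c * (ennreal (b x) * ?I (x + 1) + ennreal (a x) * ?I (x - 1)))"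
      by (simp add: add_right_mono)
    also have "\<dots> = ennreal (h x) + ennreal c * G (Suc n) (indicator {0}) x"
      unfolding G by (simp add: distrib_left mult_ac add_ac)
    finally show ?case .
  qed
  also have "G n (indicator {0}) x \<le> resolvent l (indicator {0}) x" for n
    unfolding G_def resolvent_def by (intro sum_le_suminf) auto
  finally have "G n (\<lambda>_. 1) x \<le> ennreal (h x) + ennreal c * resolvent l (indicator {0}) x" for n
    by (simp add: mult_left_mono)
  then show ?thesis
    unfolding resolvent_def G_def by (intro suminf_le_const) auto
qed

end

section \<open>Scale function estimates\<close>

text \<open>Exchange of summation in a triangle; partial tails of \<open>\<mu>\<close> appear as
  weights of the scale increments \<open>c j\<close>.\<close>

lemma sum_int_triangle_swap:
  fixes \<mu> c :: "int \<Rightarrow> real"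
  shows "(\<Sum>i=1..N. \<mu> (i + 1) * (\<Sum>j=1..i. c j)) = (\<Sum>j=1..N. c j * (\<Sum>i=j+1..N+1. \<mu> i))"
proof -
  have "(\<Sum>i=1..N. \<mu> (i + 1) * (\<Sum>j=1..i. c j)) = (\<Sum>i\<in>{1..N}. \<Sum>j\<in>{j\<in>{1..N}. j \<le> i}. c j * \<mu> (i + 1))"
    unfolding sum_distrib_left by (intro sum.cong) (auto simp: mult.commute)
  also have "\<dots> = (\<Sum>j\<in>{1..N}. \<Sum>i\<in>{i\<in>{1..N}. j \<le> i}. c j * \<mu> (i + 1))"
    by (rule sum.swap_restrict) auto
  also have "\<dots> = (\<Sum>j=1..N. c j * (\<Sum>i=j+1..N+1. \<mu> i))"
  proof (intro sum.cong refl)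
    fix j assume j: "j \<in> {1..N}"
    have "(\<Sum>i=j+1..N+1. \<mu> i) = (\<Sum>i\<in>{i\<in>{1..N}. j \<le> i}. \<mu> (i + 1))"
      by (rule sum.reindex_bij_witness[of _ "\<lambda>i. i + 1" "\<lambda>i. i - 1"]) (use j in auto)
    then show "(\<Sum>i\<in>{i\<in>{1..N}. j \<le> i}. c j * \<mu> (i + 1)) = c j * (\<Sum>i=j+1..N+1. \<mu> i)"
      by (simp add: sum_distrib_left)
  qed
  finally show ?thesis .
qed

section \<open>Detailed balance and the series on a half-line\<close>

locale bd_balance =
  fixes a b \<mu> :: "int \<Rightarrow> real"
  assumes a_pos: "\<And>n. 0 < a n" and b_pos: "\<And>n. 0 < b n" and \<mu>_pos: "\<And>n. 0 < \<mu> n"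
    and balance: "\<And>n. \<mu> n * b n = \<mu> (n + 1) * a (n + 1)"
    and \<mu>_summable: "\<mu> summable_on UNIV"
begin

text \<open>Reflection of the line exchanges birth and death rates, so results on the right
  half-line also cover the left one.\<close>

lemma mirror: "bd_balance (\<lambda>n. b (- n)) (\<lambda>n. a (- n)) (\<lambda>n. \<mu> (- n))"
proof
  show "\<mu> (- n) * a (- n) = \<mu> (- (n + 1)) * b (- (n + 1))" for n
    using balance[of "- n - 1"] by simp
  show "(\<lambda>n. \<mu> (- n)) summable_on UNIV"
    using \<mu>_summable by (subst summable_on_reindex_bij_betw[of uminus UNIV UNIV]) (auto simp: bij_uminus)
qed (simp_all add: a_pos b_pos \<mu>_pos)

lemma flux_pos: "0 < \<mu> n * b n"
  using \<mu>_pos b_pos by simp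

text \<open>\<open>D\<close> is the gradient of \<open>w\<close> weighted by the flux
  \<open>\<mu> n * b n\<close>. Detailed balance turns the drift condition into a decrease of
  \<open>D\<close> by at least \<open>\<mu> n\<close>. Boundedness of \<open>w\<close> forces
  \<open>D n\<close> to dominate the tail of \<open>\<mu>\<close> beyond \<open>n\<close>; dividing
  by the flux and telescoping bounds the partial sums of the series by the oscillation of
  \<open>w\<close>.\<close>

lemma entrance_of_supersolution:
  assumes K: "\<And>n. \<mu> n * b n \<le> K" and C: "\<And>n. \<bar>w n\<bar> \<le> C"
    and drift: "\<And>n. 1 \<le> n \<Longrightarrow> b n * (w (n + 1) - w n) + a n * (w (n - 1) - w n) \<le> - 1"
  shows "(\<lambda>i::int. \<mu> (i + 1) * (\<Sum>j=1..i. 1 / (\<mu> j * b j))) summable_on {1..}"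
proof -
  define D where "D n = \<mu> n * b n * (w (n + 1) - w n)" for n
  have D_step: "D n \<le> D (n - 1) - \<mu> n" if "1 \<le> n" for n
  proof -
    have "D n - D (n - 1) = \<mu> n * (b n * (w (n + 1) - w n) + a n * (w (n - 1) - w n))"
      using balance[of "n - 1"] by (simp add: D_def algebra_simps)
    also have "\<dots> \<le> \<mu> n * (- 1)" using drift[OF that] \<mu>_pos[of n] by (intro mult_left_mono) auto
    finally show ?thesis by simp
  qed
  have D_le: "D m \<le> D n - (\<Sum>i=n+1..m. \<mu> i)" if "0 \<le> n" "n \<le> m" for n m
    using that(2)
  proof (induction m rule: int_ge_induct)
    case base then show ?case by simp
  next
    case (step m)
    have "{n+1..m+1} = insert (m + 1) {n+1..m}" using step by auto
    then show ?case using step that(1) D_step[of "m + 1"] by simp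
  qed
  have D_ge: "(\<Sum>i=n+1..M. \<mu> i) \<le> D n" if n: "0 \<le> n" for n M
  proof (rule ccontr)
    assume "\<not> (\<Sum>i=n+1..M. \<mu> i) \<le> D n"
    \<comment> \<open>If a partial tail exceeds \<open>D n\<close>, then \<open>D\<close> is at most
      \<open>- \<epsilon>\<close> from \<open>M'\<close> on. As the flux is at most
      \<open>K\<close>, \<open>w\<close> falls by at least \<open>\<epsilon> / K\<close> at each
      further step, against its boundedness.\<close>
    define M' where "M' = max n M"
    define \<epsilon> where "\<epsilon> = (\<Sum>i=n+1..M'. \<mu> i) - D n"
    have mono: "(\<Sum>i=n+1..m. \<mu> i) \<le> (\<Sum>i=n+1..m'. \<mu> i)" if "m \<le> m'" for m m'
      using that \<mu>_pos by (intro sum_mono2) (auto simp: less_imp_le)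
    have \<epsilon>: "0 < \<epsilon>" using \<open>\<not> _ \<le> D n\<close> mono[of M M'] by (simp add: \<epsilon>_def M'_def)
    have K0: "0 < K" using flux_pos[of 0] K[of 0] by linarith
    have dec: "w (m + 1) - w m \<le> - \<epsilon> / K" if "M' \<le> m" for m
    proof -
      have "D m \<le> - \<epsilon>" using D_le[OF n, of m] that mono[OF that] by (simp add: \<epsilon>_def M'_def)
      then have *: "\<mu> m * b m * (w m - w (m + 1)) \<ge> \<epsilon>" by (simp add: D_def algebra_simps)
      then have "0 < w m - w (m + 1)" using \<epsilon> flux_pos[of m] by (smt (verit) mult_nonneg_nonpos)
      then have "\<mu> m * b m * (w m - w (m + 1)) \<le> K * (w m - w (m + 1))"
        using K[of m] by (intro mult_right_mono) auto
      then have "\<epsilon> \<le> K * (w m - w (m + 1))" using * by linarith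
      then have "\<epsilon> / K \<le> w m - w (m + 1)" using K0 by (simp add: pos_divide_le_eq mult.commute)
      then show ?thesis by simp
    qed
    have "w (M' + int k) \<le> w M' - real k * (\<epsilon> / K)" for k
    proof (induction k)
      case (Suc k)
      have "w (M' + int (Suc k)) \<le> w (M' + int k) - \<epsilon> / K" using dec[of "M' + int k"] by (simp add: algebra_simps)
      also have "\<dots> \<le> w M' - real (Suc k) * (\<epsilon> / K)" using Suc by (simp add: algebra_simps)
      finally show ?case .
    qed simp
    then have "real k * (\<epsilon> / K) \<le> 2 * C" for k
      using C[of M'] C[of "M' + int k"] by (smt (verit))
    moreover obtain k :: nat where "2 * C / (\<epsilon> / K) < real k" using reals_Archimedean2 by blast
    ultimately show False using \<epsilon> K0 by (smt (verit) divide_pos_pos pos_divide_less_eq)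
  qed
  have bound: "(\<Sum>i=1..N. \<mu> (i + 1) * (\<Sum>j=1..i. 1 / (\<mu> j * b j))) \<le> 2 * C" if "0 \<le> N" for N
  proof -
    have "(\<Sum>i=1..N. \<mu> (i + 1) * (\<Sum>j=1..i. 1 / (\<mu> j * b j))) = (\<Sum>j=1..N. 1 / (\<mu> j * b j) * (\<Sum>i=j+1..N+1. \<mu> i))"
      by (rule sum_int_triangle_swap)
    also have "\<dots> \<le> (\<Sum>j=1..N. w (j + 1) - w j)"
    proof (rule sum_mono)
      fix j assume "j \<in> {1..N}"
      then have "(\<Sum>i=j+1..N+1. \<mu> i) \<le> D j" by (intro D_ge) auto
      then show "1 / (\<mu> j * b j) * (\<Sum>i=j+1..N+1. \<mu> i) \<le> w (j + 1) - w j"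
        using flux_pos[of j] by (simp add: D_def divide_le_eq mult.commute)
    qed
    also have "\<dots> = w (N + 1) - w 1"
      using that
    proof (induction N rule: int_ge_induct)
      case (step N)
      have "{1..N+1} = insert (N + 1) {1..N}" using step by auto
      then show ?case using step by simp
    qed simp
    also have "\<dots> \<le> 2 * C" using C[of "N + 1"] C[of 1] by linarith
    finally show ?thesis .
  qed
  have nonneg: "0 \<le> \<mu> (i + 1) * (\<Sum>j=1..i. 1 / (\<mu> j * b j))" for i
    using \<mu>_pos flux_pos by (intro mult_nonneg_nonneg sum_nonneg) (auto simp: less_imp_le)
  show ?thesis
  proof (rule nonneg_bdd_above_summable_on)
    show "bdd_above (sum (\<lambda>i. \<mu> (i + 1) * (\<Sum>j=1..i. 1 / (\<mu> j * b j))) ` {F. F \<subseteq> {1..} \<and> finite F})"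
    proof (rule bdd_aboveI2)
      fix F :: "int set" assume F: "F \<in> {F. F \<subseteq> {1..} \<and> finite F}"
      define N where "N = Max (insert 0 F)"
      have "F \<subseteq> {1..N}" "0 \<le> N" using F by (auto simp: N_def)
      then have "(\<Sum>i\<in>F. \<mu> (i + 1) * (\<Sum>j=1..i. 1 / (\<mu> j * b j))) \<le> (\<Sum>i=1..N. \<mu> (i + 1) * (\<Sum>j=1..i. 1 / (\<mu> j * b j)))"
        using nonneg by (intro sum_mono2) auto
      also have "\<dots> \<le> 2 * C" by (rule bound) fact
      finally show "(\<Sum>i\<in>F. \<mu> (i + 1) * (\<Sum>j=1..i. 1 / (\<mu> j * b j))) \<le> 2 * C" .
    qed
  qed (rule nonneg)
qed

text \<open>The witness is the classical formula for the mean time to reach 0 from \<open>n\<close>,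
  a sum of scale increments times tails of \<open>\<mu>\<close>. It satisfies the drift condition
  with equality, and the series, after exchange of summation, bounds it.\<close>

lemma Lyapunov_half_line:
  assumes entrance: "(\<lambda>i::int. \<mu> (i + 1) * (\<Sum>j=1..i. 1 / (\<mu> j * b j))) summable_on {1..}"
  shows "\<exists>h H. h 0 = (0::real) \<and> (\<forall>n\<ge>0. 0 \<le> h n \<and> h n \<le> H) \<and>
    (\<forall>n\<ge>1. b n * h (n + 1) + a n * h (n - 1) + 1 \<le> (a n + b n) * h n)"
proof -
  define tail where "tail j = infsum \<mu> {j<..}" for j :: int
  define c where "c j = 1 / (\<mu> j * b j)" for j
  have c_pos: "0 < c j" for j using flux_pos by (simp add: c_def)
  have sm: "\<mu> summable_on A" for A using \<mu>_summable by (rule summable_on_subset_banach) simp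
  have tail_nonneg: "0 \<le> tail j" for j unfolding tail_def by (intro infsum_nonneg) (simp add: \<mu>_pos less_imp_le)
  have tail_step: "tail (j - 1) = \<mu> j + tail j" for j
  proof -
    have "{j - 1<..} = insert j {j<..}" by auto
    then show ?thesis unfolding tail_def using sm by (simp add: infsum_insert)
  qed
  have tail_lim: "(\<lambda>M. \<Sum>i=j+1..int M + 1. \<mu> i) \<longlonglongrightarrow> tail j" for j
  proof -
    have 1: "(sum \<mu> \<longlongrightarrow> tail j) (finite_subsets_at_top {j<..})"
      using has_sum_infsum[OF sm[of "{j<..}"]] unfolding has_sum_def tail_def .
    have "filterlim (\<lambda>M. {j+1..int M + 1}) (finite_subsets_at_top {j<..}) sequentially"
      unfolding filterlim_finite_subsets_at_top
    proof (intro allI impI)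
      fix F :: "int set" assume F: "finite F \<and> F \<subseteq> {j<..}"
      show "\<forall>\<^sub>F M in sequentially. finite {j+1..int M + 1} \<and> F \<subseteq> {j+1..int M + 1} \<and> {j+1..int M + 1} \<subseteq> {j<..}"
      proof (rule eventually_sequentiallyI[of "nat (Max (insert 0 F))"])
        fix M assume M: "nat (Max (insert 0 F)) \<le> M"
        have "x \<le> int M" if "x \<in> F" for x
        proof -
          have "x \<le> Max (insert 0 F)" using that F by (intro Max_ge) auto
          then show ?thesis using M by linarith
        qed
        then show "finite {j+1..int M + 1} \<and> F \<subseteq> {j+1..int M + 1} \<and> {j+1..int M + 1} \<subseteq> {j<..}"
          using F by force
      qed
    qed
    then show ?thesis using filterlim_compose[OF 1] by simp
  qed
  define T where "T = infsum (\<lambda>i. \<mu> (i + 1) * (\<Sum>j=1..i. c j)) {1..}"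
  \<comment> \<open>The exchange of summation is applied with tails cut off at \<open>M + 1\<close>;
    the full tails appear in the limit. All terms are nonnegative, so once \<open>M\<close> exceeds
    \<open>N\<close> the cut-off sum is below a partial sum of the series \<open>T\<close>.\<close>
  have T: "(\<Sum>j=1..N. c j * tail j) \<le> T" for N
  proof (rule LIMSEQ_le_const2)
    show "(\<lambda>M. \<Sum>j=1..N. c j * (\<Sum>i=j+1..int M + 1. \<mu> i)) \<longlonglongrightarrow> (\<Sum>j=1..N. c j * tail j)"
      by (intro tendsto_sum tendsto_mult tendsto_const tail_lim)
    show "\<exists>M0. \<forall>M\<ge>M0. (\<Sum>j=1..N. c j * (\<Sum>i=j+1..int M + 1. \<mu> i)) \<le> T"
    proof (intro exI[of _ "nat N"] allI impI)
      fix M assume "nat N \<le> M"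
      then have "(\<Sum>j=1..N. c j * (\<Sum>i=j+1..int M + 1. \<mu> i)) \<le> (\<Sum>j=1..int M. c j * (\<Sum>i=j+1..int M + 1. \<mu> i))"
        using c_pos \<mu>_pos by (intro sum_mono2) (auto intro!: mult_nonneg_nonneg sum_nonneg simp: less_imp_le)
      also have "\<dots> = (\<Sum>i=1..int M. \<mu> (i + 1) * (\<Sum>j=1..i. c j))" by (rule sum_int_triangle_swap[symmetric])
      also have "\<dots> \<le> T"
        unfolding T_def using entrance c_pos \<mu>_pos
        by (intro finite_sum_le_infsum) (auto intro!: mult_nonneg_nonneg sum_nonneg simp: less_imp_le c_def)
      finally show "(\<Sum>j=1..N. c j * (\<Sum>i=j+1..int M + 1. \<mu> i)) \<le> T" .
    qed
  qed
  \<comment> \<open>The term for \<open>j = 0\<close> is not part of the series, hence the extra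
    summand \<open>c 0 * tail 0\<close> in the bound.\<close>
  define h where "h n = (\<Sum>j=0..n-1. c j * tail j)" for n
  have h_step: "h (n + 1) = h n + c n * tail n" if "0 \<le> n" for n
  proof -
    have "{0..n} = insert n {0..n-1}" using that by auto
    then show ?thesis by (simp add: h_def)
  qed
  have ct: "0 \<le> c j * tail j" for j using c_pos[of j] tail_nonneg[of j] by simp
  show ?thesis
  proof (intro exI[of _ h] exI[of _ "c 0 * tail 0 + T"] conjI allI impI)
    show "h 0 = 0" by (simp add: h_def)
    fix n :: int assume n: "0 \<le> n"
    have "h n \<le> c 0 * tail 0 + (\<Sum>j=1..n-1. c j * tail j)"
    proof -
      have "h n \<le> (\<Sum>j\<in>insert 0 {1..n-1}. c j * tail j)"
        unfolding h_def using ct by (intro sum_mono2) auto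
      then show ?thesis by simp
    qed
    then show "h n \<le> c 0 * tail 0 + T" using T[of "n - 1"] by simp
    show "0 \<le> h n" using ct by (auto simp: h_def intro!: sum_nonneg)
  next
    fix n :: int assume n: "1 \<le> n"
    have 1: "h (n + 1) = h n + c n * tail n" using n by (intro h_step) simp
    have 2: "h (n - 1) = h n - c (n - 1) * tail (n - 1)" using h_step[of "n - 1"] n by simp
    have 3: "b n * (c n * tail n) = tail n / \<mu> n" using b_pos[of n] by (simp add: c_def)
    \<comment> \<open>Detailed balance across the edge from \<open>n - 1\<close> to
      \<open>n\<close>. The surplus \<open>\<mu> n\<close> of \<open>tail (n - 1)\<close> over
      \<open>tail n\<close> then yields the drift \<open>- 1\<close>.\<close>
    have "c (n - 1) = 1 / (\<mu> n * a n)" using balance[of "n - 1"] by (simp add: c_def)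
    then have 4: "a n * (c (n - 1) * tail (n - 1)) = (\<mu> n + tail n) / \<mu> n"
      using a_pos[of n] by (simp add: tail_step)
    have "b n * h (n + 1) + a n * h (n - 1) + 1 = (a n + b n) * h n + b n * (c n * tail n) - a n * (c (n - 1) * tail (n - 1)) + 1"
      unfolding 1 2 by (simp add: algebra_simps)
    also have "\<dots> = (a n + b n) * h n"
      unfolding 3 4 using \<mu>_pos[of n] by (simp add: add_divide_distrib)
    finally show "b n * h (n + 1) + a n * h (n - 1) + 1 \<le> (a n + b n) * h n" by simp
  qed
qed

end

text \<open>The solutions on the two half-lines both vanish at 0 and are glued there. Neither
  controls the drift at 0 itself, which the multiple \<open>c\<close> of the indicator
  absorbs.\<close>

lemma (in bd_balance) Lyapunov_entrance:
  assumes "(\<lambda>i::int. \<mu> (i + 1) * (\<Sum>j=1..i. 1 / (\<mu> j * b j))) summable_on {1..}"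
    and "(\<lambda>i::int. \<mu> (- i - 1) * (\<Sum>j=1..i. 1 / (\<mu> (- j) * a (- j)))) summable_on {1..}"
  obtains h H c where "\<And>n. 0 \<le> h n" "\<And>n. h n \<le> H" "0 < c"
    "\<And>n. b n * h (n + 1) + a n * h (n - 1) + 1 \<le> (a n + b n) * h n + c * indicator {0} n"
proof -
  obtain h1 H1 where h1: "h1 0 = (0::real)" "\<And>n. 0 \<le> n \<Longrightarrow> 0 \<le> h1 n \<and> h1 n \<le> H1"
    "\<And>n. 1 \<le> n \<Longrightarrow> b n * h1 (n + 1) + a n * h1 (n - 1) + 1 \<le> (a n + b n) * h1 n"
    using Lyapunov_half_line[OF assms(1)] by blast
  interpret mirror: bd_balance "\<lambda>n. b (- n)" "\<lambda>n. a (- n)" "\<lambda>n. \<mu> (- n)" by (rule mirror)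
  have "(\<lambda>i::int. \<mu> (- (i + 1)) * (\<Sum>j=1..i. 1 / (\<mu> (- j) * a (- j)))) summable_on {1..}"
    using assms(2) by (simp add: algebra_simps)
  then obtain h2 H2 where h2: "h2 0 = (0::real)" "\<And>n. 0 \<le> n \<Longrightarrow> 0 \<le> h2 n \<and> h2 n \<le> H2"
    "\<And>n. 1 \<le> n \<Longrightarrow> a (- n) * h2 (n + 1) + b (- n) * h2 (n - 1) + 1 \<le> (b (- n) + a (- n)) * h2 n"
    using mirror.Lyapunov_half_line by blast
  define h where "h n = (if 0 \<le> n then h1 n else h2 (- n))" for n
  \<comment> \<open>As \<open>h\<close> vanishes at 0, this is the left-hand side of the drift
    inequality there.\<close>
  define c where "c = b 0 * h1 1 + a 0 * h2 1 + 1"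
  show thesis
  proof (rule that[of h "max H1 H2" c])
    show "0 \<le> h n" "h n \<le> max H1 H2" for n using h1(2)[of n] h2(2)[of "- n"] by (auto simp: h_def)
    show "0 < c" using h1(2)[of 1] h2(2)[of 1] a_pos[of 0] b_pos[of 0]
      unfolding c_def by (intro add_nonneg_pos add_nonneg_nonneg mult_nonneg_nonneg) auto
    show "b n * h (n + 1) + a n * h (n - 1) + 1 \<le> (a n + b n) * h n + c * indicator {0} n" for n
    proof -
      consider "1 \<le> n" | "n = 0" | "n \<le> - 1" by linarith
      then show ?thesis
      proof cases
        case 1 then show ?thesis using h1(3)[of n] by (simp add: h_def)
      next
        case 2 then show ?thesis using h1(1) by (simp add: h_def c_def)
      next
        case 3
        \<comment> \<open>For \<open>n = - 1\<close> the value at 0 comes from \<open>h1\<close>,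
          while the reflected inequality refers to \<open>h2\<close>; both are 0.\<close>
        have "h (n + 1) = h2 (- n - 1)" using 3 h1(1) h2(1) by (cases "n = - 1") (auto simp: h_def)
        then show ?thesis using 3 h2(3)[of "- n"] by (simp add: h_def algebra_simps)
      qed
    qed
  qed
qed

section \<open>Transition probabilities\<close>

lemma (in bd_rates) transition_mono: "(\<And>z. f z \<le> g z) \<Longrightarrow> transition f x t \<le> transition g x t"
proof -
  assume fg: "\<And>z. f z \<le> g z"
  have "jump_kernel m f x t \<le> jump_kernel m g x t" for m
  proof (induction m arbitrary: x t)
    case 0 then show ?case by (simp add: fg mult_left_mono)
  next
    case (Suc m)
    show ?case unfolding jump_kernel.simps
      by (intro nn_integral_mono) (auto intro!: mult_left_mono add_mono Suc.IH)
  qed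
  then show ?thesis unfolding transition_def by (intro suminf_le) auto
qed

lemma (in bd_rates) transition_stay: "ennreal (exp (- rate x * t)) \<le> transition (indicator {x}) x t"
proof -
  have "jump_kernel 0 (indicator {x}) x t \<le> transition (indicator {x}) x t"
    unfolding transition_def using sum_le_suminf[of "\<lambda>m. jump_kernel m (indicator {x}) x t" "{0}"] by simp
  then show ?thesis by simp
qed

text \<open>With a process for every initial law at hand, total mass and composition over time of
  \<open>transition\<close> from \<open>x\<close> are read off the process started in
  \<open>x\<close> instead of being derived from the kernels.\<close>

locale bd_family = bd_rates a b for a b +
  fixes M :: "int pmf \<Rightarrow> 'a measure" and X :: "int pmf \<Rightarrow> real \<Rightarrow> 'a \<Rightarrow> int"
  assumes nonexplosive: "nonexplosive (bd_generator a b)"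
    and markov_process: "\<And>\<nu>. markov_process (bd_generator a b) \<nu> (M \<nu>) (X \<nu>)"
begin

lemma ex_bd_path: "\<exists>Y S. bd_path a b (M \<nu>) \<nu> Y S (X \<nu>)"
proof -
  obtain Y S where YS: "jump_hold (bd_generator a b) \<nu> (M \<nu>) Y S"
    "AE \<omega> in M \<nu>. \<forall>n t. jump_time S n \<omega> \<le> t \<and> t < jump_time S (Suc n) \<omega> \<longrightarrow> X \<nu> t \<omega> = Y n \<omega>"
    using markov_process[of \<nu>] unfolding markov_process_def by blast
  interpret prob_space "M \<nu>" using markov_process[of \<nu>] unfolding markov_process_def by blast
  have "bd_path a b (M \<nu>) \<nu> Y S (X \<nu>)"
    using markov_process[of \<nu>] nonexplosive YS
    by unfold_locales (auto simp: markov_process_def)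
  then show ?thesis by blast
qed

lemma prob_space_M: "prob_space (M \<nu>)"
  using markov_process[of \<nu>] unfolding markov_process_def by blast

lemma X_measurable: "0 \<le> t \<Longrightarrow> X \<nu> t \<in> measurable (M \<nu>) (count_space UNIV)"
  using markov_process[of \<nu>] unfolding markov_process_def by blast

lemma X_continuous: "\<omega> \<in> space (M \<nu>) \<Longrightarrow> 0 \<le> t \<Longrightarrow> continuous (at_right t) (\<lambda>s. X \<nu> s \<omega>)"
  using markov_process[of \<nu>] unfolding markov_process_def by blast

section \<open>Filtration and Markov property of the family\<close>

abbreviation \<F> :: "int pmf \<Rightarrow> ennreal \<Rightarrow> 'a measure" where
  "\<F> \<nu> t \<equiv> natural_filtration (M \<nu>) (X \<nu>) t"

lemma sets_filtration: "sets (\<F> \<nu> t) = sigma_sets (space (M \<nu>)) {X \<nu> s -` A \<inter> space (M \<nu>) | s A. 0 \<le> s \<and> ennreal s \<le> t}"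
  unfolding natural_filtration_def by (subst sets_measure_of) auto

lemma space_filtration [simp]: "space (\<F> \<nu> t) = space (M \<nu>)"
  unfolding natural_filtration_def by (subst space_measure_of) auto

lemma filtration_subset: "sets (\<F> \<nu> t) \<subseteq> sets (M \<nu>)"
  unfolding sets_filtration
  by (rule sets.sigma_sets_subset) (auto intro: measurable_sets[OF X_measurable])

lemma filtration_mono: "t \<le> u \<Longrightarrow> sets (\<F> \<nu> t) \<subseteq> sets (\<F> \<nu> u)"
  unfolding sets_filtration by (rule sigma_sets_mono') (auto intro: order_trans)

lemma X_measurable_filtration:
  assumes "0 \<le> s" "ennreal s \<le> t" shows "X \<nu> s \<in> measurable (\<F> \<nu> t) (count_space UNIV)"
  using assms by (intro measurableI) (auto simp: sets_filtration)

lemma X_eq_in_filtration: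
  assumes "0 \<le> s" "ennreal s \<le> t" shows "{\<omega> \<in> space (M \<nu>). X \<nu> s \<omega> = x} \<in> sets (\<F> \<nu> t)"
  using measurable_sets[OF X_measurable_filtration[OF assms], of "{x}" \<nu>]
  by (simp add: vimage_def Int_def conj_commute)

lemma markov_nn_integral:
  assumes "0 \<le> s" "s \<le> t" "A \<in> sets (\<F> \<nu> (ennreal s))"
  shows "(\<integral>\<^sup>+ \<omega>. indicator (A \<inter> {\<omega> \<in> space (M \<nu>). X \<nu> s \<omega> = x}) \<omega> * f (X \<nu> t \<omega>) \<partial>M \<nu>) =
    emeasure (M \<nu>) (A \<inter> {\<omega> \<in> space (M \<nu>). X \<nu> s \<omega> = x}) * transition f x (t - s)"
proof -
  obtain Y S where "bd_path a b (M \<nu>) \<nu> Y S (X \<nu>)" using ex_bd_path by blast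
  then interpret bd_path a b "M \<nu>" \<nu> Y S "X \<nu>" .
  show ?thesis by (rule markov_natural_filtration) fact+
qed

lemma emeasure_initial: "emeasure (M \<nu>) {\<omega> \<in> space (M \<nu>). X \<nu> 0 \<omega> = x} = ennreal (pmf \<nu> x)"
proof -
  obtain Y S where "bd_path a b (M \<nu>) \<nu> Y S (X \<nu>)" using ex_bd_path by blast
  then interpret bd_path a b "M \<nu>" \<nu> Y S "X \<nu>" .
  show ?thesis by (rule emeasure_X_0)
qed

lemma markov:
  assumes st: "0 \<le> s" "s \<le> t" and A: "A \<in> sets (\<F> \<nu> (ennreal s))"
  shows "emeasure (M \<nu>) (A \<inter> {\<omega> \<in> space (M \<nu>). X \<nu> s \<omega> = x \<and> X \<nu> t \<omega> = y}) =
    transition (indicator {y}) x (t - s) * emeasure (M \<nu>) (A \<inter> {\<omega> \<in> space (M \<nu>). X \<nu> s \<omega> = x})"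
proof -
  have [measurable]: "A \<in> sets (M \<nu>)" "X \<nu> s \<in> measurable (M \<nu>) (count_space UNIV)" "X \<nu> t \<in> measurable (M \<nu>) (count_space UNIV)"
    using A filtration_subset st by (auto intro: X_measurable)
  have "emeasure (M \<nu>) (A \<inter> {\<omega> \<in> space (M \<nu>). X \<nu> s \<omega> = x \<and> X \<nu> t \<omega> = y}) =
      (\<integral>\<^sup>+ \<omega>. indicator (A \<inter> {\<omega> \<in> space (M \<nu>). X \<nu> s \<omega> = x \<and> X \<nu> t \<omega> = y}) \<omega> \<partial>M \<nu>)" by simp
  also have "\<dots> = (\<integral>\<^sup>+ \<omega>. indicator (A \<inter> {\<omega> \<in> space (M \<nu>). X \<nu> s \<omega> = x}) \<omega> * indicator {y} (X \<nu> t \<omega>) \<partial>M \<nu>)"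
    by (intro nn_integral_cong) (auto split: split_indicator)
  also have "\<dots> = emeasure (M \<nu>) (A \<inter> {\<omega> \<in> space (M \<nu>). X \<nu> s \<omega> = x}) * transition (indicator {y}) x (t - s)"
    by (rule markov_nn_integral[OF st A])
  finally show ?thesis by (simp add: mult.commute)
qed

lemma X_law:
  assumes t: "0 \<le> t"
  shows "emeasure (M (return_pmf x)) {\<omega> \<in> space (M (return_pmf x)). X (return_pmf x) t \<omega> = y} = transition (indicator {y}) x t"
    and "AE \<omega> in M (return_pmf x). X (return_pmf x) 0 \<omega> = x"
proof -
  let ?\<nu> = "return_pmf x"
  interpret prob_space "M ?\<nu>" by (rule prob_space_M)
  have [measurable]: "X ?\<nu> t \<in> measurable (M ?\<nu>) (count_space UNIV)" "X ?\<nu> 0 \<in> measurable (M ?\<nu>) (count_space UNIV)"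
    using t by (auto intro: X_measurable)
  have "prob {\<omega> \<in> space (M ?\<nu>). X ?\<nu> 0 \<omega> = x} = 1" using emeasure_initial[of ?\<nu> x] by (simp add: measure_def)
  then show ae: "AE \<omega> in M ?\<nu>. X ?\<nu> 0 \<omega> = x" by (subst (asm) prob_Collect_eq_1) auto
  have "emeasure (M ?\<nu>) {\<omega> \<in> space (M ?\<nu>). X ?\<nu> t \<omega> = y} =
      emeasure (M ?\<nu>) (space (M ?\<nu>) \<inter> {\<omega> \<in> space (M ?\<nu>). X ?\<nu> 0 \<omega> = x \<and> X ?\<nu> t \<omega> = y})"
    by (rule emeasure_eq_AE) (use ae in \<open>auto elim!: eventually_mono\<close>)
  also have "\<dots> = transition (indicator {y}) x (t - 0) * emeasure (M ?\<nu>) (space (M ?\<nu>) \<inter> {\<omega> \<in> space (M ?\<nu>). X ?\<nu> 0 \<omega> = x})"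
    using t sets.top[of "\<F> ?\<nu> (ennreal 0)"] by (intro markov) auto
  also have "space (M ?\<nu>) \<inter> {\<omega> \<in> space (M ?\<nu>). X ?\<nu> 0 \<omega> = x} = {\<omega> \<in> space (M ?\<nu>). X ?\<nu> 0 \<omega> = x}" by auto
  finally show "emeasure (M ?\<nu>) {\<omega> \<in> space (M ?\<nu>). X ?\<nu> t \<omega> = y} = transition (indicator {y}) x t"
    using emeasure_initial[of ?\<nu> x] by simp
qed

text \<open>This reflects nonexplosion: in the process started in \<open>x\<close>, almost surely
  finitely many jumps occur by time \<open>t\<close>, so the kernels for all jump numbers together
  carry the full mass.\<close>

lemma transition_one:
  assumes t: "0 \<le> t" shows "transition (\<lambda>_. 1) x t = 1"
proof -
  let ?\<nu> = "return_pmf x"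
  have 1: "space (M ?\<nu>) \<inter> {\<omega> \<in> space (M ?\<nu>). X ?\<nu> 0 \<omega> = x} = {\<omega> \<in> space (M ?\<nu>). X ?\<nu> 0 \<omega> = x}" by auto
  have [measurable]: "X ?\<nu> 0 \<in> measurable (M ?\<nu>) (count_space UNIV)" by (auto intro: X_measurable)
  show ?thesis
    using markov_nn_integral[of 0 t "space (M ?\<nu>)" ?\<nu> x "\<lambda>_. 1"] t sets.top[of "\<F> ?\<nu> (ennreal 0)"]
      emeasure_initial[of ?\<nu> x]
    unfolding 1 by simp
qed

lemma transition_le_1: "0 \<le> t \<Longrightarrow> transition (indicator {y}) x t \<le> 1"
  using transition_mono[of "indicator {y}" "\<lambda>_. 1" x t] transition_one by (simp add: indicator_def)

lemma transition_total:
  assumes t: "0 \<le> t" shows "(\<integral>\<^sup>+ y. transition (indicator {y}) x t \<partial>count_space UNIV) = 1"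
proof -
  let ?\<nu> = "return_pmf x"
  interpret prob_space "M ?\<nu>" by (rule prob_space_M)
  have "emeasure (M ?\<nu>) (space (M ?\<nu>)) =
     (\<integral>\<^sup>+ y. emeasure (M ?\<nu>) (space (M ?\<nu>) \<inter> {\<omega> \<in> space (M ?\<nu>). X ?\<nu> t \<omega> = y}) \<partial>count_space UNIV)"
    by (intro emeasure_split_countable X_measurable t) simp
  also have "\<dots> = (\<integral>\<^sup>+ y. emeasure (M ?\<nu>) {\<omega> \<in> space (M ?\<nu>). X ?\<nu> t \<omega> = y} \<partial>count_space UNIV)"
    by (intro nn_integral_cong arg_cong2[where f=emeasure]) auto
  finally show ?thesis using t by (simp add: X_law emeasure_space_1)
qed

text \<open>A single intermediate state \<open>z\<close> is kept, which is enough for lower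
  bounds.\<close>

lemma transition_Chapman_Kolmogorov:
  assumes "0 \<le> s" "0 \<le> t"
  shows "transition (indicator {z}) x s * transition (indicator {y}) z t \<le> transition (indicator {y}) x (s + t)"
proof -
  let ?\<nu> = "return_pmf x"
  have m: "X ?\<nu> (s + t) \<in> measurable (M ?\<nu>) (count_space UNIV)" using assms by (auto intro: X_measurable)
  have 1: "space (M ?\<nu>) \<inter> {\<omega> \<in> space (M ?\<nu>). X ?\<nu> s \<omega> = z} = {\<omega> \<in> space (M ?\<nu>). X ?\<nu> s \<omega> = z}" by auto
  have "transition (indicator {y}) z t * transition (indicator {z}) x s =
    emeasure (M ?\<nu>) (space (M ?\<nu>) \<inter> {\<omega> \<in> space (M ?\<nu>). X ?\<nu> s \<omega> = z \<and> X ?\<nu> (s + t) \<omega> = y})"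
    using markov[of s "s + t" "space (M ?\<nu>)" ?\<nu> z y] assms sets.top[of "\<F> ?\<nu> (ennreal s)"] X_law(1)[of s x z]
    unfolding 1 by simp
  also have "\<dots> \<le> emeasure (M ?\<nu>) {\<omega> \<in> space (M ?\<nu>). X ?\<nu> (s + t) \<omega> = y}"
    using m by (intro emeasure_mono) auto
  also have "\<dots> = transition (indicator {y}) x (s + t)" using assms by (intro X_law) simp
  finally show ?thesis by (simp add: mult.commute)
qed

lemma resolvent_one:
  assumes l: "0 < l" shows "resolvent l (\<lambda>_. 1) x = ennreal (1 / l)"
proof -
  have "resolvent l (\<lambda>_. 1) x = (\<integral>\<^sup>+ t. (if 0 \<le> t then ennreal (exp (- l * t)) else 0) \<partial>lborel)"
    unfolding laplace_transition[OF l, symmetric] by (intro nn_integral_cong) (simp add: transition_one)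
  then show ?thesis using nn_integral_exp_half_line[OF l] by simp
qed

lemma resolvent_total:
  assumes l: "0 < l" shows "(\<integral>\<^sup>+ y. resolvent l (indicator {y}) x \<partial>count_space UNIV) = ennreal (1 / l)"
proof -
  have "(\<integral>\<^sup>+ y. resolvent l (indicator {y}) x \<partial>count_space UNIV) =
    (\<integral>\<^sup>+ t. \<integral>\<^sup>+ y. (if 0 \<le> t then ennreal (exp (- l * t)) * transition (indicator {y}) x t else 0) \<partial>count_space UNIV \<partial>lborel)"
    unfolding laplace_transition[OF l, symmetric]
    by (rule nn_integral_count_space_nn_integral[symmetric]) auto
  also have "\<dots> = (\<integral>\<^sup>+ t. (if 0 \<le> t then ennreal (exp (- l * t)) else 0) \<partial>lborel)"
    by (intro nn_integral_cong) (simp add: nn_integral_cmult transition_total)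
  finally show ?thesis using nn_integral_exp_half_line[OF l] by simp
qed

lemma resolvent_le:
  assumes l: "0 < l" shows "resolvent l (indicator {y}) x \<le> ennreal (1 / l)"
  unfolding resolvent_total[OF l, of x, symmetric]
  by (rule nn_integral_ge_point) simp

text \<open>Waiting in \<open>y\<close> for the remaining time \<open>t - s\<close> has probability
  at least \<open>exp (- rate y * t)\<close>, uniformly in \<open>s\<close>. This converts a bound
  on an average over times up to \<open>t\<close> into one at \<open>t\<close> itself.\<close>

lemma transition_stay_end:
  assumes "0 \<le> s" "s \<le> t"
  shows "ennreal (exp (- rate y * t)) * transition (indicator {y}) x s \<le> transition (indicator {y}) x t"
proof -
  have "ennreal (exp (- rate y * t)) \<le> ennreal (exp (- rate y * (t - s)))"
    using assms rate_pos[of y] by (intro ennreal_leI) (simp add: algebra_simps)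
  also have "\<dots> \<le> transition (indicator {y}) y (t - s)" by (rule transition_stay)
  finally have "ennreal (exp (- rate y * t)) * transition (indicator {y}) x s \<le>
      transition (indicator {y}) x s * transition (indicator {y}) y (t - s)"
    by (subst mult.commute, intro mult_left_mono) auto
  also have "\<dots> \<le> transition (indicator {y}) x (s + (t - s))"
    using assms by (intro transition_Chapman_Kolmogorov) auto
  finally show ?thesis by simp
qed

lemma transition_stay_start:
  assumes "0 \<le> s" "s \<le> t"
  shows "ennreal (exp (- rate x * t)) * transition (indicator {y}) x s \<le> transition (indicator {y}) x t"
proof -
  have "ennreal (exp (- rate x * t)) \<le> ennreal (exp (- rate x * (t - s)))"
    using assms rate_pos[of x] by (intro ennreal_leI) (simp add: algebra_simps)
  also have "\<dots> \<le> transition (indicator {x}) x (t - s)" by (rule transition_stay)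
  finally have "ennreal (exp (- rate x * t)) * transition (indicator {y}) x s \<le>
      transition (indicator {x}) x (t - s) * transition (indicator {y}) x s"
    by (intro mult_right_mono) auto
  also have "\<dots> \<le> transition (indicator {y}) x ((t - s) + s)"
    using assms by (intro transition_Chapman_Kolmogorov) auto
  finally show ?thesis by simp
qed

text \<open>A lower bound on the resolvent passes to a single time, as the contribution of times
  after \<open>t\<close> is controlled by the resolvent at \<open>l / 2\<close>.\<close>

lemma transition_lower_bound:
  assumes l: "0 < l" and t: "0 < t"
    and up: "resolvent (l / 2) (indicator {y}) x \<le> ennreal (2 / l * k)" "0 \<le> k"
    and low: "ennreal (\<eta> * k) \<le> resolvent l (indicator {y}) x"
    and stay: "\<And>s. 0 \<le> s \<Longrightarrow> s \<le> t \<Longrightarrow>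
      ennreal (exp (- r * t)) * transition (indicator {y}) x s \<le> transition (indicator {y}) x t"
    and tail: "exp (- (l / 2) * t) * (2 / l) \<le> \<eta> / 2" and \<eta>: "0 \<le> \<eta>"
  shows "ennreal (exp (- r * t) * (\<eta> / 2) / t * k) \<le> transition (indicator {y}) x t"
proof -
  \<comment> \<open>\<open>k\<close> is a scale, 1 or \<open>\<mu> y / \<mu> 0\<close> in the
    applications, and \<open>r\<close> is the rate of the state in which the path waits; keeping
    both abstract lets the passages to 0 and from 0 share one estimate.\<close>
  let ?p = "transition (indicator {y}) x"
  let ?e = "\<lambda>s. ennreal (exp (- l * s))"
  have "resolvent l (indicator {y}) x = (\<integral>\<^sup>+ s. (if 0 \<le> s then ?e s * ?p s else 0) \<partial>lborel)"
    by (rule laplace_transition[OF l, symmetric])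
  also have "\<dots> \<le> (\<integral>\<^sup>+ s. (if 0 \<le> s \<and> s \<le> t then ?e s * ?p s else 0) +
      ennreal (exp (- (l / 2) * t)) * (if 0 \<le> s then ennreal (exp (- (l / 2) * s)) * ?p s else 0) \<partial>lborel)"
  proof (intro nn_integral_mono)
    fix s :: real
    \<comment> \<open>For \<open>s > t\<close>, half of the discount pays for the late time and the
      other half remains as the discount of the resolvent at \<open>l / 2\<close>.\<close>
    have "?e s \<le> ennreal (exp (- (l / 2) * t)) * ennreal (exp (- (l / 2) * s))" if "t < s"
    proof -
      have "- l * s \<le> - (l / 2) * t + - (l / 2) * s" using that l by (simp add: field_simps)
      then have "exp (- l * s) \<le> exp (- (l / 2) * t) * exp (- (l / 2) * s)"
        unfolding exp_add[symmetric] exp_le_cancel_iff .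
      then show ?thesis by (simp add: ennreal_mult[symmetric] ennreal_leI)
    qed
    then show "(if 0 \<le> s then ?e s * ?p s else 0) \<le> (if 0 \<le> s \<and> s \<le> t then ?e s * ?p s else 0) +
      ennreal (exp (- (l / 2) * t)) * (if 0 \<le> s then ennreal (exp (- (l / 2) * s)) * ?p s else 0)"
      by (auto simp: mult.assoc[symmetric] intro: mult_right_mono)
  qed
  also have "\<dots> = (\<integral>\<^sup>+ s. (if 0 \<le> s \<and> s \<le> t then ?e s * ?p s else 0) \<partial>lborel) +
      ennreal (exp (- (l / 2) * t)) * resolvent (l / 2) (indicator {y}) x"
    using l by (subst nn_integral_add, measurable) (simp add: nn_integral_cmult laplace_transition[of "l / 2"])
  also have "ennreal (exp (- (l / 2) * t)) * resolvent (l / 2) (indicator {y}) x \<le> ennreal (\<eta> / 2 * k)"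
  proof -
    have "ennreal (exp (- (l / 2) * t)) * resolvent (l / 2) (indicator {y}) x \<le> ennreal (exp (- (l / 2) * t)) * ennreal (2 / l * k)"
      by (intro mult_left_mono up) simp
    also have "\<dots> = ennreal ((exp (- (l / 2) * t) * (2 / l)) * k)"
      using up l by (simp add: ennreal_mult[symmetric] mult.assoc)
    also have "\<dots> \<le> ennreal (\<eta> / 2 * k)" using tail up by (intro ennreal_leI mult_right_mono) auto
    finally show ?thesis .
  qed
  finally have "ennreal (\<eta> * k) \<le> (\<integral>\<^sup>+ s. (if 0 \<le> s \<and> s \<le> t then ?e s * ?p s else 0) \<partial>lborel) + ennreal (\<eta> / 2 * k)"
    using low by (meson add_left_mono order_trans)
  \<comment> \<open>The late times use up half of the lower bound; the other half is left for times
    up to \<open>t\<close>.\<close>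
  moreover have "ennreal (\<eta> * k) = ennreal (\<eta> / 2 * k) + ennreal (\<eta> / 2 * k)"
    using \<eta> up(2) by (simp add: ennreal_plus[symmetric] field_simps del: ennreal_plus)
  ultimately have "ennreal (\<eta> / 2 * k) \<le> (\<integral>\<^sup>+ s. (if 0 \<le> s \<and> s \<le> t then ?e s * ?p s else 0) \<partial>lborel)"
    by (simp add: ennreal_add_left_cancel_le add.commute)
  also have "\<dots> \<le> (\<integral>\<^sup>+ s. ennreal (exp (r * t)) * ?p t * indicator {0..t} s \<partial>lborel)"
  proof (intro nn_integral_mono)
    fix s :: real
    have "?e s * ?p s \<le> ennreal (exp (r * t)) * ?p t" if s: "0 \<le> s" "s \<le> t"
    proof -
      have "?e s * ?p s \<le> 1 * ?p s" using l s by (intro mult_right_mono) (auto simp: ennreal_le_1)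
      also have "\<dots> = ennreal (exp (r * t)) * (ennreal (exp (- r * t)) * ?p s)"
        by (simp add: mult.assoc[symmetric] ennreal_mult[symmetric] exp_add[symmetric])
      also have "\<dots> \<le> ennreal (exp (r * t)) * ?p t"
        using s stay by (intro mult_left_mono) auto
      finally show ?thesis by simp
    qed
    then show "(if 0 \<le> s \<and> s \<le> t then ?e s * ?p s else 0) \<le> ennreal (exp (r * t)) * ?p t * indicator {0..t} s"
      by (auto split: split_indicator)
  qed
  also have "\<dots> = ennreal (exp (r * t)) * ?p t * ennreal t"
    using t by (simp add: nn_integral_cmult_indicator)
  finally have *: "ennreal (\<eta> / 2 * k) \<le> ennreal (exp (r * t) * t) * ?p t"
    using t by (simp add: ennreal_mult mult_ac)
  have "ennreal (exp (- r * t) * (\<eta> / 2) / t * k) = ennreal (exp (- r * t) / t) * ennreal (\<eta> / 2 * k)"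
    using t \<eta> up(2) by (simp add: ennreal_mult[symmetric])
  also have "\<dots> \<le> ennreal (exp (- r * t) / t) * (ennreal (exp (r * t) * t) * ?p t)"
    by (intro mult_left_mono *) simp
  also have "\<dots> = ?p t"
    using t by (simp add: mult.assoc[symmetric] ennreal_mult[symmetric] exp_minus)
  finally show ?thesis .
qed

end

section \<open>Uniform minorisation and entrance boundaries\<close>

context bd_family
begin

text \<open>The bounded \<open>h\<close> gives a lower bound on the resolvent at 0 that is uniform
  in the start, and reversibility gives one for the opposite passage. The path from \<open>x\<close>
  to \<open>y\<close> is led through 0, where the cost of waiting is the same for all
  \<open>x\<close> and \<open>y\<close>.\<close>

lemma uniform_minorisation:
  fixes \<mu> h :: "int \<Rightarrow> real"
  assumes balance: "\<And>n. \<mu> n * b n = \<mu> (n + 1) * a (n + 1)" and \<mu>_pos: "\<And>n. 0 < \<mu> n"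
    and h: "\<And>n. 0 \<le> h n" "\<And>n. h n \<le> H" and c: "0 < c"
    and drift: "\<And>n. b n * h (n + 1) + a n * h (n - 1) + 1 \<le> (a n + b n) * h n + c * indicator {0} n"
  shows "\<exists>t>0. \<exists>\<epsilon>>0. \<forall>x y. ennreal (\<epsilon> * \<mu> y) \<le> transition (indicator {y}) x t"
proof -
  have H: "0 \<le> H" using h[of 0] by linarith
  \<comment> \<open>The total mass \<open>1 / l = H + 1\<close> of the resolvent exceeds the bound
    \<open>H\<close> on \<open>h\<close> by exactly 1, and this surplus has to come from visits to
    0.\<close>
  define l where "l = 1 / (H + 1)"
  have l: "0 < l" using H by (simp add: l_def)
  define \<eta> where "\<eta> = 1 / c"
  have \<eta>: "0 < \<eta>" using c by (simp add: \<eta>_def)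
  have low: "ennreal \<eta> \<le> resolvent l (indicator {0}) x" for x
  proof -
    have "ennreal (1 + H) = resolvent l (\<lambda>_. 1) x" unfolding resolvent_one[OF l] by (simp add: l_def add.commute)
    also have "\<dots> \<le> ennreal (h x) + ennreal c * resolvent l (indicator {0}) x"
      by (rule resolvent_Lyapunov[OF l h(1)]) (use c drift in \<open>auto simp: rate_def\<close>)
    also have "\<dots> \<le> ennreal H + ennreal c * resolvent l (indicator {0}) x"
      by (intro add_right_mono ennreal_leI h)
    finally have "ennreal 1 \<le> ennreal c * resolvent l (indicator {0}) x"
      using H by (simp add: add.commute[of "ennreal H"] ennreal_add_left_cancel_le)
    then have "ennreal (1 / c) * ennreal 1 \<le> ennreal (1 / c) * (ennreal c * resolvent l (indicator {0}) x)"
      by (intro mult_left_mono) auto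
    also have "\<dots> = resolvent l (indicator {0}) x"
      using c by (simp add: mult.assoc[symmetric] ennreal_mult[symmetric])
    finally show ?thesis by (simp add: \<eta>_def)
  qed
  \<comment> \<open>Time reversal: the passage from 0 to \<open>y\<close> is the one from
    \<open>y\<close> to 0 weighted by \<open>\<mu> y / \<mu> 0\<close>, which becomes the scale
    \<open>k\<close> of \<open>transition_lower_bound\<close>.\<close>
  have sym: "resolvent r (indicator {y}) 0 = ennreal (\<mu> y / \<mu> 0) * resolvent r (indicator {0}) y" for r y
  proof -
    have "ennreal (\<mu> 0) * resolvent r (indicator {y}) 0 = ennreal (\<mu> y) * resolvent r (indicator {0}) y"
      using balance \<mu>_pos by (intro resolvent_symmetric) (auto simp: less_imp_le)
    then have "ennreal (1 / \<mu> 0) * (ennreal (\<mu> 0) * resolvent r (indicator {y}) 0) =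
        ennreal (1 / \<mu> 0) * (ennreal (\<mu> y) * resolvent r (indicator {0}) y)" by simp
    then show ?thesis
      using \<mu>_pos[of 0] \<mu>_pos[of y] by (simp add: mult.assoc[symmetric] ennreal_mult[symmetric])
  qed
  have up: "resolvent (l / 2) (indicator {0}) x \<le> ennreal (2 / l)" for x
    using resolvent_le[of "l / 2" 0 x] l by simp
  have "((\<lambda>t. exp (- (l / 2) * t) * (2 / l)) \<longlongrightarrow> 0) at_top"
  proof -
    have "filterlim (\<lambda>t. - (l / 2) * t) at_bot at_top"
      using l by (intro filterlim_tendsto_neg_mult_at_bot[OF tendsto_const]) (auto simp: filterlim_ident)
    then show ?thesis by (intro tendsto_mult_left_zero filterlim_compose[OF exp_at_bot])
  qed
  then have "\<forall>\<^sub>F t in at_top. exp (- (l / 2) * t) * (2 / l) < \<eta> / 2"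
    using \<eta> by (intro order_tendstoD) auto
  then have "\<forall>\<^sub>F t in at_top. exp (- (l / 2) * t) * (2 / l) < \<eta> / 2 \<and> 0 < t"
    using eventually_gt_at_top by (rule eventually_conj)
  \<comment> \<open>One \<open>t\<close> serves all states, since the upper and the lower bound on
    the resolvent at 0 do not depend on the start.\<close>
  then obtain t where t: "exp (- (l / 2) * t) * (2 / l) < \<eta> / 2" "0 < t"
    by (metis (mono_tags, lifting) eventually_at_top_linorder order_refl)
  define \<delta> where "\<delta> = exp (- rate 0 * t) * (\<eta> / 2) / t"
  have \<delta>: "0 < \<delta>" using \<eta> t by (simp add: \<delta>_def)
  have to0: "ennreal \<delta> \<le> transition (indicator {0}) x t" for x
  proof -
    have "ennreal (exp (- rate 0 * t) * (\<eta> / 2) / t * 1) \<le> transition (indicator {0}) x t"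
    proof (rule transition_lower_bound[OF l t(2)])
      show "ennreal (exp (- rate 0 * t)) * transition (indicator {0}) x s \<le> transition (indicator {0}) x t"
        if "0 \<le> s" "s \<le> t" for s using that by (rule transition_stay_end)
    qed (use up low t \<eta> in auto)
    then show ?thesis by (simp add: \<delta>_def)
  qed
  have from0: "ennreal (\<delta> * (\<mu> y / \<mu> 0)) \<le> transition (indicator {y}) 0 t" for y
  proof -
    have k: "0 \<le> \<mu> y / \<mu> 0" using \<mu>_pos[of 0] \<mu>_pos[of y] by simp
    have u: "resolvent (l / 2) (indicator {y}) 0 \<le> ennreal (2 / l * (\<mu> y / \<mu> 0))"
    proof -
      have "resolvent (l / 2) (indicator {y}) 0 \<le> ennreal (\<mu> y / \<mu> 0) * ennreal (2 / l)"
        unfolding sym by (intro mult_left_mono up) simp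
      also have "\<dots> = ennreal (2 / l * (\<mu> y / \<mu> 0))"
        using k l by (subst mult.commute[of "2 / l"], intro ennreal_mult[symmetric]) auto
      finally show ?thesis .
    qed
    have lo: "ennreal (\<eta> * (\<mu> y / \<mu> 0)) \<le> resolvent l (indicator {y}) 0"
    proof -
      have "ennreal (\<eta> * (\<mu> y / \<mu> 0)) = ennreal (\<mu> y / \<mu> 0) * ennreal \<eta>"
        using k \<eta> by (simp add: ennreal_mult[symmetric] mult.commute)
      also have "\<dots> \<le> resolvent l (indicator {y}) 0" unfolding sym by (intro mult_left_mono low) simp
      finally show ?thesis .
    qed
    show ?thesis
      unfolding \<delta>_def
    proof (rule transition_lower_bound[OF l t(2) u k lo])
      show "ennreal (exp (- rate 0 * t)) * transition (indicator {y}) 0 s \<le> transition (indicator {y}) 0 t"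
        if "0 \<le> s" "s \<le> t" for s using that by (rule transition_stay_start)
    qed (use t \<eta> in auto)
  qed
  \<comment> \<open>Each of the two passages takes time \<open>t\<close>, so the final time is
    \<open>t + t\<close> and the constant \<open>\<delta> * \<delta> / \<mu> 0\<close>.\<close>
  have "ennreal (\<delta> * \<delta> / \<mu> 0 * \<mu> y) \<le> transition (indicator {y}) x (t + t)" for x y
  proof -
    have "ennreal (\<delta> * \<delta> / \<mu> 0 * \<mu> y) = ennreal \<delta> * ennreal (\<delta> * (\<mu> y / \<mu> 0))"
      using \<delta> \<mu>_pos[of 0] \<mu>_pos[of y] by (simp add: ennreal_mult[symmetric])
    also have "\<dots> \<le> transition (indicator {0}) x t * transition (indicator {y}) 0 t"
      by (intro mult_mono to0 from0) auto
    also have "\<dots> \<le> transition (indicator {y}) x (t + t)"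
      using t by (intro transition_Chapman_Kolmogorov) auto
    finally show ?thesis .
  qed
  moreover have "0 < t + t" "0 < \<delta> * \<delta> / \<mu> 0" using t \<delta> \<mu>_pos[of 0] by auto
  ultimately show ?thesis by blast
qed

text \<open>Off 0 the function r = R(., 0) at discount 1 satisfies L r = r, and r lies between
  \<open>\<eta>\<close> and 1. Hence \<open>- r / \<eta>\<close> is bounded with drift at most
  \<open>- 1\<close> there, as \<open>entrance_of_supersolution\<close> requires on each
  half-line.\<close>

lemma entrance_of_resolvent_bound:
  fixes \<mu> :: "int \<Rightarrow> real"
  assumes bal: "bd_balance a b \<mu>" and K: "\<And>n. \<mu> n * b n \<le> K"
    and \<eta>: "0 < \<eta>" "\<And>x. ennreal \<eta> \<le> resolvent 1 (indicator {0}) x"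
  shows "(\<lambda>i::int. \<mu> (i + 1) * (\<Sum>j=1..i. 1 / (\<mu> j * b j))) summable_on {1..}"
    "(\<lambda>i::int. \<mu> (- i - 1) * (\<Sum>j=1..i. 1 / (\<mu> (- j) * a (- j)))) summable_on {1..}"
proof -
  interpret bal: bd_balance a b \<mu> by fact
  define r where "r x = enn2real (resolvent 1 (indicator {0}) x)" for x
  have fin: "resolvent 1 (indicator {0}) x \<le> 1" for x using resolvent_le[of 1 0 x] by simp
  then have r: "resolvent 1 (indicator {0}) x = ennreal (r x)" for x
    unfolding r_def by (intro ennreal_enn2real[symmetric]) (auto simp: order_le_less_trans[OF _ ennreal_one_less_top])
  have r0: "0 \<le> r x" for x by (simp add: r_def)
  have r1: "r x \<le> 1" for x using fin[of x] r0[of x] unfolding r by (simp add: ennreal_le_1)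
  have r\<eta>: "\<eta> \<le> r x" for x using \<eta>(2)[of x] r0[of x] unfolding r by (simp add: ennreal_le_iff)
  have eq: "(1 + rate x) * r x = b x * r (x + 1) + a x * r (x - 1)" if "x \<noteq> 0" for x
  proof -
    have pos: "0 \<le> b x * r (x + 1)" "0 \<le> a x * r (x - 1)" using r0 a_pos[of x] b_pos[of x] by auto
    have "ennreal (r x) = ennreal (1 / (1 + rate x)) * (ennreal (b x) * ennreal (r (x + 1)) + ennreal (a x) * ennreal (r (x - 1)))"
      using resolvent_eq[of 1 "indicator {0}" x] that unfolding r by simp
    also have "\<dots> = ennreal ((b x * r (x + 1) + a x * r (x - 1)) / (1 + rate x))"
      using pos r0 a_pos[of x] b_pos[of x] rate_pos[of x]
      by (simp add: ennreal_mult[symmetric] ennreal_plus[symmetric] less_imp_le del: ennreal_plus)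
    finally have "r x = (b x * r (x + 1) + a x * r (x - 1)) / (1 + rate x)"
      using pos r0 rate_pos[of x] by (subst (asm) ennreal_inj) auto
    then show ?thesis using rate_pos[of x] by (simp add: field_simps)
  qed
  define w where "w x = - r x / \<eta>" for x
  have w_bound: "\<bar>w x\<bar> \<le> 1 / \<eta>" for x
    using r0[of x] r1[of x] \<eta>(1) by (simp add: w_def abs_divide divide_right_mono)
  have w_drift: "b x * (w (x + 1) - w x) + a x * (w (x - 1) - w x) \<le> - 1" if "x \<noteq> 0" for x
  proof -
    have "b x * (w (x + 1) - w x) + a x * (w (x - 1) - w x) = (rate x * r x - (b x * r (x + 1) + a x * r (x - 1))) / \<eta>"
      using \<eta>(1) by (simp add: w_def rate_def field_simps)
    also have "\<dots> = - r x / \<eta>" unfolding eq[OF that, symmetric] by (simp add: algebra_simps)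
    also have "\<dots> \<le> - 1" using r\<eta>[of x] \<eta>(1) by (simp add: field_simps)
    finally show ?thesis .
  qed
  show "(\<lambda>i::int. \<mu> (i + 1) * (\<Sum>j=1..i. 1 / (\<mu> j * b j))) summable_on {1..}"
    by (rule bal.entrance_of_supersolution[of K w "1 / \<eta>"]) (use K w_bound w_drift in auto)
  interpret mirror: bd_balance "\<lambda>n. b (- n)" "\<lambda>n. a (- n)" "\<lambda>n. \<mu> (- n)" by (rule bal.mirror)
  have "(\<lambda>i::int. \<mu> (- (i + 1)) * (\<Sum>j=1..i. 1 / (\<mu> (- j) * a (- j)))) summable_on {1..}"
  proof (rule mirror.entrance_of_supersolution[of K "\<lambda>n. w (- n)" "1 / \<eta>"])
    \<comment> \<open>The reflected flux through an edge is the original flux through that edge,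
      read from its other end.\<close>
    show "\<mu> (- n) * a (- n) \<le> K" for n using K[of "- n - 1"] bal.balance[of "- n - 1"] by simp
    show "a (- n) * (w (- (n + 1)) - w (- n)) + b (- n) * (w (- (n - 1)) - w (- n)) \<le> - 1" if "1 \<le> n" for n
    proof -
      have eq: "- (n + 1) = - n - 1" "- (n - 1) = - n + 1" by auto
      show ?thesis
        unfolding eq add.commute[of "a _ * _"] by (rule w_drift) (use that in simp)
    qed
  qed (rule w_bound)
  then show "(\<lambda>i::int. \<mu> (- i - 1) * (\<Sum>j=1..i. 1 / (\<mu> (- j) * a (- j)))) summable_on {1..}"
    by (simp add: algebra_simps)
qed

end

section \<open>The Markov property with independent randomness\<close>

context bd_family
begin

definition enlarged :: "int pmf \<Rightarrow> 'a measure \<Rightarrow> ennreal \<Rightarrow> 'a measure" where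
  "enlarged \<nu> G t = sigma (space (M \<nu>)) (sets (\<F> \<nu> t) \<union> sets G)"

lemma sets_enlarged:
  assumes "subalgebra (M \<nu>) G"
  shows "sets (enlarged \<nu> G t) = sigma_sets (space (M \<nu>)) (sets (\<F> \<nu> t) \<union> sets G)"
proof -
  have "sets G \<subseteq> Pow (space (M \<nu>))" using assms sets.space_closed[of G] by (auto simp: subalgebra_def)
  moreover have "sets (\<F> \<nu> t) \<subseteq> Pow (space (M \<nu>))" using sets.space_closed[of "\<F> \<nu> t"] by simp
  ultimately show ?thesis unfolding enlarged_def by (intro sets_measure_of) auto
qed

lemma space_enlarged [simp]: "subalgebra (M \<nu>) G \<Longrightarrow> space (enlarged \<nu> G t) = space (M \<nu>)"
  unfolding enlarged_def using sets.space_closed[of G] sets.space_closed[of "\<F> \<nu> t"]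
  by (intro space_measure_of) (auto simp: subalgebra_def)

lemma enlarged_subset:
  assumes "subalgebra (M \<nu>) G" shows "sets (enlarged \<nu> G t) \<subseteq> sets (M \<nu>)"
  unfolding sets_enlarged[OF assms] using assms filtration_subset
  by (intro sets.sigma_sets_subset) (auto simp: subalgebra_def)

lemma enlarged_mono:
  assumes "subalgebra (M \<nu>) G" "t \<le> u" shows "sets (enlarged \<nu> G t) \<subseteq> sets (enlarged \<nu> G u)"
  unfolding sets_enlarged[OF assms(1)] using filtration_mono[OF assms(2), of \<nu>]
  by (intro sigma_sets_mono') auto

text \<open>Intersections of an event of the process with an event \<open>g\<close> of
  \<open>G\<close> form a generating system closed under intersection. Independence extracts the
  probability of \<open>g\<close> on both sides, which reduces the claim to
  \<open>markov\<close>.\<close>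

lemma markov_enlarged:
  assumes G: "subalgebra (M \<nu>) G" and ind: "prob_space.indep_set (M \<nu>) (sets G) (sets (\<F> \<nu> \<infinity>))"
    and st: "0 \<le> s" "s \<le> t" and A: "A \<in> sets (enlarged \<nu> G (ennreal s))"
  shows "emeasure (M \<nu>) (A \<inter> {\<omega> \<in> space (M \<nu>). X \<nu> s \<omega> = x \<and> X \<nu> t \<omega> = y}) =
    transition (indicator {y}) x (t - s) * emeasure (M \<nu>) (A \<inter> {\<omega> \<in> space (M \<nu>). X \<nu> s \<omega> = x})"
proof -
  interpret prob_space "M \<nu>" by (rule prob_space_M)
  let ?P1 = "{\<omega> \<in> space (M \<nu>). X \<nu> s \<omega> = x \<and> X \<nu> t \<omega> = y}" and ?P2 = "{\<omega> \<in> space (M \<nu>). X \<nu> s \<omega> = x}"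
  define C where "C = {B \<inter> g | B g. B \<in> sets (\<F> \<nu> (ennreal s)) \<and> g \<in> sets G}"
  have GM: "sets G \<subseteq> sets (M \<nu>)" "space G = space (M \<nu>)" using G by (auto simp: subalgebra_def)
  have sp: "space (M \<nu>) \<in> sets G" "space (M \<nu>) \<in> sets (\<F> \<nu> (ennreal s))"
    using sets.top[of G] sets.top[of "\<F> \<nu> (ennreal s)"] GM by auto
  have P: "?P1 \<in> sets (\<F> \<nu> \<infinity>)" "?P2 \<in> sets (\<F> \<nu> \<infinity>)"
  proof -
    show "?P2 \<in> sets (\<F> \<nu> \<infinity>)" using st by (intro X_eq_in_filtration) auto
    moreover have "{\<omega> \<in> space (M \<nu>). X \<nu> t \<omega> = y} \<in> sets (\<F> \<nu> \<infinity>)" using st by (intro X_eq_in_filtration) auto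
    ultimately have "?P2 \<inter> {\<omega> \<in> space (M \<nu>). X \<nu> t \<omega> = y} \<in> sets (\<F> \<nu> \<infinity>)" by (rule sets.Int)
    also have "?P2 \<inter> {\<omega> \<in> space (M \<nu>). X \<nu> t \<omega> = y} = ?P1" by auto
    finally show "?P1 \<in> sets (\<F> \<nu> \<infinity>)" .
  qed
  have F_inf: "sets (\<F> \<nu> (ennreal s)) \<subseteq> sets (\<F> \<nu> \<infinity>)" by (rule filtration_mono) simp
  have split: "emeasure (M \<nu>) (B \<inter> g \<inter> P) = emeasure (M \<nu>) g * emeasure (M \<nu>) (B \<inter> P)"
    if "B \<in> sets (\<F> \<nu> (ennreal s))" "g \<in> sets G" "P \<in> sets (\<F> \<nu> \<infinity>)" for B g P
  proof -
    have "B \<inter> P \<in> sets (\<F> \<nu> \<infinity>)" using that F_inf by auto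
    then have "prob (g \<inter> (B \<inter> P)) = prob g * prob (B \<inter> P)" using indep_setD[OF ind that(2)] by blast
    moreover have "g \<inter> (B \<inter> P) = B \<inter> g \<inter> P" by auto
    ultimately show ?thesis by (simp add: emeasure_eq_measure ennreal_mult)
  qed
  show ?thesis
  proof (rule emeasure_Int_eq_cmult_sigma_sets)
    show "Int_stable C"
    proof (rule Int_stableI)
      fix U V assume "U \<in> C" "V \<in> C"
      then obtain B g B' g' where "U = B \<inter> g" "V = B' \<inter> g'" "B \<in> sets (\<F> \<nu> (ennreal s))" "g \<in> sets G"
        "B' \<in> sets (\<F> \<nu> (ennreal s))" "g' \<in> sets G" unfolding C_def by blast
      then have "U \<inter> V = (B \<inter> B') \<inter> (g \<inter> g')" "B \<inter> B' \<in> sets (\<F> \<nu> (ennreal s))" "g \<inter> g' \<in> sets G" by auto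
      then show "U \<inter> V \<in> C" unfolding C_def by blast
    qed
    show "C \<subseteq> sets (M \<nu>)" unfolding C_def using GM filtration_subset[of \<nu>] by blast
    show "space (M \<nu>) \<in> C" unfolding C_def using sp by blast
    show "?P1 \<in> sets (M \<nu>)" "?P2 \<in> sets (M \<nu>)" using P filtration_subset by auto
    show "transition (indicator {y}) x (t - s) < \<infinity>"
      using transition_le_1[of "t - s" y x] st by (auto intro: le_less_trans[OF _ ennreal_one_less_top])
    show "emeasure (M \<nu>) (U \<inter> ?P1) = transition (indicator {y}) x (t - s) * emeasure (M \<nu>) (U \<inter> ?P2)" if "U \<in> C" for U
    proof -
      obtain B g where U: "U = B \<inter> g" "B \<in> sets (\<F> \<nu> (ennreal s))" "g \<in> sets G" using \<open>U \<in> C\<close> unfolding C_def by blast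
      show ?thesis
        using markov[OF st U(2), of x y] unfolding U(1) split[OF U(2,3) P(1)] split[OF U(2,3) P(2)] by (simp add: mult_ac)
    qed
    have "sets (\<F> \<nu> (ennreal s)) \<union> sets G \<subseteq> C"
    proof
      fix U assume U: "U \<in> sets (\<F> \<nu> (ennreal s)) \<union> sets G"
      then have "U \<subseteq> space (M \<nu>)"
        using sets.sets_into_space[of U "\<F> \<nu> (ennreal s)"] sets.sets_into_space[of U G] GM(2) by auto
      then have eq: "U = U \<inter> space (M \<nu>)" "U = space (M \<nu>) \<inter> U" by auto
      from U show "U \<in> C"
      proof
        assume "U \<in> sets (\<F> \<nu> (ennreal s))"
        then show ?thesis unfolding C_def mem_Collect_eq
          by (intro exI[of _ U] exI[of _ "space (M \<nu>)"] conjI eq(1) sp(1))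
      next
        assume "U \<in> sets G"
        then show ?thesis unfolding C_def mem_Collect_eq
          by (intro exI[of _ "space (M \<nu>)"] exI[of _ U] conjI eq(2) sp(2))
      qed
    qed
    then show "A \<in> sigma_sets (space (M \<nu>)) C"
      using A unfolding sets_enlarged[OF G] by (rule subsetD[OF sigma_sets_mono'])
  qed
qed

text \<open>Both sides are the expected discounted time spent in \<open>y\<close> after
  \<open>s\<close>, on the event \<open>A\<close>; the state at time \<open>s\<close> is summed out.
  The same decomposition into transition functions shows that the mass of \<open>A\<close> with
  \<open>X \<nu> t = y\<close> is measurable in \<open>t\<close>, which is the second claim.\<close>

lemma resolvent_enlarged:
  assumes G: "subalgebra (M \<nu>) G" and ind: "prob_space.indep_set (M \<nu>) (sets G) (sets (\<F> \<nu> \<infinity>))"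
    and s: "0 \<le> s" and A: "A \<in> sets (enlarged \<nu> G (ennreal s))" and l: "0 < l"
  shows "(\<integral>\<^sup>+ \<omega>. indicator A \<omega> * (ennreal (exp (- l * s)) * resolvent l (indicator {y}) (X \<nu> s \<omega>)) \<partial>M \<nu>) =
    (\<integral>\<^sup>+ t. (if s \<le> t then ennreal (exp (- l * t)) * emeasure (M \<nu>) (A \<inter> {\<omega> \<in> space (M \<nu>). X \<nu> t \<omega> = y}) else 0) \<partial>lborel)"
    "(\<lambda>t. if s \<le> t then ennreal (exp (- l * t)) * emeasure (M \<nu>) (A \<inter> {\<omega> \<in> space (M \<nu>). X \<nu> t \<omega> = y}) else 0)
      \<in> borel_measurable lborel"
proof -
  have [measurable]: "A \<in> sets (M \<nu>)" using A enlarged_subset[OF G] by blast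
  have [measurable]: "X \<nu> s \<in> measurable (M \<nu>) (count_space UNIV)" using s by (rule X_measurable)
  define e where "e x = emeasure (M \<nu>) (A \<inter> {\<omega> \<in> space (M \<nu>). X \<nu> s \<omega> = x})" for x
  define p where "p x t = (if s \<le> t then ennreal (exp (- l * t)) * transition (indicator {y}) x (t - s) else 0)" for x t
  have [measurable]: "p x \<in> borel_measurable borel" for x unfolding p_def[abs_def] by measurable
  have meas: "(if s \<le> t then ennreal (exp (- l * t)) * emeasure (M \<nu>) (A \<inter> {\<omega> \<in> space (M \<nu>). X \<nu> t \<omega> = y}) else 0) =
    (\<integral>\<^sup>+ x. p x t * e x \<partial>count_space UNIV)" for t
  proof (cases "s \<le> t")
    case True
    have [measurable]: "X \<nu> t \<in> measurable (M \<nu>) (count_space UNIV)" using s True by (intro X_measurable) simp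
    have "emeasure (M \<nu>) (A \<inter> {\<omega> \<in> space (M \<nu>). X \<nu> t \<omega> = y}) =
      (\<integral>\<^sup>+ x. emeasure (M \<nu>) (A \<inter> {\<omega> \<in> space (M \<nu>). X \<nu> t \<omega> = y} \<inter> {\<omega> \<in> space (M \<nu>). X \<nu> s \<omega> = x}) \<partial>count_space UNIV)"
      by (intro emeasure_split_countable) auto
    also have "\<dots> = (\<integral>\<^sup>+ x. emeasure (M \<nu>) (A \<inter> {\<omega> \<in> space (M \<nu>). X \<nu> s \<omega> = x \<and> X \<nu> t \<omega> = y}) \<partial>count_space UNIV)"
      by (intro nn_integral_cong arg_cong2[where f=emeasure]) auto
    also have "\<dots> = (\<integral>\<^sup>+ x. transition (indicator {y}) x (t - s) * e x \<partial>count_space UNIV)"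
      unfolding markov_enlarged[OF G ind s True A] e_def ..
    finally show ?thesis using True by (simp add: p_def nn_integral_cmult[symmetric] mult.assoc)
  qed (simp add: p_def)
  have "(\<lambda>(t, x). p x t * e x) \<in> borel_measurable (lborel \<Otimes>\<^sub>M count_space UNIV)"
  proof -
    have "(\<lambda>(x, t). p x t * e x) \<in> borel_measurable (count_space UNIV \<Otimes>\<^sub>M lborel)"
      by (rule measurable_pair_measure_countable1) auto
    from measurable_pair_swap[OF this] show ?thesis by (simp add: case_prod_beta)
  qed
  then have "(\<lambda>t. \<integral>\<^sup>+ x. p x t * e x \<partial>count_space UNIV) \<in> borel_measurable lborel"
    by (intro sigma_finite_measure.borel_measurable_nn_integral sigma_finite_measure_count_space_countable) auto
  then show "(\<lambda>t. if s \<le> t then ennreal (exp (- l * t)) * emeasure (M \<nu>) (A \<inter> {\<omega> \<in> space (M \<nu>). X \<nu> t \<omega> = y}) else 0)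
      \<in> borel_measurable lborel"
    unfolding meas .
  have p_int: "(\<integral>\<^sup>+ t. p x t \<partial>lborel) = ennreal (exp (- l * s)) * resolvent l (indicator {y}) x" for x
  proof -
    have "(\<integral>\<^sup>+ t. p x t \<partial>lborel) = (\<integral>\<^sup>+ t. p x (s + 1 * t) \<partial>lborel)"
      by (subst nn_integral_real_affine[where c=1 and t=s]) auto
    also have "\<dots> = (\<integral>\<^sup>+ t. ennreal (exp (- l * s)) * (if 0 \<le> t then ennreal (exp (- l * t)) * transition (indicator {y}) x t else 0) \<partial>lborel)"
      by (intro nn_integral_cong) (auto simp: p_def ennreal_exp_add distrib_left)
    also have "\<dots> = ennreal (exp (- l * s)) * resolvent l (indicator {y}) x"
      unfolding laplace_transition[OF l, symmetric] by (rule nn_integral_cmult) measurable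
    finally show ?thesis .
  qed
  have "(\<integral>\<^sup>+ \<omega>. indicator A \<omega> * (ennreal (exp (- l * s)) * resolvent l (indicator {y}) (X \<nu> s \<omega>)) \<partial>M \<nu>) =
    (\<integral>\<^sup>+ \<omega>. (\<integral>\<^sup>+ x. (ennreal (exp (- l * s)) * resolvent l (indicator {y}) x) *
      indicator (A \<inter> {\<omega> \<in> space (M \<nu>). X \<nu> s \<omega> = x}) \<omega> \<partial>count_space UNIV) \<partial>M \<nu>)"
  proof (intro nn_integral_cong)
    fix \<omega> assume \<omega>: "\<omega> \<in> space (M \<nu>)"
    have "(\<integral>\<^sup>+ x. (ennreal (exp (- l * s)) * resolvent l (indicator {y}) x) *
      indicator (A \<inter> {\<omega> \<in> space (M \<nu>). X \<nu> s \<omega> = x}) \<omega> \<partial>count_space UNIV) =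
      (\<integral>\<^sup>+ x. (indicator A \<omega> * (ennreal (exp (- l * s)) * resolvent l (indicator {y}) x)) * indicator {X \<nu> s \<omega>} x \<partial>count_space UNIV)"
      using \<omega> by (intro nn_integral_cong) (auto split: split_indicator)
    also have "\<dots> = indicator A \<omega> * (ennreal (exp (- l * s)) * resolvent l (indicator {y}) (X \<nu> s \<omega>))"
      by (subst nn_integral_indicator_singleton) auto
    finally show "indicator A \<omega> * (ennreal (exp (- l * s)) * resolvent l (indicator {y}) (X \<nu> s \<omega>)) =
      (\<integral>\<^sup>+ x. (ennreal (exp (- l * s)) * resolvent l (indicator {y}) x) *
      indicator (A \<inter> {\<omega> \<in> space (M \<nu>). X \<nu> s \<omega> = x}) \<omega> \<partial>count_space UNIV)" by simp
  qed
  also have "\<dots> = (\<integral>\<^sup>+ x. (\<integral>\<^sup>+ \<omega>. (ennreal (exp (- l * s)) * resolvent l (indicator {y}) x) *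
      indicator (A \<inter> {\<omega> \<in> space (M \<nu>). X \<nu> s \<omega> = x}) \<omega> \<partial>M \<nu>) \<partial>count_space UNIV)"
    by (rule nn_integral_count_space_nn_integral) auto
  also have "\<dots> = (\<integral>\<^sup>+ x. (\<integral>\<^sup>+ t. p x t \<partial>lborel) * e x \<partial>count_space UNIV)"
    unfolding p_int e_def by (intro nn_integral_cong nn_integral_cmult_indicator) measurable
  also have "\<dots> = (\<integral>\<^sup>+ x. (\<integral>\<^sup>+ t. p x t * e x \<partial>lborel) \<partial>count_space UNIV)"
    by (intro nn_integral_cong nn_integral_multc[symmetric]) measurable
  also have "\<dots> = (\<integral>\<^sup>+ t. (\<integral>\<^sup>+ x. p x t * e x \<partial>count_space UNIV) \<partial>lborel)"
    by (rule nn_integral_count_space_nn_integral[symmetric]) auto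
  finally show "(\<integral>\<^sup>+ \<omega>. indicator A \<omega> * (ennreal (exp (- l * s)) * resolvent l (indicator {y}) (X \<nu> s \<omega>)) \<partial>M \<nu>) =
    (\<integral>\<^sup>+ t. (if s \<le> t then ennreal (exp (- l * t)) * emeasure (M \<nu>) (A \<inter> {\<omega> \<in> space (M \<nu>). X \<nu> t \<omega> = y}) else 0) \<partial>lborel)"
    unfolding meas .
qed

end

section \<open>Necessity\<close>

definition dyadic_ceiling :: "nat \<Rightarrow> real \<Rightarrow> real" where
  "dyadic_ceiling n r = real (nat \<lceil>2 ^ n * r\<rceil>) / 2 ^ n"

lemma dyadic_ceiling_ge: "0 \<le> r \<Longrightarrow> r \<le> dyadic_ceiling n r"
proof -
  assume "0 \<le> r"
  then have "2 ^ n * r \<le> real (nat \<lceil>2 ^ n * r\<rceil>)" by linarith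
  then show ?thesis by (simp add: dyadic_ceiling_def field_simps)
qed

lemma dyadic_ceiling_tendsto:
  assumes "0 \<le> r" shows "(\<lambda>n. dyadic_ceiling n r) \<longlonglongrightarrow> r"
proof (rule tendsto_sandwich)
  show "\<forall>\<^sub>F n in sequentially. r \<le> dyadic_ceiling n r" using dyadic_ceiling_ge[OF assms] by simp
  have "dyadic_ceiling n r \<le> r + (1 / 2) ^ n" for n
  proof -
    have "0 \<le> 2 ^ n * r" using assms by simp
    then have "real (nat \<lceil>2 ^ n * r\<rceil>) \<le> 2 ^ n * r + 1" by linarith
    then show ?thesis by (simp add: dyadic_ceiling_def field_simps power_divide)
  qed
  then show "\<forall>\<^sub>F n in sequentially. dyadic_ceiling n r \<le> r + (1 / 2) ^ n" by simp
  have "(\<lambda>n. r + (1 / 2) ^ n) \<longlonglongrightarrow> r + 0" by (intro tendsto_intros LIMSEQ_power_zero) auto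
  then show "(\<lambda>n. r + (1 / 2) ^ n) \<longlonglongrightarrow> r" by simp
qed simp

context bd_family
begin

text \<open>In the discrete topology, right-continuity means that the path is constant on an
  interval to the right of \<open>r\<close>, and the dyadic ceilings converge to \<open>r\<close>
  from above.\<close>

lemma X_dyadic_ceiling_eventually:
  assumes "\<omega> \<in> space (M \<nu>)" "0 \<le> r"
  shows "\<forall>\<^sub>F n in sequentially. X \<nu> (dyadic_ceiling n r) \<omega> = X \<nu> r \<omega>"
proof -
  have "((\<lambda>s. X \<nu> s \<omega>) \<longlongrightarrow> X \<nu> r \<omega>) (at_right r)"
    using X_continuous[OF assms] by (simp add: continuous_within)
  then have "\<forall>\<^sub>F s in at_right r. X \<nu> s \<omega> = X \<nu> r \<omega>"
    by (simp add: tendsto_discrete)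
  then obtain c where c: "r < c" "\<And>s. r < s \<Longrightarrow> s < c \<Longrightarrow> X \<nu> s \<omega> = X \<nu> r \<omega>"
    unfolding eventually_at_right_field by blast
  have "\<forall>\<^sub>F n in sequentially. dyadic_ceiling n r < c"
    using dyadic_ceiling_tendsto[OF assms(2)] c(1) by (rule order_tendstoD)
  then show ?thesis
  proof eventually_elim
    case (elim n)
    then show ?case
      using c(2)[of "dyadic_ceiling n r"] dyadic_ceiling_ge[OF assms(2), of n] by (cases "dyadic_ceiling n r = r") auto
  qed
qed

lemma X_dyadic_ceiling_measurable:
  assumes R: "R \<in> borel_measurable (M \<nu>)"
  shows "(\<lambda>\<omega>. X \<nu> (dyadic_ceiling n (R \<omega>)) \<omega>) \<in> measurable (M \<nu>) (count_space UNIV)"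
proof -
  have "(\<lambda>\<omega>. X \<nu> (real (nat \<lceil>2 ^ n * R \<omega>\<rceil>) / 2 ^ n) \<omega>) \<in> measurable (M \<nu>) (count_space UNIV)"
    by (rule measurable_compose_countable[where f="\<lambda>k \<omega>. X \<nu> (real (k::nat) / 2 ^ n) \<omega>"])
       (use R in \<open>auto intro!: X_measurable\<close>)
  then show ?thesis by (simp add: dyadic_ceiling_def)
qed

text \<open>The state at a random time is the eventual value along its dyadic ceilings, each of
  which takes countably many values.\<close>

lemma X_at_random_time_measurable:
  assumes R: "R \<in> borel_measurable (M \<nu>)" "\<And>\<omega>. 0 \<le> R \<omega>"
  shows "(\<lambda>\<omega>. X \<nu> (R \<omega>) \<omega>) \<in> measurable (M \<nu>) (count_space UNIV)"
proof -
  note [measurable] = X_dyadic_ceiling_measurable[OF R(1)]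
  have "{\<omega> \<in> space (M \<nu>). X \<nu> (R \<omega>) \<omega> = x} \<in> sets (M \<nu>)" for x
  proof -
    have "{\<omega> \<in> space (M \<nu>). X \<nu> (R \<omega>) \<omega> = x} =
      {\<omega> \<in> space (M \<nu>). \<exists>N. \<forall>n. N \<le> n \<longrightarrow> X \<nu> (dyadic_ceiling n (R \<omega>)) \<omega> = x}"
    proof (intro Collect_cong conj_cong refl)
      fix \<omega> assume \<omega>: "\<omega> \<in> space (M \<nu>)"
      obtain N where N: "\<And>n. N \<le> n \<Longrightarrow> X \<nu> (dyadic_ceiling n (R \<omega>)) \<omega> = X \<nu> (R \<omega>) \<omega>"
        using X_dyadic_ceiling_eventually[OF \<omega> R(2)] unfolding eventually_sequentially by blast
      show "X \<nu> (R \<omega>) \<omega> = x \<longleftrightarrow> (\<exists>N. \<forall>n. N \<le> n \<longrightarrow> X \<nu> (dyadic_ceiling n (R \<omega>)) \<omega> = x)"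
      proof
        assume "X \<nu> (R \<omega>) \<omega> = x" then show "\<exists>N. \<forall>n. N \<le> n \<longrightarrow> X \<nu> (dyadic_ceiling n (R \<omega>)) \<omega> = x" using N by auto
      next
        assume "\<exists>N. \<forall>n. N \<le> n \<longrightarrow> X \<nu> (dyadic_ceiling n (R \<omega>)) \<omega> = x"
        then obtain N' where "\<And>n. N' \<le> n \<Longrightarrow> X \<nu> (dyadic_ceiling n (R \<omega>)) \<omega> = x" by blast
        then show "X \<nu> (R \<omega>) \<omega> = x" using N[of "max N N'"] by simp
      qed
    qed
    also have "\<dots> \<in> sets (M \<nu>)" by measurable
    finally show ?thesis .
  qed
  then show ?thesis
    by (subst measurable_count_space_eq2_countable) (auto simp: vimage_def Int_def conj_commute)
qed

text \<open>
  The stopping time is approximated from above by its dyadic ceilings, and Fatou's lemma yields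
  the one inequality that is needed; continuity of the transition function in time plays no role.
\<close>

lemma resolvent_at_stopping_time:
  assumes G: "subalgebra (M \<nu>) G" and ind: "prob_space.indep_set (M \<nu>) (sets G) (sets (\<F> \<nu> \<infinity>))"
    and T: "stopping_time (enlarged \<nu> G) T" and \<nu>: "\<nu> = return_pmf x0" and l: "0 < l"
  shows "(\<integral>\<^sup>+ \<omega>. (if T \<omega> < \<infinity> then ennreal (exp (- l * enn2real (T \<omega>))) *
      resolvent l (indicator {y}) (X \<nu> (enn2real (T \<omega>)) \<omega>) else 0) \<partial>M \<nu>) \<le> resolvent l (indicator {y}) x0"
proof -
  let ?R = "\<lambda>x. resolvent l (indicator {y}) x"
  have T_le: "{\<omega> \<in> space (M \<nu>). T \<omega> \<le> u} \<in> sets (enlarged \<nu> G u)" for u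
    using stopping_timeD[OF T, of u] G by (simp add: Measurable.pred_def)
  have T_m [measurable]: "T \<in> borel_measurable (M \<nu>)"
    using G enlarged_subset[OF G] by (intro measurable_stopping_time[OF T]) auto
  define s where "s n k = real k / 2 ^ n" for n k :: nat
  \<comment> \<open>The event that \<open>T\<close> is finite and rounded up to
    \<open>s n k\<close>. Rounding up, it is decided by time \<open>s n k\<close>.\<close>
  define A where "A n k = {\<omega> \<in> space (M \<nu>). T \<omega> < \<infinity> \<and> nat \<lceil>2 ^ n * enn2real (T \<omega>)\<rceil> = k}" for n k :: nat
  have s0: "0 \<le> s n k" for n k by (simp add: s_def)
  have A_M [measurable]: "A n k \<in> sets (M \<nu>)" for n k unfolding A_def by measurable
  have A_en: "A n k \<in> sets (enlarged \<nu> G (ennreal (s n k)))" for n k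
  \<comment> \<open>The cell \<open>k = 0\<close> is the event that \<open>T\<close> is 0; every
    other cell is a difference of two events of the form \<open>T \<le> u\<close>.\<close>
  proof (cases k)
    case 0
    have "A n k = {\<omega> \<in> space (M \<nu>). T \<omega> \<le> ennreal (s n k)}"
      unfolding A_def
    proof (intro Collect_cong conj_cong refl)
      fix \<omega>
      have "\<not> (2::real) ^ n \<le> 0" by (simp add: not_le)
      then show "(T \<omega> < \<infinity> \<and> nat \<lceil>2 ^ n * enn2real (T \<omega>)\<rceil> = k) = (T \<omega> \<le> ennreal (s n k))"
        using 0 by (cases "T \<omega>") (auto simp: s_def mult_le_0_iff top_unique ennreal_eq_0_iff)
    qed
    then show ?thesis using T_le by simp
  next
    case (Suc j)
    have "A n k = {\<omega> \<in> space (M \<nu>). T \<omega> \<le> ennreal (s n k)} - {\<omega> \<in> space (M \<nu>). T \<omega> \<le> ennreal (s n j)}"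
    proof -
      have "(T \<omega> < \<infinity> \<and> nat \<lceil>2 ^ n * enn2real (T \<omega>)\<rceil> = k) = (T \<omega> \<le> ennreal (s n k) \<and> \<not> T \<omega> \<le> ennreal (s n j))" for \<omega>
      proof (cases "T \<omega>")
        case (real r)
        have "nat \<lceil>2 ^ n * r\<rceil> = k \<longleftrightarrow> real j < 2 ^ n * r \<and> 2 ^ n * r \<le> real k"
          using Suc real(1) by (auto simp: nat_eq_iff ceiling_eq_iff)
        then show ?thesis using real s0[of n k] s0[of n j]
          by (simp add: ennreal_le_iff) (auto simp: s_def field_simps not_le)
      qed (auto simp: top_unique)
      then show ?thesis unfolding A_def by blast
    qed
    moreover have "{\<omega> \<in> space (M \<nu>). T \<omega> \<le> ennreal (s n j)} \<in> sets (enlarged \<nu> G (ennreal (s n k)))"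
      using T_le[of "ennreal (s n j)"] enlarged_mono[OF G, of "ennreal (s n j)" "ennreal (s n k)"] Suc
      by (auto simp: s_def divide_right_mono ennreal_leI)
    ultimately show ?thesis using T_le by auto
  qed
  define q where "q n k t = (if s n k \<le> t then ennreal (exp (- l * t)) *
      emeasure (M \<nu>) (A n k \<inter> {\<omega> \<in> space (M \<nu>). X \<nu> t \<omega> = y}) else 0)" for n k t
  have q_m [measurable]: "q n k \<in> borel_measurable lborel" for n k
    unfolding q_def[abs_def] by (rule resolvent_enlarged(2)[OF G ind s0 A_en l])
  define Z where "Z n \<omega> = (if T \<omega> < \<infinity> then ennreal (exp (- l * dyadic_ceiling n (enn2real (T \<omega>)))) *
      ?R (X \<nu> (dyadic_ceiling n (enn2real (T \<omega>))) \<omega>) else 0)" for n \<omega>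
  have Z_sum: "Z n \<omega> = (\<Sum>k. indicator (A n k) \<omega> * (ennreal (exp (- l * s n k)) * ?R (X \<nu> (s n k) \<omega>)))"
    if \<omega>: "\<omega> \<in> space (M \<nu>)" for n \<omega>
  proof -
    let ?k = "nat \<lceil>2 ^ n * enn2real (T \<omega>)\<rceil>"
    have "(\<Sum>k. indicator (A n k) \<omega> * (ennreal (exp (- l * s n k)) * ?R (X \<nu> (s n k) \<omega>))) =
      (\<Sum>k. if k = ?k then (if T \<omega> < \<infinity> then ennreal (exp (- l * s n k)) * ?R (X \<nu> (s n k) \<omega>) else 0) else 0)"
      using \<omega> by (intro suminf_cong) (auto simp: A_def)
    also have "\<dots> = Z n \<omega>"
      using sums_single[of ?k "\<lambda>k. if T \<omega> < \<infinity> then ennreal (exp (- l * s n k)) * ?R (X \<nu> (s n k) \<omega>) else 0"]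
      by (auto simp: sums_iff Z_def s_def dyadic_ceiling_def)
    finally show ?thesis by simp
  qed
  have term_m [measurable]: "(\<lambda>\<omega>. indicator (A n k) \<omega> * (ennreal (exp (- l * s n k)) * ?R (X \<nu> (s n k) \<omega>))) \<in> borel_measurable (M \<nu>)" for n k
  proof -
    have [measurable]: "(\<lambda>\<omega>. ?R (X \<nu> (s n k) \<omega>)) \<in> borel_measurable (M \<nu>)"
      by (rule measurable_compose[OF X_measurable[OF s0]]) simp
    show ?thesis by measurable
  qed
  have Z_m: "Z n \<in> borel_measurable (M \<nu>)" for n
  proof -
    have "(\<lambda>\<omega>. \<Sum>k. indicator (A n k) \<omega> * (ennreal (exp (- l * s n k)) * ?R (X \<nu> (s n k) \<omega>))) \<in> borel_measurable (M \<nu>)"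
      by measurable
    then show ?thesis by (subst measurable_cong[OF Z_sum]) auto
  qed
  have Z_le: "(\<integral>\<^sup>+ \<omega>. Z n \<omega> \<partial>M \<nu>) \<le> ?R x0" for n
  proof -
    have "(\<integral>\<^sup>+ \<omega>. Z n \<omega> \<partial>M \<nu>) = (\<integral>\<^sup>+ \<omega>. (\<Sum>k. indicator (A n k) \<omega> * (ennreal (exp (- l * s n k)) * ?R (X \<nu> (s n k) \<omega>))) \<partial>M \<nu>)"
      by (intro nn_integral_cong Z_sum)
    also have "\<dots> = (\<Sum>k. \<integral>\<^sup>+ \<omega>. indicator (A n k) \<omega> * (ennreal (exp (- l * s n k)) * ?R (X \<nu> (s n k) \<omega>)) \<partial>M \<nu>)"
      by (rule nn_integral_suminf) measurable
    also have "\<dots> = (\<Sum>k. \<integral>\<^sup>+ t. q n k t \<partial>lborel)"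
      unfolding q_def resolvent_enlarged(1)[OF G ind s0 A_en l] ..
    also have "\<dots> = (\<integral>\<^sup>+ t. (\<Sum>k. q n k t) \<partial>lborel)"
      by (rule nn_integral_suminf[symmetric]) measurable
    also have "\<dots> \<le> (\<integral>\<^sup>+ t. (if 0 \<le> t then ennreal (exp (- l * t)) * transition (indicator {y}) x0 t else 0) \<partial>lborel)"
    proof (intro nn_integral_mono)
      fix t :: real
      show "(\<Sum>k. q n k t) \<le> (if 0 \<le> t then ennreal (exp (- l * t)) * transition (indicator {y}) x0 t else 0)"
      proof (cases "0 \<le> t")
        case True
        have [measurable]: "X \<nu> t \<in> measurable (M \<nu>) (count_space UNIV)" using True by (rule X_measurable)
        \<comment> \<open>The restriction to times after \<open>s n k\<close> is dropped. For fixed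
          \<open>t\<close> the cells are disjoint, so together they have at most the mass of
          \<open>X \<nu> t = y\<close>.\<close>
        have "(\<Sum>k. q n k t) \<le> (\<Sum>k. ennreal (exp (- l * t)) * emeasure (M \<nu>) (A n k \<inter> {\<omega> \<in> space (M \<nu>). X \<nu> t \<omega> = y}))"
          by (intro suminf_le) (auto simp: q_def)
        also have "\<dots> = ennreal (exp (- l * t)) * (\<Sum>k. emeasure (M \<nu>) (A n k \<inter> {\<omega> \<in> space (M \<nu>). X \<nu> t \<omega> = y}))"
          by simp
        also have "(\<Sum>k. emeasure (M \<nu>) (A n k \<inter> {\<omega> \<in> space (M \<nu>). X \<nu> t \<omega> = y})) =
          emeasure (M \<nu>) (\<Union>k. A n k \<inter> {\<omega> \<in> space (M \<nu>). X \<nu> t \<omega> = y})"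
          by (intro suminf_emeasure) (auto simp: disjoint_family_on_def A_def)
        also have "\<dots> \<le> emeasure (M \<nu>) {\<omega> \<in> space (M \<nu>). X \<nu> t \<omega> = y}"
          by (intro emeasure_mono) auto
        also have "\<dots> = transition (indicator {y}) x0 t" unfolding \<nu> by (rule X_law[OF True])
        finally show ?thesis using True by (simp add: mult_left_mono)
      next
        case False
        then have "q n k t = 0" for k using s0[of n k] by (auto simp: q_def)
        then show ?thesis by simp
      qed
    qed
    finally show ?thesis unfolding laplace_transition[OF l] .
  qed
  have "(\<lambda>n. Z n \<omega>) \<longlonglongrightarrow> (if T \<omega> < \<infinity> then ennreal (exp (- l * enn2real (T \<omega>))) *
      ?R (X \<nu> (enn2real (T \<omega>)) \<omega>) else 0)" if \<omega>: "\<omega> \<in> space (M \<nu>)" for \<omega>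
  proof (cases "T \<omega> < \<infinity>")
    case True
    let ?r = "enn2real (T \<omega>)"
    have "(\<lambda>n. ennreal (exp (- l * dyadic_ceiling n ?r))) \<longlonglongrightarrow> ennreal (exp (- l * ?r))"
      by (intro tendsto_intros dyadic_ceiling_tendsto) simp
    moreover have "?R (X \<nu> ?r \<omega>) < top"
      using resolvent_le[OF l, of y "X \<nu> ?r \<omega>"] by (rule le_less_trans) simp
    ultimately have "(\<lambda>n. ?R (X \<nu> ?r \<omega>) * ennreal (exp (- l * dyadic_ceiling n ?r))) \<longlonglongrightarrow>
        ?R (X \<nu> ?r \<omega>) * ennreal (exp (- l * ?r))"
      by (intro ennreal_tendsto_cmult)
    \<comment> \<open>By right-continuity the state is eventually frozen, so the limit concerns the
      exponential factor alone.\<close>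
    moreover have "\<forall>\<^sub>F n in sequentially. ?R (X \<nu> ?r \<omega>) * ennreal (exp (- l * dyadic_ceiling n ?r)) = Z n \<omega>"
      using X_dyadic_ceiling_eventually[OF \<omega>, of ?r]
      using True by (auto simp: Z_def mult.commute elim!: eventually_mono)
    ultimately show ?thesis
      using True by (simp add: mult.commute Lim_transform_eventually)
  qed (simp add: Z_def)
  then have "(\<integral>\<^sup>+ \<omega>. (if T \<omega> < \<infinity> then ennreal (exp (- l * enn2real (T \<omega>))) *
      ?R (X \<nu> (enn2real (T \<omega>)) \<omega>) else 0) \<partial>M \<nu>) = (\<integral>\<^sup>+ \<omega>. liminf (\<lambda>n. Z n \<omega>) \<partial>M \<nu>)"
    by (intro nn_integral_cong lim_imp_Liminf[symmetric]) auto
  also have "\<dots> \<le> liminf (\<lambda>n. \<integral>\<^sup>+ \<omega>. Z n \<omega> \<partial>M \<nu>)" by (rule nn_integral_liminf) (rule Z_m)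
  also have "\<dots> \<le> liminf (\<lambda>n::nat. ?R x0)" by (intro Liminf_mono always_eventually allI Z_le)
  also have "\<dots> = ?R x0" by (simp add: Liminf_const)
  finally show ?thesis .
qed

text \<open>Since \<open>exp (- T)\<close> is a function of \<open>T\<close>, weighting by it leaves
  the law of the state at time \<open>T\<close> proportional to \<open>\<mu>\<close>, with total
  mass \<open>\<eta>\<close>. By \<open>resolvent_at_stopping_time\<close>, \<open>\<eta>\<close>
  times the \<open>\<mu>\<close>-average of the resolvent is a lower bound, and reversibility with
  total mass 1 identifies this average as the mass of \<open>y\<close>.\<close>

lemma resolvent_lower_bound_of_strong_stationary_time:
  assumes sst: "finite_strong_stationary_time \<mu> (M \<nu>) (X \<nu>) T" and \<nu>: "\<nu> = return_pmf x0"
    and balance: "\<And>n. pmf \<mu> n * b n = pmf \<mu> (n + 1) * a (n + 1)"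
  shows "\<exists>\<eta>>0. \<forall>y. ennreal (\<eta> * pmf \<mu> y) \<le> resolvent 1 (indicator {y}) x0"
proof -
  interpret prob_space "M \<nu>" by (rule prob_space_M)
  obtain G where G: "subalgebra (M \<nu>) G" "indep_set (sets G) (sets (\<F> \<nu> \<infinity>))"
    and T: "stopping_time (enlarged \<nu> G) T"
    using sst unfolding finite_strong_stationary_time_def strong_stationary_time_def
      randomized_stopping_time_def enlarged_def[abs_def] by blast
  have fin: "AE \<omega> in M \<nu>. T \<omega> < \<infinity>" using sst by (simp add: finite_strong_stationary_time_def)
  have [measurable]: "T \<in> borel_measurable (M \<nu>)"
    using G enlarged_subset[OF G(1)] by (intro measurable_stopping_time[OF T]) auto
  define F where "F = vimage_algebra (space (M \<nu>)) T borel"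
  have F: "subalgebra (M \<nu>) F"
    unfolding F_def subalgebra_def
    by (auto simp: sets_vimage_algebra2)
  interpret finite_measure_subalgebra "M \<nu>" F by unfold_locales (rule F)
  \<comment> \<open>The value 0 at \<open>T = \<infinity>\<close> is the limit of the discount;
    positivity of \<open>\<eta>\<close> rests on the almost sure finiteness of
    \<open>T\<close>.\<close>
  define f where "f \<omega> = (if T \<omega> < \<infinity> then exp (- enn2real (T \<omega>)) else 0)" for \<omega>
  have T_F: "T \<in> borel_measurable F" unfolding F_def by (rule measurable_vimage_algebra1) simp
  have f_F: "f \<in> borel_measurable F"
    unfolding f_def using T_F by measurable
  have f_M [measurable]: "f \<in> borel_measurable (M \<nu>)" unfolding f_def by measurable
  have f01: "0 \<le> f \<omega>" "f \<omega> \<le> 1" for \<omega> by (auto simp: f_def)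
  have f_int: "integrable (M \<nu>) f"
    by (rule integrable_const_bound[of _ 1]) (use f01 in auto)
  define \<eta> where "\<eta> = (\<integral>\<omega>. f \<omega> \<partial>M \<nu>)"
  have "\<eta> \<noteq> 0"
  proof
    assume "\<eta> = 0"
    then have "AE \<omega> in M \<nu>. f \<omega> = 0"
      using integral_nonneg_eq_0_iff_AE[OF f_int] f01 by (simp add: \<eta>_def)
    with fin have "AE \<omega> in M \<nu>. False" by eventually_elim (auto simp: f_def)
    then show False by simp
  qed
  moreover have "0 \<le> \<eta>" unfolding \<eta>_def by (intro integral_nonneg_AE) (simp add: f01)
  ultimately have \<eta>: "0 < \<eta>" by simp
  define XT where "XT \<omega> = X \<nu> (enn2real (T \<omega>)) \<omega>" for \<omega>
  have XT [measurable]: "XT \<in> measurable (M \<nu>) (count_space UNIV)"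
    unfolding XT_def by (rule X_at_random_time_measurable) auto
  have [measurable]: "(\<lambda>\<omega>. indicator {x} (XT \<omega>) :: ennreal) \<in> borel_measurable (M \<nu>)" for x
    by (rule measurable_compose[of XT _ "count_space UNIV"]) auto
  \<comment> \<open>\<open>f\<close> is measurable for the \<sigma>-algebra of \<open>T\<close>, so
    the indicator may be replaced by its conditional expectation, a constant.\<close>
  have law: "(\<integral>\<^sup>+ \<omega>. ennreal (f \<omega>) * indicator {x} (XT \<omega>) \<partial>M \<nu>) = ennreal (pmf \<mu> x * \<eta>)" for x
  proof -
    let ?I = "indicator {\<omega> \<in> space (M \<nu>). X \<nu> (enn2real (T \<omega>)) \<omega> \<in> {x}} :: 'a \<Rightarrow> real"
    have I_set: "{\<omega> \<in> space (M \<nu>). X \<nu> (enn2real (T \<omega>)) \<omega> \<in> {x}} \<in> sets (M \<nu>)"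
      using measurable_sets[OF XT, of "{x}"] by (simp add: XT_def vimage_def Int_def conj_commute)
    have I_m [measurable]: "?I \<in> borel_measurable (M \<nu>)" by (rule borel_measurable_indicator[OF I_set])
    have int: "integrable (M \<nu>) (\<lambda>\<omega>. f \<omega> * ?I \<omega>)"
    proof (rule integrable_const_bound[of _ 1])
      show "AE \<omega> in M \<nu>. norm (f \<omega> * ?I \<omega>) \<le> 1" using f01 by (auto split: split_indicator)
    qed (intro borel_measurable_times f_M I_m)
    have ce: "AE \<omega> in M \<nu>. T \<omega> < \<infinity> \<longrightarrow> real_cond_exp (M \<nu>) F ?I \<omega> = measure_pmf.prob \<mu> {x}"
      using sst unfolding finite_strong_stationary_time_def strong_stationary_time_def F_def by blast
    have "(\<integral>\<omega>. f \<omega> * ?I \<omega> \<partial>M \<nu>) = (\<integral>\<omega>. f \<omega> * real_cond_exp (M \<nu>) F ?I \<omega> \<partial>M \<nu>)"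
      by (rule real_cond_exp_intg(2)[symmetric]) (use int f_F I_m in auto)
    also have "\<dots> = (\<integral>\<omega>. f \<omega> * pmf \<mu> x \<partial>M \<nu>)"
    proof (rule integral_cong_AE)
      show "AE \<omega> in M \<nu>. f \<omega> * real_cond_exp (M \<nu>) F ?I \<omega> = f \<omega> * pmf \<mu> x"
        using ce fin by eventually_elim (simp add: measure_pmf_single)
    qed (intro borel_measurable_times f_M borel_measurable_cond_exp2 borel_measurable_const)+
    also have "\<dots> = pmf \<mu> x * \<eta>" by (simp add: \<eta>_def mult.commute)
    finally have e: "(\<integral>\<omega>. f \<omega> * ?I \<omega> \<partial>M \<nu>) = pmf \<mu> x * \<eta>" .
    have "(\<integral>\<^sup>+ \<omega>. ennreal (f \<omega>) * indicator {x} (XT \<omega>) \<partial>M \<nu>) = (\<integral>\<^sup>+ \<omega>. ennreal (f \<omega> * ?I \<omega>) \<partial>M \<nu>)"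
      by (intro nn_integral_cong) (auto simp: XT_def split: split_indicator)
    also have "\<dots> = ennreal (pmf \<mu> x * \<eta>)"
      using nn_integral_eq_integral[OF int] f01 e by simp
    finally show ?thesis .
  qed
  have "ennreal (\<eta> * pmf \<mu> y) \<le> resolvent 1 (indicator {y}) x0" for y
  proof -
    \<comment> \<open>The inserted sum over \<open>x\<close> is the total mass 1 of the resolvent at
      discount 1; symmetry then turns it from a sum over end states into one over starting
      states.\<close>
    have "ennreal (\<eta> * pmf \<mu> y) = ennreal \<eta> * (ennreal (pmf \<mu> y) * (\<integral>\<^sup>+ x. resolvent 1 (indicator {x}) y \<partial>count_space UNIV))"
      using \<eta> by (simp add: resolvent_total ennreal_mult)
    also have "\<dots> = (\<integral>\<^sup>+ x. ennreal \<eta> * (ennreal (pmf \<mu> y) * resolvent 1 (indicator {x}) y) \<partial>count_space UNIV)"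
      by (simp add: nn_integral_cmult)
    also have "\<dots> = (\<integral>\<^sup>+ x. resolvent 1 (indicator {y}) x * ennreal (pmf \<mu> x * \<eta>) \<partial>count_space UNIV)"
    proof (intro nn_integral_cong)
      fix x
      have "ennreal (pmf \<mu> y) * resolvent 1 (indicator {x}) y = ennreal (pmf \<mu> x) * resolvent 1 (indicator {y}) x"
        by (rule resolvent_symmetric) (auto simp: balance)
      then show "ennreal \<eta> * (ennreal (pmf \<mu> y) * resolvent 1 (indicator {x}) y) = resolvent 1 (indicator {y}) x * ennreal (pmf \<mu> x * \<eta>)"
        using \<eta> by (simp add: ennreal_mult mult_ac)
    qed
    also have "\<dots> = (\<integral>\<^sup>+ x. (\<integral>\<^sup>+ \<omega>. resolvent 1 (indicator {y}) x * (ennreal (f \<omega>) * indicator {x} (XT \<omega>)) \<partial>M \<nu>) \<partial>count_space UNIV)"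
      unfolding law[symmetric]
      by (intro nn_integral_cong nn_integral_cmult[symmetric]) measurable
    also have "\<dots> = (\<integral>\<^sup>+ \<omega>. (\<integral>\<^sup>+ x. resolvent 1 (indicator {y}) x * (ennreal (f \<omega>) * indicator {x} (XT \<omega>)) \<partial>count_space UNIV) \<partial>M \<nu>)"
      by (rule nn_integral_count_space_nn_integral[symmetric]) (auto, measurable)
    also have "\<dots> = (\<integral>\<^sup>+ \<omega>. (if T \<omega> < \<infinity> then ennreal (exp (- 1 * enn2real (T \<omega>))) *
      resolvent 1 (indicator {y}) (X \<nu> (enn2real (T \<omega>)) \<omega>) else 0) \<partial>M \<nu>)"
    proof (intro nn_integral_cong)
      fix \<omega>
      have "(\<integral>\<^sup>+ x. resolvent 1 (indicator {y}) x * (ennreal (f \<omega>) * indicator {x} (XT \<omega>)) \<partial>count_space UNIV) =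
        (\<integral>\<^sup>+ x. (resolvent 1 (indicator {y}) x * ennreal (f \<omega>)) * indicator {XT \<omega>} x \<partial>count_space UNIV)"
        by (intro nn_integral_cong) (auto split: split_indicator)
      also have "\<dots> = resolvent 1 (indicator {y}) (XT \<omega>) * ennreal (f \<omega>)"
        by (subst nn_integral_indicator_singleton) auto
      finally show "(\<integral>\<^sup>+ x. resolvent 1 (indicator {y}) x * (ennreal (f \<omega>) * indicator {x} (XT \<omega>)) \<partial>count_space UNIV) =
        (if T \<omega> < \<infinity> then ennreal (exp (- 1 * enn2real (T \<omega>))) *
      resolvent 1 (indicator {y}) (X \<nu> (enn2real (T \<omega>)) \<omega>) else 0)"
        by (simp add: f_def XT_def mult.commute)
    qed
    also have "\<dots> \<le> resolvent 1 (indicator {y}) x0"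
      by (rule resolvent_at_stopping_time[OF G T \<nu>]) simp
    finally show ?thesis .
  qed
  then show ?thesis using \<eta> by blast
qed

end

section \<open>Sufficiency\<close>

text \<open>By independence the joint law of \<open>W\<close> and \<open>U\<close> is a product, and
  for fixed \<open>w \<le> 1\<close> a uniform variable is at most \<open>w\<close> with probability
  \<open>w\<close>, read as 0 for negative \<open>w\<close>. Applied to variables determined by the
  process, it realises given conditional probabilities by events.\<close>

lemma (in prob_space) emeasure_uniform_le:
  assumes U: "U \<in> borel_measurable M" "distr M borel U = uniform_measure lborel {0..1::real}"
    and W: "W \<in> borel_measurable F" "subalgebra M F" "\<And>\<omega>. W \<omega> \<le> 1"
    and ind: "indep_set (sets (vimage_algebra (space M) U borel)) (sets F)"
  shows "emeasure M {\<omega> \<in> space M. U \<omega> \<le> W \<omega>} = (\<integral>\<^sup>+ \<omega>. ennreal (W \<omega>) \<partial>M)"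
proof -
  note [measurable] = U(1)
  have [measurable]: "W \<in> borel_measurable M" using measurable_from_subalg[OF W(2,1)] .
  interpret dU: prob_space "distr M borel U" by (rule prob_space_distr) measurable
  interpret dW: prob_space "distr M borel W" by (rule prob_space_distr) measurable
  have eq: "distr M borel W \<Otimes>\<^sub>M distr M borel U = distr M (borel \<Otimes>\<^sub>M borel) (\<lambda>\<omega>. (W \<omega>, U \<omega>))"
  proof (rule pair_measure_eqI)
    fix A B assume "A \<in> sets (distr M borel W)" "B \<in> sets (distr M borel U)"
    then have [measurable]: "A \<in> sets borel" "B \<in> sets borel" by auto
    have "U -` B \<inter> space M \<in> sets (vimage_algebra (space M) U borel)" by (rule in_vimage_algebra) measurable
    moreover have "W -` A \<inter> space M \<in> sets F"
      using measurable_sets[OF W(1), of A] W(2) by (simp add: subalgebra_def)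
    ultimately have "prob ((U -` B \<inter> space M) \<inter> (W -` A \<inter> space M)) = prob (U -` B \<inter> space M) * prob (W -` A \<inter> space M)"
      by (rule indep_setD[OF ind])
    moreover have "(U -` B \<inter> space M) \<inter> (W -` A \<inter> space M) = (\<lambda>\<omega>. (W \<omega>, U \<omega>)) -` (A \<times> B) \<inter> space M" by auto
    ultimately show "emeasure (distr M borel W) A * emeasure (distr M borel U) B =
        emeasure (distr M (borel \<Otimes>\<^sub>M borel) (\<lambda>\<omega>. (W \<omega>, U \<omega>))) (A \<times> B)"
      by (simp add: emeasure_distr emeasure_eq_measure ennreal_mult[symmetric] mult.commute)
  qed (auto intro: dU.sigma_finite_measure_axioms dW.sigma_finite_measure_axioms cong: sets_pair_measure_cong)
  have u: "emeasure (distr M borel U) {..w} = ennreal w" if "w \<le> 1" for w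
  proof -
    have "{0..1} \<inter> {..w} = {0..w}" using that by auto
    then show ?thesis unfolding U(2)
      by (cases "0 \<le> w") (auto simp: emeasure_lborel_Icc_eq ennreal_neg divide_ennreal_def)
  qed
  define D where "D = {p \<in> space (borel \<Otimes>\<^sub>M borel). snd p \<le> (fst p :: real)}"
  have D: "D \<in> sets (borel \<Otimes>\<^sub>M borel)" unfolding D_def by measurable
  have D': "D \<in> sets (distr M borel W \<Otimes>\<^sub>M distr M borel U)"
    using D by (simp cong: sets_pair_measure_cong)
  have "emeasure M {\<omega> \<in> space M. U \<omega> \<le> W \<omega>} =
    emeasure (distr M (borel \<Otimes>\<^sub>M borel) (\<lambda>\<omega>. (W \<omega>, U \<omega>))) D"
    by (subst emeasure_distr[OF _ D]) (auto intro!: arg_cong2[where f=emeasure] simp: D_def space_pair_measure)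
  also have "\<dots> = (\<integral>\<^sup>+ w. emeasure (distr M borel U) (Pair w -` D) \<partial>distr M borel W)"
    unfolding eq[symmetric] by (rule dU.emeasure_pair_measure_alt[OF D'])
  also have "\<dots> = (\<integral>\<^sup>+ \<omega>. emeasure (distr M borel U) (Pair (W \<omega>) -` D) \<partial>M)"
    by (rule nn_integral_distr[OF _ dU.measurable_emeasure_Pair[OF D']]) measurable
  also have "\<dots> = (\<integral>\<^sup>+ \<omega>. ennreal (W \<omega>) \<partial>M)"
  proof (intro nn_integral_cong)
    fix \<omega>
    have "Pair (W \<omega>) -` D = {..W \<omega>}" by (auto simp: D_def space_pair_measure)
    then show "emeasure (distr M borel U) (Pair (W \<omega>) -` D) = ennreal (W \<omega>)"
      using u[OF W(3)] by simp
  qed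
  finally show ?thesis .
qed

text \<open>\<open>markov\<close> says that two measures agree on the events up to time
  \<open>s\<close>. Restricted to that \<sigma>-algebra they are equal, hence integrate every
  \<open>Z\<close> measurable for it equally.\<close>

lemma (in bd_family) markov_weighted:
  assumes st: "0 \<le> s" "s \<le> t" and Z: "Z \<in> borel_measurable (\<F> \<nu> (ennreal s))"
  shows "(\<integral>\<^sup>+ \<omega>. Z \<omega> * indicator {\<omega> \<in> space (M \<nu>). X \<nu> s \<omega> = x \<and> X \<nu> t \<omega> = y} \<omega> \<partial>M \<nu>) =
    transition (indicator {y}) x (t - s) * (\<integral>\<^sup>+ \<omega>. Z \<omega> * indicator {\<omega> \<in> space (M \<nu>). X \<nu> s \<omega> = x} \<omega> \<partial>M \<nu>)"
proof -
  let ?P1 = "{\<omega> \<in> space (M \<nu>). X \<nu> s \<omega> = x \<and> X \<nu> t \<omega> = y}" and ?P2 = "{\<omega> \<in> space (M \<nu>). X \<nu> s \<omega> = x}"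
  let ?c = "transition (indicator {y}) x (t - s)"
  have [measurable]: "X \<nu> s \<in> measurable (M \<nu>) (count_space UNIV)" "X \<nu> t \<in> measurable (M \<nu>) (count_space UNIV)"
    using st by (auto intro: X_measurable)
  have F: "subalgebra (M \<nu>) (\<F> \<nu> (ennreal s))" using filtration_subset by (simp add: subalgebra_def)
  have id: "(\<lambda>\<omega>. \<omega>) \<in> measurable (M \<nu>) (\<F> \<nu> (ennreal s))" using measurable_from_subalg[OF F measurable_ident] by (simp add: id_def)
  have Zm [measurable]: "Z \<in> borel_measurable (M \<nu>)" using measurable_from_subalg[OF F Z] .
  have P [measurable]: "?P1 \<in> sets (M \<nu>)" "?P2 \<in> sets (M \<nu>)" by measurable
  have eq: "distr (density (M \<nu>) (indicator ?P1)) (\<F> \<nu> (ennreal s)) (\<lambda>\<omega>. \<omega>) =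
    distr (density (M \<nu>) (\<lambda>\<omega>. ?c * indicator ?P2 \<omega>)) (\<F> \<nu> (ennreal s)) (\<lambda>\<omega>. \<omega>)"
  proof (rule measure_eqI)
    fix A assume "A \<in> sets (distr (density (M \<nu>) (indicator ?P1)) (\<F> \<nu> (ennreal s)) (\<lambda>\<omega>. \<omega>))"
    then have A: "A \<in> sets (\<F> \<nu> (ennreal s))" by simp
    then have AM [measurable]: "A \<in> sets (M \<nu>)" using filtration_subset by blast
    have vA: "(\<lambda>\<omega>. \<omega>) -` A \<inter> space (M \<nu>) = A" using sets.sets_into_space[OF AM] by auto
    have "emeasure (distr (density (M \<nu>) (indicator ?P1)) (\<F> \<nu> (ennreal s)) (\<lambda>\<omega>. \<omega>)) A = emeasure (M \<nu>) (A \<inter> ?P1)"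
      using id A vA by (simp add: emeasure_distr emeasure_restricted Int_commute)
    also have "\<dots> = ?c * emeasure (M \<nu>) (A \<inter> ?P2)" by (rule markov[OF st A])
    also have "\<dots> = emeasure (distr (density (M \<nu>) (\<lambda>\<omega>. ?c * indicator ?P2 \<omega>)) (\<F> \<nu> (ennreal s)) (\<lambda>\<omega>. \<omega>)) A"
      using id A vA by (simp add: emeasure_distr emeasure_density nn_integral_cmult mult.assoc
          indicator_inter_arith[symmetric] Int_commute)
    finally show "emeasure (distr (density (M \<nu>) (indicator ?P1)) (\<F> \<nu> (ennreal s)) (\<lambda>\<omega>. \<omega>)) A =
      emeasure (distr (density (M \<nu>) (\<lambda>\<omega>. ?c * indicator ?P2 \<omega>)) (\<F> \<nu> (ennreal s)) (\<lambda>\<omega>. \<omega>)) A" .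
  qed simp
  have "(\<integral>\<^sup>+ \<omega>. Z \<omega> * indicator ?P1 \<omega> \<partial>M \<nu>) = (\<integral>\<^sup>+ \<omega>. Z \<omega> \<partial>distr (density (M \<nu>) (indicator ?P1)) (\<F> \<nu> (ennreal s)) (\<lambda>\<omega>. \<omega>))"
    using id Z by (simp add: nn_integral_distr nn_integral_density mult.commute)
  also have "\<dots> = (\<integral>\<^sup>+ \<omega>. ?c * (Z \<omega> * indicator ?P2 \<omega>) \<partial>M \<nu>)"
    unfolding eq using id Z by (simp add: nn_integral_distr nn_integral_density mult_ac)
  also have "\<dots> = ?c * (\<integral>\<^sup>+ \<omega>. Z \<omega> * indicator ?P2 \<omega> \<partial>M \<nu>)"
    by (rule nn_integral_cmult) measurable
  finally show ?thesis .
qed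

section \<open>Randomised stopping on the skeleton\<close>

locale sst_construction = bd_family a b M X for a b and M :: "int pmf \<Rightarrow> 'a measure" and X +
  fixes \<nu> \<mu> :: "int pmf" and U :: "'a \<Rightarrow> real" and \<tau> \<epsilon> :: real
  assumes U: "U \<in> borel_measurable (M \<nu>)" "distr (M \<nu>) borel U = uniform_measure lborel {0..1::real}"
    and U_indep: "prob_space.indep_set (M \<nu>) (sets (vimage_algebra (space (M \<nu>)) U borel)) (sets (\<F> \<nu> \<infinity>))"
    and \<tau>: "0 < \<tau>" and \<epsilon>: "0 < \<epsilon>" and \<mu>_pos: "\<And>y. 0 < pmf \<mu> y"
    and minorisation: "\<And>x y. ennreal (\<epsilon> * pmf \<mu> y) \<le> transition (indicator {y}) x \<tau>"
begin

sublocale prob_space "M \<nu>" by (rule prob_space_M)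

definition p :: "int \<Rightarrow> int \<Rightarrow> real" where "p x y = enn2real (transition (indicator {y}) x \<tau>)"

lemma transition_p: "transition (indicator {y}) x \<tau> = ennreal (p x y)"
  using transition_le_1[of \<tau> y x] \<tau> unfolding p_def
  by (intro ennreal_enn2real[symmetric]) (auto intro: le_less_trans)

lemma p_ge: "\<epsilon> * pmf \<mu> y \<le> p x y"
  using minorisation[of y x] unfolding transition_p by (subst (asm) ennreal_le_iff) (auto simp: p_def)

lemma p_pos: "0 < p x y"
  using p_ge[of y x] \<epsilon> \<mu>_pos[of y] by (smt (verit) mult_pos_pos)

definition skel :: "nat \<Rightarrow> 'a \<Rightarrow> int" where "skel k \<omega> = X \<nu> (\<tau> * real k) \<omega>"

definition stop :: "int \<Rightarrow> int \<Rightarrow> real" where "stop x y = \<epsilon> * pmf \<mu> y / p x y"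

lemma stop_bounds: "0 \<le> stop x y" "stop x y \<le> 1"
  using p_ge[of y x] p_pos[of x y] \<epsilon> by (auto simp: stop_def)

text \<open>
  \<open>surv k\<close> is the conditional probability, given the process, of not stopping up to step \<open>k\<close>, so that
  the single uniform variable \<open>U\<close> suffices: stop at the first \<open>k\<close> with \<open>surv k < U\<close>.
\<close>

definition surv :: "nat \<Rightarrow> 'a \<Rightarrow> real" where
  "surv k \<omega> = (\<Prod>i<k. 1 - stop (skel i \<omega>) (skel (Suc i) \<omega>))"

lemma surv_Suc: "surv (Suc k) \<omega> = surv k \<omega> * (1 - stop (skel k \<omega>) (skel (Suc k) \<omega>))"
  by (simp add: surv_def)

lemma surv_0 [simp]: "surv 0 \<omega> = 1" by (simp add: surv_def)

lemma surv_nonneg: "0 \<le> surv k \<omega>"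
  unfolding surv_def by (intro prod_nonneg) (simp add: stop_bounds)

lemma surv_Suc_le: "surv (Suc k) \<omega> \<le> surv k \<omega>"
  unfolding surv_Suc using surv_nonneg stop_bounds by (intro mult_right_le_one_le) auto

lemma surv_antimono: "j \<le> k \<Longrightarrow> surv k \<omega> \<le> surv j \<omega>"
  by (induction k rule: dec_induct) (auto intro: order_trans[OF surv_Suc_le])

lemma surv_le_1: "surv k \<omega> \<le> 1"
  using surv_antimono[of 0 k \<omega>] by simp

lemma skel_filtration:
  "ennreal (\<tau> * real k) \<le> u \<Longrightarrow> skel k \<in> measurable (\<F> \<nu> u) (count_space UNIV)"
  unfolding skel_def[abs_def] using \<tau> by (intro X_measurable_filtration) auto

lemma skel_measurable [measurable]: "skel k \<in> measurable (M \<nu>) (count_space UNIV)"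
  unfolding skel_def[abs_def] using \<tau> by (intro X_measurable) auto

lemma stop_skel_measurable:
  assumes "skel k \<in> measurable N (count_space UNIV)" "skel (Suc k) \<in> measurable N (count_space UNIV)"
  shows "(\<lambda>\<omega>. stop (skel k \<omega>) (skel (Suc k) \<omega>)) \<in> borel_measurable N"
  by (rule measurable_compose_countable[OF _ assms(1), where f="\<lambda>x \<omega>. stop x (skel (Suc k) \<omega>)"])
     (rule measurable_compose[OF assms(2)], simp)

lemma surv_filtration:
  assumes "ennreal (\<tau> * real k) \<le> u" shows "surv k \<in> borel_measurable (\<F> \<nu> u)"
proof -
  have "(\<lambda>\<omega>. stop (skel i \<omega>) (skel (Suc i) \<omega>)) \<in> borel_measurable (\<F> \<nu> u)" if "i \<in> {..<k}" for i
  proof -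
    have "ennreal (\<tau> * real i) \<le> u" "ennreal (\<tau> * real (Suc i)) \<le> u"
      using that \<tau> by (auto intro!: order_trans[OF _ assms] ennreal_leI mult_left_mono)
    then show ?thesis by (intro stop_skel_measurable skel_filtration)
  qed
  then show ?thesis unfolding surv_def[abs_def] by (intro borel_measurable_prod borel_measurable_diff) auto
qed

lemma surv_measurable [measurable]: "surv k \<in> borel_measurable (M \<nu>)"
  using measurable_from_subalg[of "M \<nu>" "\<F> \<nu> \<infinity>", OF _ surv_filtration[of k \<infinity>]] filtration_subset
  by (simp add: subalgebra_def)

lemma U_measurable [measurable]: "U \<in> borel_measurable (M \<nu>)" by (rule U)

text \<open>The probability of not having stopped up to step \<open>k\<close>, by
  \<open>U_le_surv\<close>.\<close>

definition mass :: "nat \<Rightarrow> ennreal" where "mass k = (\<integral>\<^sup>+ \<omega>. ennreal (surv k \<omega>) \<partial>M \<nu>)"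

lemma mass_finite: "mass k \<le> 1"
proof -
  have "mass k \<le> (\<integral>\<^sup>+ \<omega>. 1 \<partial>M \<nu>)" unfolding mass_def
    by (intro nn_integral_mono) (simp add: ennreal_le_1 surv_le_1)
  then show ?thesis by (simp add: emeasure_space_1)
qed

text \<open>\<open>stop x y\<close> times the transition probability from \<open>x\<close> to
  \<open>y\<close> is \<open>\<epsilon> * pmf \<mu> y\<close>, free of the previous state
  \<open>x\<close>. Summing over \<open>x\<close> therefore leaves the survival mass as a separate
  factor.\<close>

lemma integral_stop:
  "(\<integral>\<^sup>+ \<omega>. ennreal (surv k \<omega> * stop (skel k \<omega>) (skel (Suc k) \<omega>)) * indicator {\<omega> \<in> space (M \<nu>). skel (Suc k) \<omega> = y} \<omega> \<partial>M \<nu>) =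
    ennreal (\<epsilon> * pmf \<mu> y) * mass k"
proof -
  let ?Q = "\<lambda>x. {\<omega> \<in> space (M \<nu>). skel k \<omega> = x \<and> skel (Suc k) \<omega> = y}"
  have split: "g \<omega> = (\<integral>\<^sup>+ x. g \<omega> * indicator {\<omega> \<in> space (M \<nu>). skel k \<omega> = x} \<omega> \<partial>count_space UNIV)"
    if "\<omega> \<in> space (M \<nu>)" for g :: "'a \<Rightarrow> ennreal" and \<omega>
  proof -
    have "(\<integral>\<^sup>+ x. g \<omega> * indicator {\<omega> \<in> space (M \<nu>). skel k \<omega> = x} \<omega> \<partial>count_space UNIV) =
      (\<integral>\<^sup>+ x. g \<omega> * indicator {skel k \<omega>} x \<partial>count_space UNIV)"
      using that by (intro nn_integral_cong) (auto split: split_indicator)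
    also have "\<dots> = g \<omega>" by (subst nn_integral_indicator_singleton) auto
    finally show ?thesis by simp
  qed
  have "(\<integral>\<^sup>+ \<omega>. ennreal (surv k \<omega> * stop (skel k \<omega>) (skel (Suc k) \<omega>)) * indicator {\<omega> \<in> space (M \<nu>). skel (Suc k) \<omega> = y} \<omega> \<partial>M \<nu>) =
    (\<integral>\<^sup>+ \<omega>. (\<integral>\<^sup>+ x. ennreal (stop x y) * (ennreal (surv k \<omega>) * indicator (?Q x) \<omega>) \<partial>count_space UNIV) \<partial>M \<nu>)"
  proof (intro nn_integral_cong)
    fix \<omega> assume \<omega>: "\<omega> \<in> space (M \<nu>)"
    show "ennreal (surv k \<omega> * stop (skel k \<omega>) (skel (Suc k) \<omega>)) * indicator {\<omega> \<in> space (M \<nu>). skel (Suc k) \<omega> = y} \<omega> =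
      (\<integral>\<^sup>+ x. ennreal (stop x y) * (ennreal (surv k \<omega>) * indicator (?Q x) \<omega>) \<partial>count_space UNIV)"
      by (subst split[OF \<omega>], intro nn_integral_cong)
         (auto simp: surv_nonneg stop_bounds ennreal_mult mult_ac split: split_indicator)
  qed
  also have "\<dots> = (\<integral>\<^sup>+ x. (\<integral>\<^sup>+ \<omega>. ennreal (stop x y) * (ennreal (surv k \<omega>) * indicator (?Q x) \<omega>) \<partial>M \<nu>) \<partial>count_space UNIV)"
    by (rule nn_integral_count_space_nn_integral) auto
  also have "\<dots> = (\<integral>\<^sup>+ x. ennreal (\<epsilon> * pmf \<mu> y) * (\<integral>\<^sup>+ \<omega>. ennreal (surv k \<omega>) * indicator {\<omega> \<in> space (M \<nu>). skel k \<omega> = x} \<omega> \<partial>M \<nu>) \<partial>count_space UNIV)"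
  proof (intro nn_integral_cong)
    fix x
    have "(\<integral>\<^sup>+ \<omega>. ennreal (surv k \<omega>) * indicator (?Q x) \<omega> \<partial>M \<nu>) =
      transition (indicator {y}) x (\<tau> * real (Suc k) - \<tau> * real k) *
      (\<integral>\<^sup>+ \<omega>. ennreal (surv k \<omega>) * indicator {\<omega> \<in> space (M \<nu>). skel k \<omega> = x} \<omega> \<partial>M \<nu>)"
      unfolding skel_def
      by (rule markov_weighted) (use \<tau> surv_filtration[of k "ennreal (\<tau> * real k)"] in \<open>auto simp: distrib_left\<close>)
    also have "\<tau> * real (Suc k) - \<tau> * real k = \<tau>" by (simp add: algebra_simps)
    finally have *: "(\<integral>\<^sup>+ \<omega>. ennreal (surv k \<omega>) * indicator (?Q x) \<omega> \<partial>M \<nu>) =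
      ennreal (p x y) * (\<integral>\<^sup>+ \<omega>. ennreal (surv k \<omega>) * indicator {\<omega> \<in> space (M \<nu>). skel k \<omega> = x} \<omega> \<partial>M \<nu>)"
      unfolding transition_p .
    have "ennreal (stop x y) * ennreal (p x y) = ennreal (\<epsilon> * pmf \<mu> y)"
      using p_pos[of x y] stop_bounds[of x y] by (simp add: ennreal_mult[symmetric]) (simp add: stop_def)
    then show "(\<integral>\<^sup>+ \<omega>. ennreal (stop x y) * (ennreal (surv k \<omega>) * indicator (?Q x) \<omega>) \<partial>M \<nu>) =
      ennreal (\<epsilon> * pmf \<mu> y) * (\<integral>\<^sup>+ \<omega>. ennreal (surv k \<omega>) * indicator {\<omega> \<in> space (M \<nu>). skel k \<omega> = x} \<omega> \<partial>M \<nu>)"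
      by (subst nn_integral_cmult) (auto simp: * mult.assoc[symmetric])
  qed
  also have "\<dots> = ennreal (\<epsilon> * pmf \<mu> y) * (\<integral>\<^sup>+ \<omega>. (\<integral>\<^sup>+ x. ennreal (surv k \<omega>) * indicator {\<omega> \<in> space (M \<nu>). skel k \<omega> = x} \<omega> \<partial>count_space UNIV) \<partial>M \<nu>)"
    by (subst nn_integral_count_space_nn_integral) (auto simp: nn_integral_cmult)
  also have "(\<integral>\<^sup>+ \<omega>. (\<integral>\<^sup>+ x. ennreal (surv k \<omega>) * indicator {\<omega> \<in> space (M \<nu>). skel k \<omega> = x} \<omega> \<partial>count_space UNIV) \<partial>M \<nu>) = mass k"
    unfolding mass_def by (intro nn_integral_cong split[symmetric])
  finally show ?thesis .
qed

lemma emeasure_U_le: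
  assumes W: "W \<in> borel_measurable (\<F> \<nu> \<infinity>)" "\<And>\<omega>. W \<omega> \<le> 1"
  shows "emeasure (M \<nu>) {\<omega> \<in> space (M \<nu>). U \<omega> \<le> W \<omega>} = (\<integral>\<^sup>+ \<omega>. ennreal (W \<omega>) \<partial>M \<nu>)"
  by (rule emeasure_uniform_le[OF U W(1) _ W(2) U_indep]) (simp add: subalgebra_def filtration_subset)

lemma AE_U: "AE \<omega> in M \<nu>. 0 < U \<omega> \<and> U \<omega> \<le> 1"
proof -
  have "emeasure (M \<nu>) {\<omega> \<in> space (M \<nu>). U \<omega> \<le> 0} = 0"
    using emeasure_U_le[of "\<lambda>_. 0"] by simp
  then have "AE \<omega> in M \<nu>. \<not> U \<omega> \<le> 0" by (subst AE_iff_measurable) auto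
  moreover have "prob {\<omega> \<in> space (M \<nu>). U \<omega> \<le> 1} = 1"
    using emeasure_U_le[of "\<lambda>_. 1"] by (simp add: measure_def emeasure_space_1)
  then have "AE \<omega> in M \<nu>. U \<omega> \<le> 1" by (subst (asm) prob_Collect_eq_1) auto
  ultimately show ?thesis by eventually_elim auto
qed

text \<open>Stopping at step \<open>Suc k\<close> means that \<open>U\<close> falls between two
  consecutive survival values. The probability is a difference of two masses of the form
  \<open>U \<le> W\<close>, evaluated with \<open>integral_stop\<close>.\<close>

lemma emeasure_stopped:
  "emeasure (M \<nu>) {\<omega> \<in> space (M \<nu>). surv (Suc k) \<omega> < U \<omega> \<and> U \<omega> \<le> surv k \<omega> \<and> skel (Suc k) \<omega> = y} =
    ennreal (\<epsilon> * pmf \<mu> y) * mass k"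
proof -
  \<comment> \<open>Where the state differs from \<open>y\<close>, the value 0 makes
    \<open>U \<le> W j\<close> almost surely false, so the condition on the state is carried by
    \<open>W\<close>.\<close>
  define W where "W j \<omega> = (if skel (Suc k) \<omega> = y then surv j \<omega> else 0)" for j \<omega>
  have W: "W j \<in> borel_measurable (\<F> \<nu> \<infinity>)" for j
  proof -
    have [measurable]: "skel (Suc k) \<in> measurable (\<F> \<nu> \<infinity>) (count_space UNIV)" "surv j \<in> borel_measurable (\<F> \<nu> \<infinity>)"
      by (simp_all add: skel_filtration surv_filtration)
    show ?thesis unfolding W_def[abs_def] by measurable
  qed
  have W1: "W j \<omega> \<le> 1" for j \<omega> by (simp add: W_def surv_le_1)
  have Wm [measurable]: "W j \<in> borel_measurable (M \<nu>)" for j unfolding W_def[abs_def] by measurable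
  have W_le: "W (Suc k) \<omega> \<le> W k \<omega>" for \<omega> by (simp add: W_def surv_Suc_le)
  let ?E = "\<lambda>j. {\<omega> \<in> space (M \<nu>). U \<omega> \<le> W j \<omega>}"
  let ?D = "{\<omega> \<in> space (M \<nu>). surv (Suc k) \<omega> < U \<omega> \<and> U \<omega> \<le> surv k \<omega> \<and> skel (Suc k) \<omega> = y}"
  have "emeasure (M \<nu>) ?D = emeasure (M \<nu>) (?E k - ?E (Suc k))"
  proof (rule emeasure_eq_AE, use AE_U in eventually_elim)
    case (elim \<omega>) then show ?case by (auto simp: W_def)
  qed auto
  also have "\<dots> = emeasure (M \<nu>) (?E k) - emeasure (M \<nu>) (?E (Suc k))"
    using W_le by (intro emeasure_Diff) (auto intro: order_trans)
  also have "emeasure (M \<nu>) (?E k) = (\<integral>\<^sup>+ \<omega>. ennreal (W (Suc k) \<omega>) +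
      ennreal (surv k \<omega> * stop (skel k \<omega>) (skel (Suc k) \<omega>)) * indicator {\<omega> \<in> space (M \<nu>). skel (Suc k) \<omega> = y} \<omega> \<partial>M \<nu>)"
    unfolding emeasure_U_le[OF W W1]
  proof (intro nn_integral_cong)
    fix \<omega> assume "\<omega> \<in> space (M \<nu>)"
    then show "ennreal (W k \<omega>) = ennreal (W (Suc k) \<omega>) +
      ennreal (surv k \<omega> * stop (skel k \<omega>) (skel (Suc k) \<omega>)) * indicator {\<omega> \<in> space (M \<nu>). skel (Suc k) \<omega> = y} \<omega>"
      using surv_nonneg[of "Suc k" \<omega>] surv_nonneg[of k \<omega>] stop_bounds
      by (auto simp: W_def ennreal_plus[symmetric] surv_Suc algebra_simps simp del: ennreal_plus)
  qed
  also have "\<dots> = emeasure (M \<nu>) (?E (Suc k)) + ennreal (\<epsilon> * pmf \<mu> y) * mass k"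
  proof -
    have [measurable]: "(\<lambda>\<omega>. stop (skel k \<omega>) (skel (Suc k) \<omega>)) \<in> borel_measurable (M \<nu>)"
      by (rule stop_skel_measurable) measurable
    show ?thesis unfolding emeasure_U_le[OF W W1] integral_stop[symmetric]
      by (rule nn_integral_add) measurable
  qed
  finally show ?thesis by (simp add: ennreal_add_diff_cancel_left)
qed

lemma emeasure_stopped_set:
  "emeasure (M \<nu>) {\<omega> \<in> space (M \<nu>). surv (Suc k) \<omega> < U \<omega> \<and> U \<omega> \<le> surv k \<omega> \<and> skel (Suc k) \<omega> \<in> A} =
    ennreal \<epsilon> * mass k * emeasure (measure_pmf \<mu>) A"
proof -
  let ?D = "{\<omega> \<in> space (M \<nu>). surv (Suc k) \<omega> < U \<omega> \<and> U \<omega> \<le> surv k \<omega> \<and> skel (Suc k) \<omega> \<in> A}"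
  have "emeasure (M \<nu>) ?D = (\<integral>\<^sup>+ y. emeasure (M \<nu>) (?D \<inter> {\<omega> \<in> space (M \<nu>). skel (Suc k) \<omega> = y}) \<partial>count_space UNIV)"
    by (rule emeasure_split_countable) measurable
  also have "\<dots> = (\<integral>\<^sup>+ y. (ennreal \<epsilon> * mass k) * (ennreal (pmf \<mu> y) * indicator A y) \<partial>count_space UNIV)"
  proof (intro nn_integral_cong)
    fix y
    show "emeasure (M \<nu>) (?D \<inter> {\<omega> \<in> space (M \<nu>). skel (Suc k) \<omega> = y}) = (ennreal \<epsilon> * mass k) * (ennreal (pmf \<mu> y) * indicator A y)"
    proof (cases "y \<in> A")
      case True
      then have "?D \<inter> {\<omega> \<in> space (M \<nu>). skel (Suc k) \<omega> = y} =
        {\<omega> \<in> space (M \<nu>). surv (Suc k) \<omega> < U \<omega> \<and> U \<omega> \<le> surv k \<omega> \<and> skel (Suc k) \<omega> = y}" by auto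
      then show ?thesis using True \<epsilon> by (simp add: emeasure_stopped ennreal_mult mult_ac)
    next
      case False
      then have "?D \<inter> {\<omega> \<in> space (M \<nu>). skel (Suc k) \<omega> = y} = {}" by auto
      then show ?thesis using False by simp
    qed
  qed
  also have "\<dots> = (ennreal \<epsilon> * mass k) * (\<integral>\<^sup>+ y. ennreal (pmf \<mu> y) * indicator A y \<partial>count_space UNIV)"
    by (rule nn_integral_cmult) simp
  also have "(\<integral>\<^sup>+ y. ennreal (pmf \<mu> y) * indicator A y \<partial>count_space UNIV) = emeasure (measure_pmf \<mu>) A"
    by (simp add: nn_integral_count_space_indicator[symmetric] nn_integral_pmf)
  finally show ?thesis .
qed

end

context sst_construction
begin

lemma U_le_surv: "emeasure (M \<nu>) {\<omega> \<in> space (M \<nu>). U \<omega> \<le> surv k \<omega>} = mass k"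
  unfolding mass_def by (rule emeasure_U_le) (auto intro: surv_filtration surv_le_1)

lemma mass_Suc: "mass k = mass (Suc k) + ennreal \<epsilon> * mass k"
proof -
  have "mass k = emeasure (M \<nu>) ({\<omega> \<in> space (M \<nu>). U \<omega> \<le> surv (Suc k) \<omega>} \<union>
      {\<omega> \<in> space (M \<nu>). surv (Suc k) \<omega> < U \<omega> \<and> U \<omega> \<le> surv k \<omega> \<and> skel (Suc k) \<omega> \<in> UNIV})"
    unfolding U_le_surv[symmetric] using surv_Suc_le
    by (intro arg_cong2[where f=emeasure]) (auto intro: order_trans)
  also have "\<dots> = mass (Suc k) + ennreal \<epsilon> * mass k"
    by (subst plus_emeasure[symmetric])
       (auto simp: U_le_surv emeasure_stopped_set[of k UNIV, simplified] measure_pmf.emeasure_space_1[simplified])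
  finally show ?thesis .
qed

text \<open>Each step stops a fraction \<open>\<epsilon>\<close> of the surviving mass, so survival
  is geometric. That \<open>\<epsilon>\<close> is at most 1 follows from nonnegativity of the mass
  after one step.\<close>

lemma mass_eq: "mass k = ennreal ((1 - \<epsilon>) ^ k)" and \<epsilon>_le_1: "\<epsilon> \<le> 1"
proof -
  define m where "m k = enn2real (mass k)" for k
  have m: "mass k = ennreal (m k)" for k
    unfolding m_def using mass_finite[of k] by (intro ennreal_enn2real[symmetric]) (auto intro: le_less_trans)
  have m0: "0 \<le> m k" for k by (simp add: m_def)
  have Suc: "m (Suc k) = (1 - \<epsilon>) * m k" for k
  proof -
    have "ennreal (m k) = ennreal (m (Suc k) + \<epsilon> * m k)"
      using mass_Suc[of k] \<epsilon> m0 by (simp add: m ennreal_mult[symmetric])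
    then have "m k = m (Suc k) + \<epsilon> * m k"
      using m0[of k] m0[of "Suc k"] \<epsilon> by (subst (asm) ennreal_inj) auto
    then show ?thesis by (simp add: algebra_simps)
  qed
  have m_0: "m 0 = 1" by (simp add: m_def mass_def emeasure_space_1)
  show "\<epsilon> \<le> 1" using Suc[of 0] m0[of 1] m_0 by simp
  have "m k = (1 - \<epsilon>) ^ k" by (induction k) (simp_all add: m_0 Suc)
  then show "mass k = ennreal ((1 - \<epsilon>) ^ k)" by (simp add: m)
qed

lemma AE_stopped: "AE \<omega> in M \<nu>. \<exists>k. surv k \<omega> < U \<omega>"
proof -
  let ?N = "{\<omega> \<in> space (M \<nu>). \<forall>k. U \<omega> \<le> surv k \<omega>}"
  have "prob ?N \<le> (1 - \<epsilon>) ^ k" for k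
  proof -
    have "prob ?N \<le> prob {\<omega> \<in> space (M \<nu>). U \<omega> \<le> surv k \<omega>}"
      by (intro finite_measure_mono) auto
    also have "\<dots> = (1 - \<epsilon>) ^ k"
      using U_le_surv[of k] \<epsilon>_le_1 by (simp add: mass_eq measure_def)
    finally show ?thesis .
  qed
  moreover have "(\<lambda>k. (1 - \<epsilon>) ^ k) \<longlonglongrightarrow> 0" using \<epsilon> \<epsilon>_le_1 by (intro LIMSEQ_power_zero) auto
  ultimately have "prob ?N \<le> 0" by (intro LIMSEQ_le_const) auto
  then have "emeasure (M \<nu>) ?N = 0" by (simp add: emeasure_eq_measure measure_le_0_iff)
  then have "AE \<omega> in M \<nu>. \<not> (\<forall>k. U \<omega> \<le> surv k \<omega>)" by (subst AE_iff_measurable[where N="?N"]) auto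
  then show ?thesis by eventually_elim (auto simp: not_le)
qed

section \<open>The stopping time and its joint law with the stopped state\<close>

definition hit :: "'a \<Rightarrow> nat" where "hit \<omega> = (LEAST k. surv k \<omega> < U \<omega>)"

text \<open>\<open>hit\<close> is unspecified if no index qualifies; this null event is sent to
  \<open>\<infinity>\<close>.\<close>

definition sst :: "'a \<Rightarrow> ennreal" where
  "sst \<omega> = (if \<exists>k. surv k \<omega> < U \<omega> then ennreal (\<tau> * real (hit \<omega>)) else \<infinity>)"

lemma hit_measurable [measurable]: "hit \<in> measurable (M \<nu>) (count_space UNIV)"
  unfolding hit_def[abs_def] by measurable

text \<open>Every index with \<open>surv k < U\<close> bounds the least one from above, so only grid
  times up to \<open>u\<close> are inspected, and at these \<open>surv k\<close> is known by time
  \<open>u\<close>. For \<open>u = \<infinity>\<close> the right-hand side would miss the paths that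
  never stop.\<close>

lemma sst_le_iff:
  assumes "u \<noteq> \<infinity>"
  shows "sst \<omega> \<le> u \<longleftrightarrow> (\<exists>k. ennreal (\<tau> * real k) \<le> u \<and> surv k \<omega> < U \<omega>)"
proof
  assume "sst \<omega> \<le> u"
  then have ex: "\<exists>k. surv k \<omega> < U \<omega>" and le: "ennreal (\<tau> * real (hit \<omega>)) \<le> u"
    using assms by (auto simp: sst_def top_unique split: if_splits)
  have "surv (hit \<omega>) \<omega> < U \<omega>" unfolding hit_def using ex by (rule LeastI_ex)
  then show "\<exists>k. ennreal (\<tau> * real k) \<le> u \<and> surv k \<omega> < U \<omega>" using le by blast
next
  assume "\<exists>k. ennreal (\<tau> * real k) \<le> u \<and> surv k \<omega> < U \<omega>"
  then obtain k where k: "ennreal (\<tau> * real k) \<le> u" "surv k \<omega> < U \<omega>" by blast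
  have "hit \<omega> \<le> k" unfolding hit_def using k(2) by (rule Least_le)
  then have "ennreal (\<tau> * real (hit \<omega>)) \<le> ennreal (\<tau> * real k)" using \<tau> by (intro ennreal_leI) auto
  then show "sst \<omega> \<le> u" using k by (auto simp: sst_def intro: order_trans)
qed

abbreviation G :: "'a measure" where "G \<equiv> vimage_algebra (space (M \<nu>)) U borel"

lemma subalgebra_G: "subalgebra (M \<nu>) G"
  unfolding subalgebra_def by (auto simp: sets_vimage_algebra2)

lemma stopping_time_sst: "stopping_time (enlarged \<nu> G) sst"
proof
  fix u :: ennreal
  show "Measurable.pred (enlarged \<nu> G u) (\<lambda>\<omega>. sst \<omega> \<le> u)"
  proof (cases "u = \<infinity>")
    case False
    have "Measurable.pred (enlarged \<nu> G u) (\<lambda>\<omega>. ennreal (\<tau> * real k) \<le> u \<and> surv k \<omega> < U \<omega>)" for k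
    proof (cases "ennreal (\<tau> * real k) \<le> u")
      case True
      have F: "subalgebra (enlarged \<nu> G u) (\<F> \<nu> u)" "subalgebra (enlarged \<nu> G u) G"
        unfolding subalgebra_def sets_enlarged[OF subalgebra_G] using subalgebra_G by auto
      have [measurable]: "surv k \<in> borel_measurable (enlarged \<nu> G u)"
        by (rule measurable_from_subalg[OF F(1) surv_filtration[OF True]])
      have [measurable]: "U \<in> borel_measurable (enlarged \<nu> G u)"
        by (rule measurable_from_subalg[OF F(2)]) (rule measurable_vimage_algebra1, simp)
      show ?thesis using True by simp
    qed simp
    then show ?thesis unfolding sst_le_iff[OF False] by measurable
  qed simp
qed

lemma sst_measurable [measurable]: "sst \<in> borel_measurable (M \<nu>)"
  unfolding sst_def[abs_def] by measurable

lemma AE_sst_finite: "AE \<omega> in M \<nu>. sst \<omega> < \<infinity>"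
  using AE_stopped by eventually_elim (simp add: sst_def)

text \<open>Whatever the step of the stop, the stopped state has law \<open>\<mu>\<close>; hence
  time and state are independent.\<close>

lemma sst_law:
  assumes B [measurable]: "B \<in> sets borel"
  shows "emeasure (M \<nu>) {\<omega> \<in> space (M \<nu>). sst \<omega> \<in> B \<and> X \<nu> (enn2real (sst \<omega>)) \<omega> \<in> A} =
    emeasure (M \<nu>) {\<omega> \<in> space (M \<nu>). sst \<omega> \<in> B} * emeasure (measure_pmf \<mu>) A"
proof -
  have [measurable]: "(\<lambda>\<omega>. X \<nu> (enn2real (sst \<omega>)) \<omega>) \<in> measurable (M \<nu>) (count_space UNIV)"
    by (rule X_at_random_time_measurable) auto
  \<comment> \<open>The mass of stopping at step \<open>k\<close> with the time in \<open>B\<close>,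
    the same for all \<open>A\<close>. Nothing is stopped at step 0, since \<open>surv 0 = 1\<close>
    and \<open>U\<close> is almost surely at most 1.\<close>
  define c where "c k = (case k of 0 \<Rightarrow> 0 | Suc j \<Rightarrow> indicator B (ennreal (\<tau> * real k)) * (ennreal \<epsilon> * mass j))" for k
  have "emeasure (M \<nu>) {\<omega> \<in> space (M \<nu>). sst \<omega> \<in> B \<and> X \<nu> (enn2real (sst \<omega>)) \<omega> \<in> A} =
    (\<integral>\<^sup>+ k. c k \<partial>count_space UNIV) * emeasure (measure_pmf \<mu>) A" for A
  proof -
    let ?C = "{\<omega> \<in> space (M \<nu>). sst \<omega> \<in> B \<and> X \<nu> (enn2real (sst \<omega>)) \<omega> \<in> A}"
    have "emeasure (M \<nu>) ?C = (\<integral>\<^sup>+ k. emeasure (M \<nu>) (?C \<inter> {\<omega> \<in> space (M \<nu>). hit \<omega> = k}) \<partial>count_space UNIV)"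
      by (rule emeasure_split_countable) measurable
    also have "\<dots> = (\<integral>\<^sup>+ k. c k * emeasure (measure_pmf \<mu>) A \<partial>count_space UNIV)"
    proof (intro nn_integral_cong)
      fix k
      have k_iff: "hit \<omega> = k \<longleftrightarrow> (\<exists>j. k = Suc j \<and> surv k \<omega> < U \<omega> \<and> U \<omega> \<le> surv j \<omega>)"
        if "\<exists>k. surv k \<omega> < U \<omega>" "U \<omega> \<le> 1" for \<omega>
      proof
        assume hk: "hit \<omega> = k"
        have k: "surv k \<omega> < U \<omega>" unfolding hk[symmetric] hit_def using that(1) by (rule LeastI_ex)
        with that(2) have "k \<noteq> 0" by (cases k) auto
        then obtain j where j: "k = Suc j" using not0_implies_Suc by blast
        have "\<not> surv j \<omega> < U \<omega>" using not_less_Least[of j "\<lambda>k. surv k \<omega> < U \<omega>"] hk j by (simp add: hit_def)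
        then show "\<exists>j. k = Suc j \<and> surv k \<omega> < U \<omega> \<and> U \<omega> \<le> surv j \<omega>" using j k by auto
      next
        assume "\<exists>j. k = Suc j \<and> surv k \<omega> < U \<omega> \<and> U \<omega> \<le> surv j \<omega>"
        then obtain j where j: "k = Suc j" "surv k \<omega> < U \<omega>" "U \<omega> \<le> surv j \<omega>" by blast
        show "hit \<omega> = k" unfolding hit_def
        proof (rule Least_equality)
          fix i assume i: "surv i \<omega> < U \<omega>"
          show "k \<le> i"
          proof (rule ccontr)
            assume "\<not> k \<le> i"
            then have "surv j \<omega> \<le> surv i \<omega>" using j(1) by (intro surv_antimono) simp
            then show False using i j(3) by simp
          qed
        qed (rule j(2))
      qed
      have sst_k: "sst \<omega> = ennreal (\<tau> * real k)" "X \<nu> (enn2real (sst \<omega>)) \<omega> = skel k \<omega>"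
        if "\<exists>k. surv k \<omega> < U \<omega>" "hit \<omega> = k" for \<omega>
        using that \<tau> by (simp_all add: sst_def skel_def)
      show "emeasure (M \<nu>) (?C \<inter> {\<omega> \<in> space (M \<nu>). hit \<omega> = k}) = c k * emeasure (measure_pmf \<mu>) A"
      proof (cases k)
        case 0
        have "emeasure (M \<nu>) (?C \<inter> {\<omega> \<in> space (M \<nu>). hit \<omega> = k}) = emeasure (M \<nu>) {}"
        proof (rule emeasure_eq_AE, use AE_stopped AE_U in eventually_elim)
          case (elim \<omega>) then show ?case using k_iff[of \<omega>] 0 by auto
        qed auto
        then show ?thesis by (simp add: c_def 0)
      next
        case (Suc j)
        let ?D = "{\<omega> \<in> space (M \<nu>). surv (Suc j) \<omega> < U \<omega> \<and> U \<omega> \<le> surv j \<omega> \<and> skel (Suc j) \<omega> \<in> A}"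
        have "emeasure (M \<nu>) (?C \<inter> {\<omega> \<in> space (M \<nu>). hit \<omega> = k}) =
          emeasure (M \<nu>) (if ennreal (\<tau> * real k) \<in> B then ?D else {})"
        proof (rule emeasure_eq_AE, use AE_stopped AE_U in eventually_elim)
          case (elim \<omega>)
          have "hit \<omega> = k \<longleftrightarrow> surv (Suc j) \<omega> < U \<omega> \<and> U \<omega> \<le> surv j \<omega>"
            using k_iff[of \<omega>] elim Suc by auto
          then show ?case using sst_k[OF elim(1)] Suc by auto
        qed auto
        also have "\<dots> = indicator B (ennreal (\<tau> * real k)) * emeasure (M \<nu>) ?D" by auto
        also have "\<dots> = c k * emeasure (measure_pmf \<mu>) A"
          unfolding emeasure_stopped_set c_def Suc by (simp add: mult.assoc)
        finally show ?thesis .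
      qed
    qed
    also have "\<dots> = (\<integral>\<^sup>+ k. c k \<partial>count_space UNIV) * emeasure (measure_pmf \<mu>) A"
      by (rule nn_integral_multc) simp
    finally show ?thesis .
  qed
  \<comment> \<open>The case of all states identifies the sum of the \<open>c k\<close> as the
    probability that the time lies in \<open>B\<close>.\<close>
  from this[of A] this[of UNIV] show ?thesis
    by (simp add: measure_pmf.emeasure_space_1[simplified])
qed

lemma finite_strong_stationary_time_sst: "finite_strong_stationary_time \<mu> (M \<nu>) (X \<nu>) sst"
  unfolding finite_strong_stationary_time_def strong_stationary_time_def
proof (intro conjI allI AE_sst_finite)
  show "randomized_stopping_time (M \<nu>) (X \<nu>) sst"
    unfolding randomized_stopping_time_def
    using subalgebra_G U_indep stopping_time_sst[unfolded enlarged_def[abs_def]] by blast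
  fix A
  define F where "F = vimage_algebra (space (M \<nu>)) sst borel"
  have F: "subalgebra (M \<nu>) F"
    unfolding F_def subalgebra_def by (auto simp: sets_vimage_algebra2)
  interpret finite_measure_subalgebra "M \<nu>" F by unfold_locales (rule F)
  let ?C = "{\<omega> \<in> space (M \<nu>). X \<nu> (enn2real (sst \<omega>)) \<omega> \<in> A}"
  have XT [measurable]: "(\<lambda>\<omega>. X \<nu> (enn2real (sst \<omega>)) \<omega>) \<in> measurable (M \<nu>) (count_space UNIV)"
    by (rule X_at_random_time_measurable) auto
  have C [measurable]: "?C \<in> sets (M \<nu>)"
    using measurable_sets[OF XT, of A] by (simp add: vimage_def Int_def conj_commute)
  \<comment> \<open>The constant is tested as conditional expectation: every event of
    \<open>F\<close> has the form that the time lies in a Borel set, where \<open>sst_law\<close> is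
    the defining identity.\<close>
  have "AE \<omega> in M \<nu>. real_cond_exp (M \<nu>) F (indicator ?C) \<omega> = (\<lambda>_. measure_pmf.prob \<mu> A) \<omega>"
  proof (rule real_cond_exp_charact)
    fix E assume "E \<in> sets F"
    then obtain B where B [measurable]: "B \<in> sets borel" and E: "E = sst -` B \<inter> space (M \<nu>)"
      unfolding F_def by (auto simp: sets_vimage_algebra2)
    have [measurable]: "E \<in> sets (M \<nu>)" unfolding E by measurable
    have "(\<integral>\<omega>\<in>E. indicator ?C \<omega> \<partial>M \<nu>) = (\<integral>\<omega>. indicator (E \<inter> ?C) \<omega> \<partial>M \<nu>)"
      unfolding set_lebesgue_integral_def by (intro Bochner_Integration.integral_cong) (auto split: split_indicator)
    also have "\<dots> = prob (E \<inter> ?C)" by simp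
    also have "E \<inter> ?C = {\<omega> \<in> space (M \<nu>). sst \<omega> \<in> B \<and> X \<nu> (enn2real (sst \<omega>)) \<omega> \<in> A}" by (auto simp: E)
    also have "prob \<dots> = prob {\<omega> \<in> space (M \<nu>). sst \<omega> \<in> B} * measure_pmf.prob \<mu> A"
      using sst_law[OF B, of A] by (simp add: measure_def enn2real_mult)
    also have "{\<omega> \<in> space (M \<nu>). sst \<omega> \<in> B} = E" by (auto simp: E)
    also have "prob E * measure_pmf.prob \<mu> A = (\<integral>\<omega>\<in>E. measure_pmf.prob \<mu> A \<partial>M \<nu>)"
      by (simp add: set_lebesgue_integral_def)
    finally show "(\<integral>\<omega>\<in>E. indicator ?C \<omega> \<partial>M \<nu>) = (\<integral>\<omega>\<in>E. measure_pmf.prob \<mu> A \<partial>M \<nu>)" .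
  qed (auto intro!: integrable_real_indicator simp: less_top[symmetric])
  then show "AE \<omega> in M \<nu>. sst \<omega> < \<infinity> \<longrightarrow>
    real_cond_exp (M \<nu>) (vimage_algebra (space (M \<nu>)) sst borel) (indicator ?C) \<omega> = measure_pmf.prob \<mu> A"
    unfolding F_def by eventually_elim simp
qed

end

section \<open>The equivalence, assembled from both directions\<close>

theorem theorem3p5:
  fixes a b :: "int \<Rightarrow> real"
    and \<mu> :: "int pmf"
    and M :: "int pmf \<Rightarrow> 'a measure"
    and X :: "int pmf \<Rightarrow> real \<Rightarrow> 'a \<Rightarrow> int"
  assumes "\<And>n. a n > 0"
    and "\<And>n. b n > 0"
    and "nonexplosive (bd_generator a b)"
    and "positive_recurrent (bd_generator a b)"
    and "\<And>n. pmf \<mu> n * b n = pmf \<mu> (n + 1) * a (n + 1)"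
    and "(\<lambda>n. pmf \<mu> n * b n) summable_on UNIV"
    and "\<And>\<nu>. markov_process (bd_generator a b) \<nu> (M \<nu>) (X \<nu>)"
    and "\<And>\<nu>. large_enough (M \<nu>) (X \<nu>)"
  shows "(\<forall>\<nu>. \<exists>T. finite_strong_stationary_time \<mu> (M \<nu>) (X \<nu>) T) \<longleftrightarrow>
     (\<lambda>i::int. pmf \<mu> (i + 1) * (\<Sum>j=1..i. 1 / (pmf \<mu> j * b j))) summable_on {1..} \<and>
     (\<lambda>i::int. pmf \<mu> (- i - 1) * (\<Sum>j=1..i. 1 / (pmf \<mu> (- j) * a (- j)))) summable_on {1..}"
proof -
  interpret bd_family a b M X
    using assms by unfold_locales
  have \<mu>_pos: "0 < pmf \<mu> n" for n
  proof -
    obtain n0 where "n0 \<in> set_pmf \<mu>" using set_pmf_not_empty[of \<mu>] by blast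
    then have n0: "0 < pmf \<mu> n0" by (simp add: pmf_positive)
    \<comment> \<open>Detailed balance carries positivity from one point of the support to both
      neighbours.\<close>
    have step: "0 < pmf \<mu> m \<longleftrightarrow> 0 < pmf \<mu> (m + 1)" for m
      using assms(5)[of m] assms(1)[of "m + 1"] assms(2)[of m]
      by (metis less_irrefl mult_pos_pos zero_less_mult_pos2)
    show ?thesis
    proof (induction n rule: int_induct[where k=n0])
      case (step2 i) then show ?case using step[of "i - 1"] by simp
    qed (use n0 step in auto)
  qed
  have bal: "bd_balance a b (pmf \<mu>)"
  proof
    show "pmf \<mu> summable_on UNIV"
    proof (rule nonneg_bdd_above_summable_on)
      show "bdd_above (sum (pmf \<mu>) ` {F. F \<subseteq> UNIV \<and> finite F})"
        by (rule bdd_aboveI2[of _ _ 1]) (auto simp: measure_measure_pmf_finite[symmetric])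
    qed simp
  qed (use assms \<mu>_pos in auto)
  \<comment> \<open>The total flux dominates each single edge and serves as the constant in the
    scale estimates.\<close>
  define K where "K = infsum (\<lambda>n. pmf \<mu> n * b n) UNIV"
  have K: "pmf \<mu> n * b n \<le> K" for n
    using finite_sum_le_infsum[OF assms(6), of "{n}"] assms(2) by (simp add: K_def less_imp_le)
  show ?thesis
  proof
    assume "\<forall>\<nu>. \<exists>T. finite_strong_stationary_time \<mu> (M \<nu>) (X \<nu>) T"
    then obtain T where "finite_strong_stationary_time \<mu> (M (return_pmf 0)) (X (return_pmf 0)) T" by blast
    from resolvent_lower_bound_of_strong_stationary_time[OF this refl assms(5)]
    obtain \<eta> where \<eta>: "0 < \<eta>" "\<And>y. ennreal (\<eta> * pmf \<mu> y) \<le> resolvent 1 (indicator {y}) 0" by blast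
    \<comment> \<open>The weight of \<open>y\<close> in the lower bound cancels against the one from
      reversibility, so the bound no longer depends on the starting state \<open>y\<close>.\<close>
    have low: "ennreal (\<eta> * pmf \<mu> 0) \<le> resolvent 1 (indicator {0}) y" for y
    proof -
      have "ennreal (pmf \<mu> y) * ennreal (\<eta> * pmf \<mu> 0) = ennreal (pmf \<mu> 0) * ennreal (\<eta> * pmf \<mu> y)"
        using \<eta>(1) by (simp add: ennreal_mult[symmetric] mult_ac)
      also have "\<dots> \<le> ennreal (pmf \<mu> 0) * resolvent 1 (indicator {y}) 0" by (intro mult_left_mono \<eta>) simp
      also have "\<dots> = ennreal (pmf \<mu> y) * resolvent 1 (indicator {0}) y"
        by (rule resolvent_symmetric) (auto simp: assms(5))
      finally have "ennreal (1 / pmf \<mu> y) * (ennreal (pmf \<mu> y) * ennreal (\<eta> * pmf \<mu> 0)) \<le>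
          ennreal (1 / pmf \<mu> y) * (ennreal (pmf \<mu> y) * resolvent 1 (indicator {0}) y)"
        by (rule mult_left_mono) simp
      moreover have "ennreal (1 / pmf \<mu> y) * (ennreal (pmf \<mu> y) * v) = v" for v
        using \<mu>_pos[of y] by (simp add: mult.assoc[symmetric] ennreal_mult[symmetric])
      ultimately show ?thesis by (simp only:)
    qed
    have "0 < \<eta> * pmf \<mu> 0" using \<eta>(1) \<mu>_pos[of 0] by simp
    from entrance_of_resolvent_bound[OF bal K this low]
    show "(\<lambda>i::int. pmf \<mu> (i + 1) * (\<Sum>j=1..i. 1 / (pmf \<mu> j * b j))) summable_on {1..} \<and>
     (\<lambda>i::int. pmf \<mu> (- i - 1) * (\<Sum>j=1..i. 1 / (pmf \<mu> (- j) * a (- j)))) summable_on {1..}" by blast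
  next
    assume entrance: "(\<lambda>i::int. pmf \<mu> (i + 1) * (\<Sum>j=1..i. 1 / (pmf \<mu> j * b j))) summable_on {1..} \<and>
     (\<lambda>i::int. pmf \<mu> (- i - 1) * (\<Sum>j=1..i. 1 / (pmf \<mu> (- j) * a (- j)))) summable_on {1..}"
    obtain h H c where "\<And>n. 0 \<le> h n" "\<And>n. h n \<le> H" "0 < c"
      "\<And>n. b n * h (n + 1) + a n * h (n - 1) + 1 \<le> (a n + b n) * h n + c * indicator {0} n"
      using bd_balance.Lyapunov_entrance[OF bal] entrance by blast
    from uniform_minorisation[OF assms(5) \<mu>_pos this]
    obtain \<tau> \<epsilon> where \<tau>: "0 < \<tau>" "0 < \<epsilon>" "\<And>x y. ennreal (\<epsilon> * pmf \<mu> y) \<le> transition (indicator {y}) x \<tau>" by blast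
    show "\<forall>\<nu>. \<exists>T. finite_strong_stationary_time \<mu> (M \<nu>) (X \<nu>) T"
    proof
      fix \<nu>
      obtain U where U: "U \<in> borel_measurable (M \<nu>)" "distr (M \<nu>) borel U = uniform_measure lborel {0..1::real}"
        "prob_space.indep_set (M \<nu>) (sets (vimage_algebra (space (M \<nu>)) U borel)) (sets (\<F> \<nu> \<infinity>))"
        using assms(8)[of \<nu>] unfolding large_enough_def by blast
      interpret sst_construction a b M X \<nu> \<mu> U \<tau> \<epsilon>
        using U \<tau> \<mu>_pos by unfold_locales
      show "\<exists>T. finite_strong_stationary_time \<mu> (M \<nu>) (X \<nu>) T"
        using finite_strong_stationary_time_sst by blast
    qed
  qed
qed

end
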